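(* Let $\mathbb H$ be a graded affine Hecke algebra, $\Pi_M\subset\Pi$, and suppose the (finite dimensional) $\mathbb H_M$-module $(\sigma,U_\sigma)$ has a $\bullet$-invariant hermitian form $\langle\ ,\ \rangle_{\sigma,\bullet}$. Write $\widetilde M=\delta(M)$, $w^0=w^0_M$ and $R^0=R_{w^0_M}$. Then the form $$\langle h_1\otimes v_1,h_2\otimes v_2\rangle_\bullet=\big\langle a\sigma\big[\epsilon_{\widetilde M}(t_{(w^0)^{-1}}\,h_2^\bullet\, h_1\, R^0)\big]v_1,\,v_2\big\rangle_{\sigma,\bullet},\qquad h_1,h_2\in\mathbb H,\ v_1,v_2\in U_\sigma,$$ on the induced module $X(M,\sigma)=\mathbb H\otimes_{\mathbb H_M}U_\sigma$ is $\bullet$-invariant and sesquilinear.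
   Context: Root data and algebra: $V,V^\vee$ are finite dimensional real vector spaces with a perfect pairing; $R\subset V$, $R^\vee\subset V^\vee$ form a reduced root system with Weyl group $W$, simple roots $\Pi$, positive roots $R^+$; $k:\Pi\to\mathbb R$ is constant on $W$-conjugate simple roots. $V_{\mathbb C}$ is the complexification of $V$ with conjugation $\bar{\ }$. The graded affine Hecke algebra $\mathbb H$ is the unital associative $\mathbb C$-algebra generated by $S(V_{\mathbb C})$ and $\{t_w:w\in W\}$ such that $w\otimes a\mapsto t_wa$ is an isomorphism $\mathbb C[W]\otimes S(V_{\mathbb C})\cong\mathbb H$ of $(\mathbb C[W],S(V_{\mathbb C}))$-bimodules and $a\,t_{s_\alpha}=t_{s_\alpha}s_\alpha(a)+k_\alpha\frac{a-s_\alpha(a)}{\alpha}$ for $\alpha\in\Pi$, $a\in S(V_{\mathbb C})$. The star operation $\bullet$ is the conjugate-linear anti-automorphism with $t_w^\bullet=t_{w^{-1}}$, $\omega^\bullet=\overline\omega$ ($\omega\in V_{\mathbb C}$). A form on a module $(\pi,X)$ is $\bullet$-invariant if $\langle\pi(h)x,y\rangle=\langle x,\pi(h^\bullet)y\rangle$ for all $h$. Parabolic subalgebras: for $\Pi_M\subset\Pi$, $W_M$ is generated by $s_\alpha$, $\alpha\in\Pi_M$, with longest element $w_{0,M}$; $\mathbb H_M$ is the subalgebra generated by $t_w$ ($w\in W_M$) and $S(V_{\mathbb C})$ (stable under $\bullet$). $\mathcal J_M$ is the set of minimal length representatives of $W/W_M$. Every $h\in\mathbb H$ is uniquely $h=\sum_{w\in\mathcal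 J_M}t_wm_w$ with $m_w\in\mathbb H_M$, and $\epsilon_M(h):=m_1$; the same formula is used for elements with rational coefficients. With $w_0$ the longest element of $W$, $\delta(\alpha)=-w_0(\alpha)$, $\Pi_{\delta(M)}=\delta(\Pi_M)$, $w^0_M=w_0w_{0,\delta(M)}=w_{0,M}w_0$. Transfer: $\phi(t_m)=t_{(w^0_M)^{-1}mw^0_M}$ ($m\in W_M$), $\phi(\omega)=(w^0_M)^{-1}(\omega)$ ($\omega\in V_{\mathbb C}$) defines an isomorphism $\mathbb H_M\to\mathbb H_{\delta(M)}$; the $\mathbb H_{\delta(M)}$-module $a\sigma$ is $U_{a\sigma}=U_\sigma$ with $(a\sigma)(m')=\sigma(\phi^{-1}(m'))$. Elements $R_w$: in $\hat{\mathbb H}=\mathbb H\otimes_{S(V_{\mathbb C})}\mathcal O$, where $\mathcal O$ is the ring of rational functions (the fraction field of $S(V_{\mathbb C})$), put $R_{s_\alpha}=t_{s_\alpha}\frac{\alpha}{k_\alpha-\alpha}-\frac{k_\alpha}{k_\alpha-\alpha}$ ($\alpha\in\Pi$) and $R_x=R_{s_{\alpha_1}}\cdots R_{s_{\alpha_k}}$ for a reduced expression $x=s_{\alpha_1}\cdots s_{\alpha_k}$ (independent of the choice).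
   Formalization: It is assumed that, for all h_1, h_2, the rational element ε(t_{(w^0)^{-1}} h_2^• h_1 R^0) can be evaluated under aσ, i.e. has a denominator in S(V_C) acting invertibly; otherwise the formula is undefined (e.g. rank one, M empty, aσ(α)=k≠0). *)

theory Defs
  imports
    Complex_Main
    "HOL-Library.Poly_Mapping"
    "HOL-Computational_Algebra.Fraction_Field"
begin

section \<open>Real root data\<close>

record ('v, 'd) root_data =
  pairing :: "'v \<Rightarrow> 'd \<Rightarrow> real"
  roots   :: "'v set"
  coroot  :: "'v \<Rightarrow> 'd"
  simple  :: "'v set"
  param   :: "'v \<Rightarrow> real"

definition fin_dim_real :: "'v::real_vector itself \<Rightarrow> bool" where
  "fin_dim_real _ \<longleftrightarrow> (\<exists>B::'v set. finite B \<and> span B = UNIV)"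

definition perfect_pairing :: "('v::real_vector \<Rightarrow> 'd::real_vector \<Rightarrow> real) \<Rightarrow> bool" where
  "perfect_pairing b \<longleftrightarrow>
     (\<forall>y. linear (\<lambda>x. b x y)) \<and> (\<forall>x. linear (b x)) \<and>
     (\<forall>f. linear f \<longrightarrow> (\<exists>!y. f = (\<lambda>x. b x y))) \<and>
     (\<forall>g. linear g \<longrightarrow> (\<exists>!x. g = b x))"

definition refl :: "('v::real_vector, 'd::real_vector, 'z) root_data_scheme \<Rightarrow> 'v \<Rightarrow> 'v \<Rightarrow> 'v" where
  "refl D \<alpha> = (\<lambda>x. x - pairing D x (coroot D \<alpha>) *\<^sub>R \<alpha>)"

definition corefl :: "('v::real_vector, 'd::real_vector, 'z) root_data_scheme \<Rightarrow> 'v \<Rightarrow> 'd \<Rightarrow> 'd" where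
  "corefl D \<alpha> = (\<lambda>y. y - pairing D \<alpha> y *\<^sub>R coroot D \<alpha>)"

text \<open>The roots need not span the space and the values of roots on coroots are not required to be
  integers.\<close>

definition reduced_root_system :: "('v::real_vector, 'd::real_vector, 'z) root_data_scheme \<Rightarrow> bool" where
  "reduced_root_system D \<longleftrightarrow>
     finite (roots D) \<and> inj_on (coroot D) (roots D) \<and>
     (\<forall>\<alpha>\<in>roots D. pairing D \<alpha> (coroot D \<alpha>) = 2 \<and>
        refl D \<alpha> ` roots D \<subseteq> roots D \<and>
        corefl D \<alpha> ` (coroot D ` roots D) \<subseteq> coroot D ` roots D \<and>
        (\<forall>c. c *\<^sub>R \<alpha> \<in> roots D \<longrightarrow> c = 1 \<or> c = - 1))"

definition simple_system :: "('v::real_vector, 'd::real_vector, 'z) root_data_scheme \<Rightarrow> bool" where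
  "simple_system D \<longleftrightarrow>
     simple D \<subseteq> roots D \<and> independent (simple D) \<and>
     (\<forall>\<beta>\<in>roots D. \<exists>c. (\<forall>\<alpha>\<in>simple D. 0 \<le> c \<alpha>) \<and>
        (\<beta> = (\<Sum>\<alpha>\<in>simple D. c \<alpha> *\<^sub>R \<alpha>) \<or> \<beta> = - (\<Sum>\<alpha>\<in>simple D. c \<alpha> *\<^sub>R \<alpha>)))"

text \<open>Reflections are involutions, so closure under left multiplication by them is enough to get
  the generated group.\<close>

inductive_set refl_group ::
  "('v::real_vector, 'd::real_vector, 'z) root_data_scheme \<Rightarrow> 'v set \<Rightarrow> ('v \<Rightarrow> 'v) set"
  for D A where
  one: "id \<in> refl_group D A"
| step: "\<alpha> \<in> A \<Longrightarrow> w \<in> refl_group D A \<Longrightarrow> refl D \<alpha> \<circ> w \<in> refl_group D A"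

definition weyl :: "('v::real_vector, 'd::real_vector, 'z) root_data_scheme \<Rightarrow> ('v \<Rightarrow> 'v) set" where
  "weyl D = refl_group D (roots D)"

definition root_datum :: "('v::real_vector, 'd::real_vector, 'z) root_data_scheme \<Rightarrow> bool" where
  "root_datum D \<longleftrightarrow>
     fin_dim_real TYPE('v) \<and> fin_dim_real TYPE('d) \<and> perfect_pairing (pairing D) \<and>
     reduced_root_system D \<and> simple_system D \<and>
     (\<forall>\<alpha>\<in>simple D. \<forall>\<beta>\<in>simple D. (\<exists>w\<in>weyl D. w \<alpha> = \<beta>) \<longrightarrow> param D \<alpha> = param D \<beta>)"

definition word_prod :: "('v::real_vector, 'd::real_vector, 'z) root_data_scheme \<Rightarrow> 'v list \<Rightarrow> 'v \<Rightarrow> 'v" where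
  "word_prod D as = foldr (\<lambda>\<alpha> w. refl D \<alpha> \<circ> w) as id"

definition len :: "('v::real_vector, 'd::real_vector, 'z) root_data_scheme \<Rightarrow> ('v \<Rightarrow> 'v) \<Rightarrow> nat" where
  "len D w = (LEAST n. \<exists>as. set as \<subseteq> simple D \<and> length as = n \<and> word_prod D as = w)"

definition reduced_word :: "('v::real_vector, 'd::real_vector, 'z) root_data_scheme \<Rightarrow> ('v \<Rightarrow> 'v) \<Rightarrow> 'v list \<Rightarrow> bool" where
  "reduced_word D w as \<longleftrightarrow> set as \<subseteq> simple D \<and> word_prod D as = w \<and> length as = len D w"

text \<open>A parabolic \<open>M\<close> is given by its set \<open>P\<close> of simple roots throughout.\<close>

definition longest :: "('v::real_vector, 'd::real_vector, 'z) root_data_scheme \<Rightarrow> 'v set \<Rightarrow> 'v \<Rightarrow> 'v" where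
  "longest D P = arg_max_on (len D) (refl_group D P)"

definition min_reps :: "('v::real_vector, 'd::real_vector, 'z) root_data_scheme \<Rightarrow> 'v set \<Rightarrow> ('v \<Rightarrow> 'v) set" where
  "min_reps D P = {w \<in> weyl D. \<forall>v\<in>refl_group D P. len D w \<le> len D (w \<circ> v)}"

definition dual_par :: "('v::real_vector, 'd::real_vector, 'z) root_data_scheme \<Rightarrow> 'v set \<Rightarrow> 'v set" where
  "dual_par D P = (\<lambda>\<alpha>. - longest D (simple D) \<alpha>) ` P"

definition w_up :: "('v::real_vector, 'd::real_vector, 'z) root_data_scheme \<Rightarrow> 'v set \<Rightarrow> 'v \<Rightarrow> 'v" where
  "w_up D P = longest D (simple D) \<circ> longest D (dual_par D P)"


section \<open>The graded Hecke algebra and its rational extension\<close>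

definition ring_hom_fun :: "('a::ring_1 \<Rightarrow> 'b::ring_1) \<Rightarrow> bool" where
  "ring_hom_fun f \<longleftrightarrow> f 1 = 1 \<and> (\<forall>x y. f (x + y) = f x + f y) \<and> (\<forall>x y. f (x * y) = f x * f y)"

text \<open>\<open>symmetric_algebra c \<iota>\<close>: the ring, with scalars \<open>c\<close> and generators \<open>\<iota>\<close>, is \<open>S(V\<^sub>\<complex>)\<close>, that is,
  the complex polynomial ring on a basis of \<open>V\<close>. The element \<open>u + iv\<close> of \<open>V\<^sub>\<complex>\<close> is
  \<open>\<iota> u + c \<i> * \<iota> v\<close>.\<close>

definition symmetric_algebra :: "(complex \<Rightarrow> 's::idom) \<Rightarrow> ('v::real_vector \<Rightarrow> 's) \<Rightarrow> bool" where
  "symmetric_algebra c \<iota> \<longleftrightarrow>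
     ring_hom_fun c \<and>
     (\<forall>x y. \<iota> (x + y) = \<iota> x + \<iota> y) \<and> (\<forall>r x. \<iota> (r *\<^sub>R x) = c (of_real r) * \<iota> x) \<and>
     (\<exists>B. finite B \<and> independent B \<and> span B = UNIV \<and>
        (\<forall>a. \<exists>!p::('v \<Rightarrow> nat) \<Rightarrow> complex.
           finite {e. p e \<noteq> 0} \<and> (\<forall>e. p e \<noteq> 0 \<longrightarrow> (\<forall>b. b \<notin> B \<longrightarrow> e b = 0)) \<and>
           a = (\<Sum>e | p e \<noteq> 0. c (p e) * (\<Prod>b\<in>B. \<iota> b ^ e b))))"

text \<open>\<open>'s\<close> carries \<open>S(V\<^sub>\<complex>)\<close>, \<open>'h\<close> the algebra \<open>\<HH>\<close> and \<open>'g\<close> its extension by the field of rational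
  functions \<open>'s fract\<close>. Complex scalars act on \<open>\<HH>\<close> through \<open>pol \<circ> const\<close>.\<close>

record (overloaded) ('v, 'd, 's::idom, 'h, 'g) hecke_data = "('v, 'd) root_data" +
  const :: "complex \<Rightarrow> 's"
  inc   :: "'v \<Rightarrow> 's"
  wact  :: "('v \<Rightarrow> 'v) \<Rightarrow> 's \<Rightarrow> 's"
  tw    :: "('v \<Rightarrow> 'v) \<Rightarrow> 'h"
  pol   :: "'s \<Rightarrow> 'h"
  star  :: "'h \<Rightarrow> 'h"
  emb   :: "'h \<Rightarrow> 'g"
  rat   :: "'s fract \<Rightarrow> 'g"

type_synonym ('v, 'd, 's, 'h, 'g) hecke = "('v, 'd, 's, 'h, 'g) hecke_data"

definition cvec :: "('v::real_vector, 'd::real_vector, 's::idom, 'h::ring_1, 'g::ring_1) hecke \<Rightarrow> 'v \<Rightarrow> 'v \<Rightarrow> 's" where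
  "cvec D u v = inc D u + const D \<i> * inc D v"

definition scal :: "('v::real_vector, 'd::real_vector, 's::idom, 'h::ring_1, 'g::ring_1) hecke \<Rightarrow> complex \<Rightarrow> 'h" where
  "scal D z = pol D (const D z)"

definition weyl_action :: "('v::real_vector, 'd::real_vector, 's::idom, 'h::ring_1, 'g::ring_1) hecke \<Rightarrow> bool" where
  "weyl_action D \<longleftrightarrow>
     (\<forall>w\<in>weyl D. ring_hom_fun (wact D w) \<and> (\<forall>z. wact D w (const D z) = const D z) \<and>
        (\<forall>v. wact D w (inc D v) = inc D (w v)))"

text \<open>The quotient \<open>(a - s\<^sub>\<alpha>(a)) / \<alpha>\<close>, which lies in \<open>S(V\<^sub>\<complex>)\<close>.\<close>

definition divided_diff :: "('v::real_vector, 'd::real_vector, 's::idom, 'h::ring_1, 'g::ring_1) hecke \<Rightarrow> 'v \<Rightarrow> 's \<Rightarrow> 's" where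
  "divided_diff D \<alpha> a = (THE q. inc D \<alpha> * q = a - wact D (refl D \<alpha>) a)"

definition graded_hecke_algebra :: "('v::real_vector, 'd::real_vector, 's::idom, 'h::ring_1, 'g::ring_1) hecke \<Rightarrow> bool" where
  "graded_hecke_algebra D \<longleftrightarrow>
     ring_hom_fun (pol D) \<and>
     tw D id = 1 \<and> (\<forall>v\<in>weyl D. \<forall>w\<in>weyl D. tw D (v \<circ> w) = tw D v * tw D w) \<and>
     (\<forall>h. \<exists>!f. (\<forall>w. w \<notin> weyl D \<longrightarrow> f w = 0) \<and> h = (\<Sum>w\<in>weyl D. tw D w * pol D (f w))) \<and>
     (\<forall>\<alpha>\<in>simple D. \<forall>a.
        pol D a * tw D (refl D \<alpha>) =
          tw D (refl D \<alpha>) * pol D (wact D (refl D \<alpha>) a)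
          + scal D (of_real (param D \<alpha>)) * pol D (divided_diff D \<alpha> a))"

definition star_operation :: "('v::real_vector, 'd::real_vector, 's::idom, 'h::ring_1, 'g::ring_1) hecke \<Rightarrow> bool" where
  "star_operation D \<longleftrightarrow>
     bij (star D) \<and>
     (\<forall>x y. star D (x + y) = star D x + star D y) \<and>
     (\<forall>x y. star D (x * y) = star D y * star D x) \<and>
     (\<forall>z x. star D (scal D z * x) = scal D (cnj z) * star D x) \<and>
     (\<forall>w\<in>weyl D. star D (tw D w) = tw D (inv w)) \<and>
     (\<forall>u v. star D (pol D (cvec D u v)) = pol D (cvec D u (- v)))"

text \<open>\<open>'g\<close> is \<open>\<HH> \<otimes>\<^bsub>S\<^esub> O\<close>: as \<open>\<HH>\<close> is right free over \<open>S(V\<^sub>\<complex>)\<close> on the \<open>t\<^sub>w\<close>, so is \<open>'g\<close> over the field.\<close>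

definition rational_extension :: "('v::real_vector, 'd::real_vector, 's::idom, 'h::ring_1, 'g::ring_1) hecke \<Rightarrow> bool" where
  "rational_extension D \<longleftrightarrow>
     ring_hom_fun (emb D) \<and> ring_hom_fun (rat D) \<and>
     (\<forall>a. emb D (pol D a) = rat D (Fract a 1)) \<and>
     (\<forall>x. \<exists>!f. (\<forall>w. w \<notin> weyl D \<longrightarrow> f w = 0) \<and> x = (\<Sum>w\<in>weyl D. emb D (tw D w) * rat D (f w)))"

definition graded_hecke :: "('v::real_vector, 'd::real_vector, 's::idom, 'h::ring_1, 'g::ring_1) hecke \<Rightarrow> bool" where
  "graded_hecke D \<longleftrightarrow>
     root_datum D \<and> symmetric_algebra (const D) (inc D) \<and> weyl_action D \<and>
     graded_hecke_algebra D \<and> star_operation D \<and> rational_extension D"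


section \<open>Parabolic subalgebras\<close>

inductive_set subring_gen :: "'a::ring_1 set \<Rightarrow> 'a set" for A where
  gen:  "x \<in> A \<Longrightarrow> x \<in> subring_gen A"
| one:  "1 \<in> subring_gen A"
| diff: "x \<in> subring_gen A \<Longrightarrow> y \<in> subring_gen A \<Longrightarrow> x - y \<in> subring_gen A"
| mult: "x \<in> subring_gen A \<Longrightarrow> y \<in> subring_gen A \<Longrightarrow> x * y \<in> subring_gen A"

definition par_alg :: "('v::real_vector, 'd::real_vector, 's::idom, 'h::ring_1, 'g::ring_1) hecke \<Rightarrow> 'v set \<Rightarrow> 'h set" where
  "par_alg D P = subring_gen (tw D ` refl_group D P \<union> range (pol D))"

definition par_alg_rat :: "('v::real_vector, 'd::real_vector, 's::idom, 'h::ring_1, 'g::ring_1) hecke \<Rightarrow> 'v set \<Rightarrow> 'g set" where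
  "par_alg_rat D P = subring_gen ((emb D \<circ> tw D) ` refl_group D P \<union> range (rat D))"

definition eps :: "('v::real_vector, 'd::real_vector, 's::idom, 'h::ring_1, 'g::ring_1) hecke \<Rightarrow> 'v set \<Rightarrow> 'g \<Rightarrow> 'g" where
  "eps D P x =
     (THE m. (\<forall>w. w \<notin> min_reps D P \<longrightarrow> m w = 0) \<and> (\<forall>w\<in>min_reps D P. m w \<in> par_alg_rat D P) \<and>
        x = (\<Sum>w\<in>min_reps D P. emb D (tw D w) * m w)) id"

definition is_transfer :: "('v::real_vector, 'd::real_vector, 's::idom, 'h::ring_1, 'g::ring_1) hecke \<Rightarrow> 'v set \<Rightarrow> ('h \<Rightarrow> 'h) \<Rightarrow> bool" where
  "is_transfer D P \<phi> \<longleftrightarrow>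
     bij_betw \<phi> (par_alg D P) (par_alg D (dual_par D P)) \<and>
     (\<forall>x\<in>par_alg D P. \<forall>y\<in>par_alg D P. \<phi> (x + y) = \<phi> x + \<phi> y \<and> \<phi> (x * y) = \<phi> x * \<phi> y) \<and>
     (\<forall>z. \<phi> (scal D z) = scal D z) \<and>
     (\<forall>m\<in>refl_group D P. \<phi> (tw D m) = tw D (inv (w_up D P) \<circ> m \<circ> w_up D P)) \<and>
     (\<forall>u v. \<phi> (pol D (cvec D u v)) = pol D (cvec D (inv (w_up D P) u) (inv (w_up D P) v)))"

text \<open>The transfer isomorphism is determined on \<open>par_alg D P\<close> by its values on generators; outside it
  is arbitrary.\<close>

definition transfer :: "('v::real_vector, 'd::real_vector, 's::idom, 'h::ring_1, 'g::ring_1) hecke \<Rightarrow> 'v set \<Rightarrow> 'h \<Rightarrow> 'h" where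
  "transfer D P = (SOME \<phi>. is_transfer D P \<phi>)"

definition twist :: "('v::real_vector, 'd::real_vector, 's::idom, 'h::ring_1, 'g::ring_1) hecke \<Rightarrow> 'v set \<Rightarrow> ('h \<Rightarrow> 'u \<Rightarrow> 'u) \<Rightarrow> 'h \<Rightarrow> 'u \<Rightarrow> 'u" where
  "twist D P \<sigma> = (\<lambda>m. \<sigma> (inv_into (par_alg D P) (transfer D P) m))"


section \<open>The elements \<open>R\<^sub>w\<close>\<close>

definition R_simple :: "('v::real_vector, 'd::real_vector, 's::idom, 'h::ring_1, 'g::ring_1) hecke \<Rightarrow> 'v \<Rightarrow> 'g" where
  "R_simple D \<alpha> =
     (let k = const D (of_real (param D \<alpha>)); a = inc D \<alpha>
      in emb D (tw D (refl D \<alpha>)) * rat D (Fract a (k - a)) - rat D (Fract k (k - a)))"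

definition R_elt :: "('v::real_vector, 'd::real_vector, 's::idom, 'h::ring_1, 'g::ring_1) hecke \<Rightarrow> ('v \<Rightarrow> 'v) \<Rightarrow> 'g" where
  "R_elt D x = prod_list (map (R_simple D) (SOME as. reduced_word D x as))"


section \<open>Modules, forms and evaluation of rational elements\<close>

definition fd_module :: "('v::real_vector, 'd::real_vector, 's::idom, 'h::ring_1, 'g::ring_1) hecke \<Rightarrow> 'h set
    \<Rightarrow> (complex \<Rightarrow> 'u::ab_group_add \<Rightarrow> 'u) \<Rightarrow> ('h \<Rightarrow> 'u \<Rightarrow> 'u) \<Rightarrow> bool" where
  "fd_module D A scl \<sigma> \<longleftrightarrow>
     vector_space scl \<and> (\<exists>B. finite B \<and> module.span scl B = UNIV) \<and>
     (\<forall>u. \<sigma> 1 u = u) \<and> (\<forall>z u. \<sigma> (scal D z) u = scl z u) \<and>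
     (\<forall>m\<in>A. \<forall>u v. \<sigma> m (u + v) = \<sigma> m u + \<sigma> m v) \<and>
     (\<forall>m\<in>A. \<forall>n\<in>A. \<forall>u. \<sigma> (m + n) u = \<sigma> m u + \<sigma> n u \<and> \<sigma> (m * n) u = \<sigma> m (\<sigma> n u))"

definition hermitian_form :: "(complex \<Rightarrow> 'u::ab_group_add \<Rightarrow> 'u) \<Rightarrow> ('u \<Rightarrow> 'u \<Rightarrow> complex) \<Rightarrow> bool" where
  "hermitian_form scl B \<longleftrightarrow>
     (\<forall>u v w. B (u + v) w = B u w + B v w) \<and> (\<forall>z u v. B (scl z u) v = z * B u v) \<and>
     (\<forall>u v. B v u = cnj (B u v))"

definition star_invariant :: "('v::real_vector, 'd::real_vector, 's::idom, 'h::ring_1, 'g::ring_1) hecke \<Rightarrow> 'h set \<Rightarrow> 'x set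
    \<Rightarrow> ('h \<Rightarrow> 'x \<Rightarrow> 'x) \<Rightarrow> ('x \<Rightarrow> 'x \<Rightarrow> complex) \<Rightarrow> bool" where
  "star_invariant D A X \<pi> B \<longleftrightarrow> (\<forall>h\<in>A. \<forall>x\<in>X. \<forall>y\<in>X. B (\<pi> h x) y = B x (\<pi> (star D h) y))"

text \<open>A rational element \<open>x = m q\<^sup>-\<^sup>1\<close>, with \<open>m\<close> in the parabolic subalgebra and \<open>q\<close> in \<open>S(V\<^sub>\<complex>)\<close>, acts on a
  module \<open>\<rho>\<close> by \<open>\<rho>(m) \<rho>(q)\<^sup>-\<^sup>1\<close> as soon as \<open>\<rho>(q)\<close> is invertible; the result does not depend on the
  chosen fraction since \<open>S(V\<^sub>\<complex>)\<close> is commutative.\<close>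

definition fraction_at :: "('v::real_vector, 'd::real_vector, 's::idom, 'h::ring_1, 'g::ring_1) hecke \<Rightarrow> 'v set
    \<Rightarrow> ('h \<Rightarrow> 'u \<Rightarrow> 'u) \<Rightarrow> 'g \<Rightarrow> 'h \<Rightarrow> 's \<Rightarrow> bool" where
  "fraction_at D P \<rho> x m q \<longleftrightarrow>
     m \<in> par_alg D P \<and> q \<noteq> 0 \<and> bij (\<rho> (pol D q)) \<and> x * rat D (Fract q 1) = emb D m"

definition regular_at :: "('v::real_vector, 'd::real_vector, 's::idom, 'h::ring_1, 'g::ring_1) hecke \<Rightarrow> 'v set
    \<Rightarrow> ('h \<Rightarrow> 'u \<Rightarrow> 'u) \<Rightarrow> 'g \<Rightarrow> bool" where
  "regular_at D P \<rho> x \<longleftrightarrow> (\<exists>m q. fraction_at D P \<rho> x m q)"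

definition eval_at :: "('v::real_vector, 'd::real_vector, 's::idom, 'h::ring_1, 'g::ring_1) hecke \<Rightarrow> 'v set
    \<Rightarrow> ('h \<Rightarrow> 'u \<Rightarrow> 'u) \<Rightarrow> 'g \<Rightarrow> 'u \<Rightarrow> 'u" where
  "eval_at D P \<rho> x = (THE T. \<exists>m q. fraction_at D P \<rho> x m q \<and> T = \<rho> m \<circ> inv (\<rho> (pol D q)))"


section \<open>The induced module\<close>

text \<open>The tensor product of \<open>\<HH>\<close> and \<open>U\<close> over \<open>par_alg D P\<close>, as the free abelian group on \<open>\<HH> \<times> U\<close>
  modulo the subgroup of relations; elements are cosets.\<close>

inductive_set tensor_rel :: "('v::real_vector, 'd::real_vector, 's::idom, 'h::ring_1, 'g::ring_1) hecke \<Rightarrow> 'v set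
    \<Rightarrow> ('h \<Rightarrow> 'u::ab_group_add \<Rightarrow> 'u) \<Rightarrow> ('h \<times> 'u \<Rightarrow>\<^sub>0 int) set"
  for D P \<sigma> where
  zero: "0 \<in> tensor_rel D P \<sigma>"
| diff: "p \<in> tensor_rel D P \<sigma> \<Longrightarrow> q \<in> tensor_rel D P \<sigma> \<Longrightarrow> p - q \<in> tensor_rel D P \<sigma>"
| addl: "Poly_Mapping.single (h + h', u) 1 - Poly_Mapping.single (h, u) 1
           - Poly_Mapping.single (h', u) 1 \<in> tensor_rel D P \<sigma>"
| addr: "Poly_Mapping.single (h, u + u') 1 - Poly_Mapping.single (h, u) 1
           - Poly_Mapping.single (h, u') 1 \<in> tensor_rel D P \<sigma>"
| bal:  "m \<in> par_alg D P \<Longrightarrow>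
           Poly_Mapping.single (h * m, u) 1 - Poly_Mapping.single (h, \<sigma> m u) 1 \<in> tensor_rel D P \<sigma>"

type_synonym ('h, 'u) ind = "('h \<times> 'u \<Rightarrow>\<^sub>0 int) set"

definition coset :: "('v::real_vector, 'd::real_vector, 's::idom, 'h::ring_1, 'g::ring_1) hecke \<Rightarrow> 'v set
    \<Rightarrow> ('h \<Rightarrow> 'u::ab_group_add \<Rightarrow> 'u) \<Rightarrow> ('h \<times> 'u \<Rightarrow>\<^sub>0 int) \<Rightarrow> ('h, 'u) ind" where
  "coset D P \<sigma> p = {q. q - p \<in> tensor_rel D P \<sigma>}"

definition ind_module :: "('v::real_vector, 'd::real_vector, 's::idom, 'h::ring_1, 'g::ring_1) hecke \<Rightarrow> 'v set
    \<Rightarrow> ('h \<Rightarrow> 'u::ab_group_add \<Rightarrow> 'u) \<Rightarrow> ('h, 'u) ind set" where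
  "ind_module D P \<sigma> = range (coset D P \<sigma>)"

definition tensor :: "('v::real_vector, 'd::real_vector, 's::idom, 'h::ring_1, 'g::ring_1) hecke \<Rightarrow> 'v set
    \<Rightarrow> ('h \<Rightarrow> 'u::ab_group_add \<Rightarrow> 'u) \<Rightarrow> 'h \<Rightarrow> 'u \<Rightarrow> ('h, 'u) ind" where
  "tensor D P \<sigma> h u = coset D P \<sigma> (Poly_Mapping.single (h, u) 1)"

definition ind_add :: "('h, 'u) ind \<Rightarrow> ('h, 'u) ind \<Rightarrow> ('h, 'u) ind" where
  "ind_add x y = {p + q | p q. p \<in> x \<and> q \<in> y}"

definition free_act :: "'h::ring_1 \<Rightarrow> ('h \<times> 'u \<Rightarrow>\<^sub>0 int) \<Rightarrow> ('h \<times> 'u \<Rightarrow>\<^sub>0 int)" where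
  "free_act h p = (\<Sum>(g, u)\<in>Poly_Mapping.keys p.
     Poly_Mapping.single (h * g, u) (Poly_Mapping.lookup p (g, u)))"

definition ind_act :: "('v::real_vector, 'd::real_vector, 's::idom, 'h::ring_1, 'g::ring_1) hecke \<Rightarrow> 'v set
    \<Rightarrow> ('h \<Rightarrow> 'u::ab_group_add \<Rightarrow> 'u) \<Rightarrow> 'h \<Rightarrow> ('h, 'u) ind \<Rightarrow> ('h, 'u) ind" where
  "ind_act D P \<sigma> h x = (\<Union>p\<in>x. coset D P \<sigma> (free_act h p))"

definition ind_sesquilinear :: "('v::real_vector, 'd::real_vector, 's::idom, 'h::ring_1, 'g::ring_1) hecke \<Rightarrow> 'v set
    \<Rightarrow> ('h \<Rightarrow> 'u::ab_group_add \<Rightarrow> 'u) \<Rightarrow> (('h, 'u) ind \<Rightarrow> ('h, 'u) ind \<Rightarrow> complex) \<Rightarrow> bool" where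
  "ind_sesquilinear D P \<sigma> F \<longleftrightarrow>
     (\<forall>x\<in>ind_module D P \<sigma>. \<forall>y\<in>ind_module D P \<sigma>.
        (\<forall>z\<in>ind_module D P \<sigma>. F (ind_add x z) y = F x y + F z y \<and> F x (ind_add y z) = F x y + F x z) \<and>
        (\<forall>a. F (ind_act D P \<sigma> (scal D a) x) y = a * F x y \<and>
             F x (ind_act D P \<sigma> (scal D a) y) = cnj a * F x y))"

definition form_elt :: "('v::real_vector, 'd::real_vector, 's::idom, 'h::ring_1, 'g::ring_1) hecke \<Rightarrow> 'v set \<Rightarrow> 'h \<Rightarrow> 'h \<Rightarrow> 'g" where
  "form_elt D P h1 h2 =
     eps D (dual_par D P)
       (emb D (tw D (inv (w_up D P))) * emb D (star D h2) * emb D h1 * R_elt D (w_up D P))"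

end

theory Submission
  imports Defs
begin

text \<open>
  The values of the form on pure tensors are prescribed. They extend to the induced module as soon
  as the prescription is additive and balanced over the parabolic subalgebra \<open>\<HH>\<^sub>M\<close> in each slot;
  invariance is then the identity \<open>h\<^sub>2\<^sup>\<bullet> (h h\<^sub>1) = (h\<^sup>\<bullet> h\<^sub>2)\<^sup>\<bullet> h\<^sub>1\<close>, and compatibility with scalars is
  the balancing in the second slot for a scalar. Write \<open>w\<^sup>0\<close> for \<open>w\<^sup>0\<^sub>M\<close>, \<open>N\<close> for \<open>\<delta>(M)\<close>,
  \<open>R\<^sup>0\<close> for \<open>R\<close> at \<open>w\<^sup>0\<close>, and \<open>\<phi>\<close> for the transfer. Three facts make the prescription balanced.

  First slot. The element \<open>R\<^sup>0\<close> intertwines the two parabolic subalgebras: \<open>n R\<^sup>0 = R\<^sup>0 \<phi>(n)\<close>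
  (\<open>transfer_R0\<close>). For polynomials this is built into the rank one elements. For reflections it
  comes from \<open>s\<^sub>\<beta> w\<^sup>0 = w\<^sup>0 s\<^sub>\<alpha>\<close> and the independence of \<open>R\<close> from the reduced word; the latter holds
  because an element \<open>X\<close> with \<open>a X = X w\<inverse>(a)\<close> for all polynomials \<open>a\<close> is determined by its coefficient
  at \<open>w\<close> (\<open>intertwiner_0\<close>), and that coefficient of an \<open>R\<close>-word is a product over the inversions of \<open>w\<close>
  (\<open>R_word_leading\<close>). Conjugation by \<open>R\<^sup>0\<close> also shows that the transfer exists. Since \<open>\<epsilon>\<^sub>N\<close> is linear over
  \<open>\<HH>\<^sub>N\<close> on the right, the first slot is balanced.

  Second slot. The projection \<open>\<epsilon>\<^sub>N\<close> is not linear on the left, but \<open>X \<mapsto> \<epsilon>\<^sub>N(t\<^bsub>(w\<^sup>0)\<inverse>\<^esub> X)\<close> reads off the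
  coefficients of \<open>X\<close> on the coset \<open>w\<^sup>0 W\<^sub>N\<close>. As \<open>w\<^sup>0\<close> has maximal length among the minimal coset
  representatives, the shorter terms that arise when a polynomial is moved past \<open>t\<^sub>u\<close> never meet this coset,
  and the functional turns left multiplication by \<open>n \<in> \<HH>\<^sub>M\<close> into left multiplication by \<open>\<phi>(n)\<close>
  (\<open>top_left\<close>).

  Evaluation. Evaluating fractions \<open>m q\<inverse>\<close> at a module is in general not multiplicative on the right.
  In rank one with \<open>k \<noteq> 0\<close>, at the one dimensional module \<open>t = 1\<close>, \<open>\<alpha> = k\<close>, the element
  \<open>x = (t + 1) (k + \<alpha>)\<inverse>\<close> and \<open>x t = - x\<close> are both regular, but \<open>x\<close> has the value \<open>1 / k\<close>, and so \<open>x t\<close>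
  does not have the value of \<open>x\<close> times that of \<open>t\<close>. What saves the form is that \<open>R\<^sup>0\<close> has the common
  denominator \<open>q\<^sub>0 = \<Prod>(k\<^sub>\<beta> - \<beta>)\<close>, over the positive roots \<open>\<beta>\<close> outside the subsystem of \<open>N\<close> with
  \<open>k\<^sub>\<beta> \<noteq> 0\<close>. The group \<open>W\<^sub>N\<close> permutes these roots, so \<open>q\<^sub>0\<close> is central in \<open>\<HH>\<^sub>N\<close> (\<open>q0_central\<close>).
  Moreover \<open>q\<^sub>0\<close> acts bijectively (\<open>d0_bij\<close>): the coefficient of \<open>R\<^sup>0\<close> at \<open>w\<^sup>0\<close> is, up to sign,
  the quotient of the product of these \<open>\<beta>\<close> by \<open>q\<^sub>0\<close>, every factor \<open>k\<^sub>\<beta> - \<beta>\<close> is a prime that divides no root,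
  and so \<open>q\<^sub>0\<close> divides every denominator at which the value for \<open>h\<^sub>1 = h\<^sub>2 = 1\<close> can be evaluated.
  All values of the form therefore have the shape \<open>m q\<^sub>0\<inverse>\<close> with \<open>q\<^sub>0\<close> central and invertible.
\<close>

section \<open>Root data\<close>

text \<open>  Finiteness of the root system enters the uniqueness of reflections through this remark: a product of two
  reflections in the same root is unipotent and moves points along an arithmetic progression.\<close>

lemma arith_progression_in_finite:
  fixes x y :: "'a::real_vector"
  assumes "finite F" "\<And>n::nat. x + real n *\<^sub>R y \<in> F"
  shows "y = 0"
proof (rule ccontr)
  assume y: "y \<noteq> 0"
  have "inj (\<lambda>n::nat. x + real n *\<^sub>R y)"
    by (rule injI) (use y in auto)
  moreover have "finite (range (\<lambda>n::nat. x + real n *\<^sub>R y))"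
    by (rule finite_subset[OF _ assms(1)]) (use assms(2) in auto)
  ultimately show False
    using finite_imageD infinite_UNIV_nat by blast
qed

locale rdat =
  fixes D :: "('v::real_vector, 'd::real_vector, 'z) root_data_scheme"
  assumes root_datum: "root_datum D"
begin

abbreviation "s \<equiv> refl D"
abbreviation "W \<equiv> weyl D"

lemma pairing_linear_left: "linear (\<lambda>x. pairing D x y)"
  and pairing_linear_right: "linear (pairing D x)"
  using root_datum by (auto simp: root_datum_def perfect_pairing_def)

lemmas pairing_simps =
  linear_add[OF pairing_linear_left] linear_diff[OF pairing_linear_left]
  linear_scale[OF pairing_linear_left] linear_neg[OF pairing_linear_left] linear_0[OF pairing_linear_left]
  linear_add[OF pairing_linear_right] linear_diff[OF pairing_linear_right]
  linear_scale[OF pairing_linear_right] linear_neg[OF pairing_linear_right] linear_0[OF pairing_linear_right]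

lemma finite_roots: "finite (roots D)"
  and coroot_inj: "inj_on (coroot D) (roots D)"
  and pairing_coroot_self: "\<And>a. a \<in> roots D \<Longrightarrow> pairing D a (coroot D a) = 2"
  and refl_root: "\<And>a b. a \<in> roots D \<Longrightarrow> b \<in> roots D \<Longrightarrow> s a b \<in> roots D"
  and corefl_coroot: "\<And>a b. a \<in> roots D \<Longrightarrow> b \<in> roots D \<Longrightarrow> corefl D a (coroot D b) \<in> coroot D ` roots D"
  and root_multiple: "\<And>a c. a \<in> roots D \<Longrightarrow> c *\<^sub>R a \<in> roots D \<Longrightarrow> c = 1 \<or> c = - 1"
  using root_datum by (simp_all add: root_datum_def reduced_root_system_def image_subset_iff)

lemma simple_roots: "simple D \<subseteq> roots D"
  and simple_independent: "independent (simple D)"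
  using root_datum by (auto simp: root_datum_def simple_system_def)

lemma simple_root [simp]: "a \<in> simple D \<Longrightarrow> a \<in> roots D"
  using simple_roots by auto

lemma finite_simple: "finite (simple D)"
  using finite_subset[OF simple_roots finite_roots] .

lemma root_nonzero: "a \<in> roots D \<Longrightarrow> a \<noteq> 0"
  using pairing_coroot_self by (force simp: pairing_simps)

lemma refl_linear: "linear (s a)"
  by (rule linearI) (auto simp: refl_def pairing_simps algebra_simps)

lemma refl_refl [simp]: "a \<in> roots D \<Longrightarrow> s a (s a x) = x"
  by (simp add: refl_def pairing_simps pairing_coroot_self algebra_simps)

lemma refl_comp_refl: "a \<in> roots D \<Longrightarrow> s a \<circ> s a = id"
  by (rule ext) simp

lemma refl_self: "a \<in> roots D \<Longrightarrow> s a a = - a"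
  by (simp add: refl_def pairing_coroot_self scaleR_2)

lemma neg_root: "a \<in> roots D \<Longrightarrow> - a \<in> roots D"
  using refl_root refl_self by metis

lemma bij_refl: "a \<in> roots D \<Longrightarrow> bij (s a)"
  by (rule o_bij[of "s a"]) (simp_all add: refl_comp_refl)

lemma pairing_refl: "pairing D (s a x) y = pairing D x (corefl D a y)"
  by (simp add: refl_def corefl_def pairing_simps)


section \<open>The Weyl group\<close>

lemma refl_in_group: "a \<in> A \<Longrightarrow> s a \<in> refl_group D A"
  using refl_group.step[OF _ refl_group.one] by fastforce

lemma refl_group_comp: "v \<in> refl_group D A \<Longrightarrow> w \<in> refl_group D A \<Longrightarrow> v \<circ> w \<in> refl_group D A"
  by (induction rule: refl_group.induct) (auto simp: comp_assoc intro: refl_group.intros)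

lemma refl_group_mono: "A \<subseteq> A' \<Longrightarrow> w \<in> refl_group D A \<Longrightarrow> w \<in> refl_group D A'"
  by (rotate_tac 1, induction rule: refl_group.induct) (auto intro: refl_group.intros)

lemma weyl_linear: "w \<in> W \<Longrightarrow> linear w"
  unfolding weyl_def
  by (induction rule: refl_group.induct)
     (rule linear_id, rule linear_compose[OF _ refl_linear], assumption)

lemma weyl_bij: "w \<in> W \<Longrightarrow> bij w"
  unfolding weyl_def by (induction rule: refl_group.induct) (rule bij_id, rule bij_comp, assumption, rule bij_refl)

lemma weyl_root: "w \<in> W \<Longrightarrow> b \<in> roots D \<Longrightarrow> w b \<in> roots D"
  unfolding weyl_def by (induction rule: refl_group.induct) (auto intro: refl_root)

lemma weyl_inv1 [simp]: "w \<in> W \<Longrightarrow> inv w (w x) = x"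
  by (simp add: weyl_bij bij_is_inj)
lemma weyl_inv2 [simp]: "w \<in> W \<Longrightarrow> w (inv w x) = x"
  by (simp add: weyl_bij bij_is_surj surj_f_inv_f)

lemma weyl_inv_comp [simp]:
  assumes "w \<in> W"
  shows "inv w \<circ> w = id" "w \<circ> inv w = id" "inv w \<circ> (w \<circ> f) = f" "w \<circ> (inv w \<circ> f) = f"
    "f \<circ> w \<circ> inv w = f" "f \<circ> inv w \<circ> w = f"
  using assms by (auto simp: fun_eq_iff)

lemma inv_refl: "a \<in> roots D \<Longrightarrow> inv (s a) = s a"
  by (simp add: inv_unique_comp refl_comp_refl)

lemma refl_group_weyl: "A \<subseteq> roots D \<Longrightarrow> w \<in> refl_group D A \<Longrightarrow> w \<in> W"
  unfolding weyl_def by (rule refl_group_mono)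

lemma weyl_comp: "v \<in> W \<Longrightarrow> w \<in> W \<Longrightarrow> v \<circ> w \<in> W"
  unfolding weyl_def by (rule refl_group_comp)

lemma refl_group_inv:
  assumes "A \<subseteq> roots D" "w \<in> refl_group D A"
  shows "inv w \<in> refl_group D A"
  using assms(2)
proof (induction rule: refl_group.induct)
  case one
  then show ?case unfolding inv_id by (rule refl_group.one)
next
  case (step a w)
  have "inv (s a \<circ> w) = inv w \<circ> s a"
    using step assms(1) weyl_bij[OF refl_group_weyl[OF assms(1) step(2)]] bij_refl[of a] inv_refl[of a]
    by (metis o_inv_distrib subsetD)
  then show ?case
    using step(1,3) refl_group_comp refl_in_group by metis
qed

lemma weyl_inv: "w \<in> W \<Longrightarrow> inv w \<in> W"
  unfolding weyl_def by (rule refl_group_inv) auto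

lemma refl_weyl: "a \<in> roots D \<Longrightarrow> s a \<in> W"
  unfolding weyl_def by (rule refl_in_group)

lemma id_weyl: "id \<in> W"
  unfolding weyl_def by (rule refl_group.one)

lemma weyl_inv_inv [simp]: "w \<in> W \<Longrightarrow> inv (inv w) = w"
  by (simp add: inv_inv_eq weyl_bij)

lemma weyl_inv_distrib: "v \<in> W \<Longrightarrow> w \<in> W \<Longrightarrow> inv (v \<circ> w) = inv w \<circ> inv v"
  by (simp add: o_inv_distrib weyl_bij)

lemmas weyl_simps = weyl_comp weyl_inv refl_weyl id_weyl

lemma weyl_neg: "w \<in> W \<Longrightarrow> w (- x) = - w x"
  by (simp add: weyl_linear linear_neg)

text \<open>  Reflections of the two spaces are adjoint, and the dual reflections permute the coroots; so moving a coroot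
  by \<open>w\<close> gives some coroot. Which one it is follows from \<open>coroot_unique\<close>.\<close>

lemma coroot_transport:
  assumes "w \<in> W" "b \<in> roots D"
  shows "\<exists>g\<in>roots D. \<forall>x. pairing D x (coroot D g) = pairing D (inv w x) (coroot D b)"
  using assms(1) unfolding weyl_def
proof (induction rule: refl_group.induct)
  case one
  then show ?case using assms(2) by (auto simp: inv_id)
next
  case (step a w)
  then obtain g where g: "g \<in> roots D" "\<And>x. pairing D x (coroot D g) = pairing D (inv w x) (coroot D b)"
    by auto
  have w: "w \<in> W" "s a \<in> W" using step by (auto simp: weyl_def refl_in_group)
  obtain g' where g': "g' \<in> roots D" "corefl D a (coroot D g) = coroot D g'"
    using corefl_coroot[OF step(1) g(1)] by auto
  have "pairing D x (coroot D g') = pairing D (inv (s a \<circ> w) x) (coroot D b)" for x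
    using g g' w inv_refl[OF step(1)] by (simp add: weyl_inv_distrib pairing_refl flip: g(2))
  then show ?case using g'(1) by blast
qed

text \<open>  The roots need not span, so that a reflection is not determined by its effect on the roots alone.
  Comparing \<open>x \<mapsto> x - \<langle>x, g\<^sup>\<or>\<rangle> b\<close> with the reflection in \<open>b\<close> shows first that \<open>g\<^sup>\<or>\<close> and \<open>b\<^sup>\<or>\<close> agree on
  all roots; the same argument on the side of the coroots then gives \<open>g\<^sup>\<or> = b\<^sup>\<or>\<close>.\<close>

lemma coroot_unique:
  assumes b: "b \<in> roots D" and g: "g \<in> roots D" and bg: "pairing D b (coroot D g) = 2"
    and stab: "\<And>x. x \<in> roots D \<Longrightarrow> x - pairing D x (coroot D g) *\<^sub>R b \<in> roots D"
  shows "g = b"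
proof -
  let ?u = "coroot D g" and ?v = "coroot D b"
  have eq: "pairing D x ?u = pairing D x ?v" if x: "x \<in> roots D" for x
  proof -
    let ?e = "pairing D x ?u - pairing D x ?v"
    \<comment> \<open>one step of the progression is the product of the two reflections\<close>
    have "x + real n *\<^sub>R (?e *\<^sub>R b) \<in> roots D" for n
    proof (induction n)
      case (Suc n)
      let ?y = "x + real n *\<^sub>R (?e *\<^sub>R b)"
      have "s b (?y - pairing D ?y ?u *\<^sub>R b) \<in> roots D"
        using refl_root[OF b stab[OF Suc]] .
      also have "s b (?y - pairing D ?y ?u *\<^sub>R b) = x + real (Suc n) *\<^sub>R (?e *\<^sub>R b)"
        using bg pairing_coroot_self[OF b] by (simp add: refl_def pairing_simps algebra_simps flip: scaleR_add_left)
      finally show ?case .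
    qed (use x in simp)
    from arith_progression_in_finite[OF finite_roots this] have "?e *\<^sub>R b = 0" .
    then show ?thesis using root_nonzero[OF b] by simp
  qed
  have gv: "pairing D g ?v = 2" using eq[OF g] pairing_coroot_self[OF g] by simp
  have "?u + real n *\<^sub>R (2 *\<^sub>R (?u - ?v)) \<in> coroot D ` roots D" for n
  proof (induction n)
    case (Suc n)
    let ?y = "?u + real n *\<^sub>R (2 *\<^sub>R (?u - ?v))"
    have "corefl D g (corefl D b ?y) \<in> coroot D ` roots D"
      using corefl_coroot[OF b] corefl_coroot[OF g] Suc by (metis imageE)
    also have "corefl D g (corefl D b ?y) = ?u + real (Suc n) *\<^sub>R (2 *\<^sub>R (?u - ?v))"
      using bg gv pairing_coroot_self[OF b] pairing_coroot_self[OF g]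
      by (simp add: corefl_def pairing_simps algebra_simps scaleR_2)
    finally show ?case .
  qed (use g in simp)
  from arith_progression_in_finite[OF finite_imageI[OF finite_roots] this]
  have "?u = ?v" by simp
  then show ?thesis using coroot_inj b g by (auto dest: inj_onD)
qed

text \<open>  Together with its consequence \<open>refl_conj\<close> this says that the coroot map is equivariant, so that conjugate
  roots have conjugate reflections.\<close>

lemma pairing_coroot_weyl:
  assumes w: "w \<in> W" and b: "b \<in> roots D"
  shows "pairing D (w x) (coroot D (w b)) = pairing D x (coroot D b)"
proof -
  obtain g where g: "g \<in> roots D" "\<And>x. pairing D x (coroot D g) = pairing D (inv w x) (coroot D b)"
    using coroot_transport[OF w b] by auto
  have "g = w b"
  proof (rule coroot_unique)
    show "w b \<in> roots D" "g \<in> roots D" using w b g weyl_root by auto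
    show "pairing D (w b) (coroot D g) = 2"
      using g w b pairing_coroot_self by simp
    fix x assume "x \<in> roots D"
    then have "w (s b (inv w x)) \<in> roots D"
      using w b by (simp add: weyl_root refl_root weyl_inv)
    also have "w (s b (inv w x)) = x - pairing D x (coroot D g) *\<^sub>R w b"
      using w by (simp add: refl_def g linear_diff[OF weyl_linear] linear_scale[OF weyl_linear])
    finally show "x - pairing D x (coroot D g) *\<^sub>R w b \<in> roots D" .
  qed
  then show ?thesis using g w by auto
qed

lemma refl_conj:
  assumes w: "w \<in> W" and b: "b \<in> roots D"
  shows "s (w b) (w x) = w (s b x)"
  using linear_diff[OF weyl_linear[OF w]] linear_scale[OF weyl_linear[OF w]]
  by (simp add: refl_def pairing_coroot_weyl[OF w b])

lemma refl_conj_comp: "w \<in> W \<Longrightarrow> b \<in> roots D \<Longrightarrow> s (w b) \<circ> w = w \<circ> s b"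
  by (rule ext) (simp add: refl_conj)

lemma refl_neg: "b \<in> roots D \<Longrightarrow> s (- b) = s b"
  using refl_conj[OF refl_weyl, of b b] by (metis ext refl_refl refl_self)


section \<open>Positive roots\<close>

text \<open>  A linear extension to the whole space of the coordinate of the basis of simple roots; its values outside
  the span of the roots are arbitrary.\<close>

definition coord :: "'v \<Rightarrow> 'v \<Rightarrow> real" where
  "coord a = (SOME f. linear f \<and> (\<forall>b\<in>simple D. f b = (if b = a then 1 else 0)))"

lemma coord: "linear (coord a) \<and> (\<forall>b\<in>simple D. coord a b = (if b = a then 1 else 0))"
  unfolding coord_def
  using someI_ex[OF linear_independent_extend[OF simple_independent, of "\<lambda>b. if b = a then 1 else 0"]] .

lemma coord_linear: "linear (coord a)" using coord by auto
lemma coord_simple: "b \<in> simple D \<Longrightarrow> coord a b = (if b = a then 1 else 0)" using coord by auto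

lemmas coord_simps = linear_add[OF coord_linear] linear_diff[OF coord_linear] linear_scale[OF coord_linear]
  linear_neg[OF coord_linear] linear_0[OF coord_linear] linear_sum[OF coord_linear] coord_simple

lemma coord_sum: "a \<in> simple D \<Longrightarrow> coord a (\<Sum>b\<in>simple D. c b *\<^sub>R b) = c a"
  using finite_simple by (simp add: coord_simps if_distrib sum.delta cong: if_cong)

definition pos :: "'v \<Rightarrow> bool" where
  "pos b \<longleftrightarrow> b \<in> roots D \<and> (\<forall>a\<in>simple D. 0 \<le> coord a b)"

lemma root_expand: "b \<in> roots D \<Longrightarrow> b = (\<Sum>a\<in>simple D. coord a b *\<^sub>R a)"
  and pos_or_neg: "b \<in> roots D \<Longrightarrow> pos b \<or> pos (- b)"
proof -
  assume b: "b \<in> roots D"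
  then obtain c where c: "\<forall>a\<in>simple D. 0 \<le> c a"
    "b = (\<Sum>a\<in>simple D. c a *\<^sub>R a) \<or> b = - (\<Sum>a\<in>simple D. c a *\<^sub>R a)"
    using root_datum by (auto simp: root_datum_def simple_system_def)
  have cc: "\<forall>a\<in>simple D. coord a (\<Sum>a\<in>simple D. c a *\<^sub>R a) = c a" by (simp add: coord_sum)
  show "b = (\<Sum>a\<in>simple D. coord a b *\<^sub>R a)"
    using c(2) cc by (auto simp: coord_simps(4) sum_negf)
  show "pos b \<or> pos (- b)"
    using c(2) cc c(1) b neg_root[OF b] by (auto simp: pos_def coord_simps(4))
qed

lemma pos_root: "pos b \<Longrightarrow> b \<in> roots D" by (simp add: pos_def)

lemma pos_simple: "a \<in> simple D \<Longrightarrow> pos a" by (auto simp: pos_def coord_simple)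

lemma not_pos_neg: "pos b \<Longrightarrow> \<not> pos (- b)"
proof
  assume "pos b" "pos (- b)"
  then have "\<forall>a\<in>simple D. coord a b = 0" by (force simp: pos_def coord_simps(4))
  then have "b = 0" using root_expand[of b] \<open>pos b\<close> by (simp add: pos_def)
  then show False using root_nonzero \<open>pos b\<close> pos_root by blast
qed

lemma pos_neg_iff: "b \<in> roots D \<Longrightarrow> pos (- b) \<longleftrightarrow> \<not> pos b"
  using pos_or_neg not_pos_neg by blast

lemma posI: "b \<in> roots D \<Longrightarrow> a \<in> simple D \<Longrightarrow> 0 < coord a b \<Longrightarrow> pos b"
  using pos_or_neg[of b] by (force simp: pos_def coord_simps(4))

lemma pos_single:
  assumes b: "pos b" and a: "a \<in> simple D" and z: "\<And>a'. a' \<in> simple D \<Longrightarrow> a' \<noteq> a \<Longrightarrow> coord a' b = 0"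
  shows "b = a"
proof -
  have "(\<Sum>c\<in>simple D. coord c b *\<^sub>R c) = (\<Sum>c\<in>simple D. if c = a then coord a b *\<^sub>R a else 0)"
    by (rule sum.cong) (use z in auto)
  then have "b = (\<Sum>c\<in>simple D. if c = a then coord a b *\<^sub>R a else 0)"
    using root_expand[OF pos_root[OF b]] by (rule back_subst[rotated])
  then have ba: "b = coord a b *\<^sub>R a"
    using a finite_simple by (simp add: sum.delta)
  moreover have "coord a b = 1 \<or> coord a b = - 1"
    using root_multiple[of a "coord a b"] ba pos_root[OF b] a by auto
  moreover have "coord a b \<ge> 0" using b a by (simp add: pos_def)
  ultimately show ?thesis by auto
qed

lemma coord_refl: "a' \<noteq> a \<Longrightarrow> a \<in> simple D \<Longrightarrow> coord a' (s a x) = coord a' x"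
  by (simp add: refl_def coord_simps)

text \<open>  A simple reflection changes one coordinate only, and a positive root other than that simple root has
  another positive coordinate, because the root system is reduced (\<open>pos_single\<close>).\<close>

lemma pos_refl:
  assumes a: "a \<in> simple D" and b: "pos b" "b \<noteq> a"
  shows "pos (s a b)"
proof -
  obtain a' where a': "a' \<in> simple D" "a' \<noteq> a" "coord a' b \<noteq> 0"
    using pos_single[OF b(1) a] b(2) by auto
  then have "coord a' b > 0" using b(1) by (force simp: pos_def)
  then show ?thesis
    using a a' b posI[of "s a b" a'] coord_refl[of a' a b] by (simp add: refl_root pos_root)
qed

text \<open>  An invariant inner product on the span of the roots; as a form on the whole space it may be degenerate.\<close>

definition killing :: "'v \<Rightarrow> 'v \<Rightarrow> real" where
  "killing x y = (\<Sum>g\<in>coroot D ` roots D. pairing D x g * pairing D y g)"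

lemma killing_refl:
  assumes a: "a \<in> roots D"
  shows "killing (s a x) (s a y) = killing x y"
proof -
  have inv: "corefl D a (corefl D a g) = g" for g
    using pairing_coroot_self[OF a] by (simp add: corefl_def pairing_simps algebra_simps)
  have "bij_betw (corefl D a) (coroot D ` roots D) (coroot D ` roots D)"
    by (rule bij_betw_byWitness[where f' = "corefl D a"]) (use inv corefl_coroot[OF a] in auto)
  from sum.reindex_bij_betw[OF this, of "\<lambda>g. pairing D x g * pairing D y g"]
  show ?thesis by (simp add: killing_def pairing_refl)
qed

lemma killing_linear: "linear (killing x)"
  by (rule linearI) (auto simp: killing_def pairing_simps algebra_simps sum.distrib sum_distrib_left)

lemma killing_root_pos: "b \<in> roots D \<Longrightarrow> killing b b > 0"
proof -
  assume b: "b \<in> roots D"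
  have "pairing D b (coroot D b) * pairing D b (coroot D b) \<le> killing b b"
    unfolding killing_def by (rule member_le_sum) (use b finite_roots in auto)
  then show ?thesis using pairing_coroot_self[OF b] by simp
qed

lemma killing_pairing: "a \<in> roots D \<Longrightarrow> 2 * killing x a = pairing D x (coroot D a) * killing a a"
proof -
  assume a: "a \<in> roots D"
  have "killing x a = killing (s a x) (- a)" using killing_refl[OF a, of x a] refl_self[OF a] by simp
  also have "\<dots> = - killing x a + pairing D x (coroot D a) * killing a a"
    by (simp add: refl_def killing_def pairing_simps algebra_simps sum.distrib sum_distrib_left sum_negf sum_subtractf)
  finally show ?thesis by simp
qed

text \<open>  In the orbit of a positive root take a positive root \<open>x\<close> of least height. If it is not simple,
  no simple reflection lowers its height, so \<open>x\<close> pairs nonpositively with all simple roots and hence with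
  itself, which contradicts \<open>killing_root_pos\<close>.\<close>

lemma pos_orbit:
  assumes "pos b"
  shows "\<exists>w\<in>refl_group D (simple D). \<exists>a\<in>simple D. b = w a"
proof -
  let ?G = "refl_group D (simple D)"
  let ?ht = "\<lambda>x. \<Sum>a\<in>simple D. coord a x"
  define X where "X = {x. pos x \<and> (\<exists>w\<in>?G. b = w x)}"
  have "finite X" by (rule finite_subset[OF _ finite_roots]) (auto simp: X_def pos_def)
  moreover have "b \<in> X" using assms by (auto simp: X_def intro!: bexI[of _ id] refl_group.one)
  ultimately obtain x where x: "x \<in> X" "\<And>y. y \<in> X \<Longrightarrow> ?ht x \<le> ?ht y"
    using arg_min_if_finite(1)[of X ?ht] arg_min_least[of X _ ?ht] by (metis empty_iff)
  then obtain w where w: "w \<in> ?G" "b = w x" and px: "pos x" by (auto simp: X_def)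
  have "x \<in> simple D"
  proof (rule ccontr)
    assume nx: "x \<notin> simple D"
    have "pairing D x (coroot D a) \<le> 0" if a: "a \<in> simple D" for a
    proof -
      have "pos (s a x)" using pos_refl[OF a px] a nx by auto
      moreover have "b = (w \<circ> s a) (s a x)" using w a by simp
      moreover have "w \<circ> s a \<in> ?G" using w a by (simp add: refl_group_comp refl_in_group)
      ultimately have "s a x \<in> X" unfolding X_def by blast
      then have "?ht x \<le> ?ht (s a x)" by (rule x(2))
      also have "?ht (s a x) = ?ht x - pairing D x (coroot D a)"
        using a finite_simple coord_simple[OF a]
        by (simp add: refl_def coord_simps(2,3) sum_subtractf flip: sum_distrib_left)
      finally show ?thesis by simp
    qed
    then have "killing x a \<le> 0" if "a \<in> simple D" for a
      using killing_pairing[of a x] killing_root_pos[of a] that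
      by (smt (verit) mult_nonpos_nonneg simple_root)
    moreover have "killing x x = (\<Sum>a\<in>simple D. coord a x * killing x a)"
      using arg_cong[OF root_expand[OF pos_root[OF px]], of "killing x"]
      by (simp add: linear_sum[OF killing_linear] linear_scale[OF killing_linear])
    moreover have "(\<Sum>a\<in>simple D. coord a x * killing x a) \<le> 0"
      by (rule sum_nonpos) (use calculation(1) px in \<open>auto simp: pos_def mult_nonneg_nonpos\<close>)
    ultimately show False using killing_root_pos[OF pos_root[OF px]] by simp
  qed
  then show ?thesis using w by blast
qed

lemma weyl_simple: "W = refl_group D (simple D)"
proof
  show "refl_group D (simple D) \<subseteq> W"
    using refl_group_weyl[OF simple_roots] by auto
  have *: "s b \<in> refl_group D (simple D)" if b: "pos b" for b
  proof -
    obtain w a where w: "w \<in> refl_group D (simple D)" "a \<in> simple D" "b = w a"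
      using pos_orbit[OF b] by auto
    have wW: "w \<in> W" using w refl_group_weyl[OF simple_roots] by auto
    have "s b = w \<circ> s a \<circ> inv w"
      using refl_conj_comp[OF wW, of a] w wW by (metis comp_assoc comp_id simple_root weyl_inv_comp(2))
    then show ?thesis
      using w by (simp add: refl_group_comp refl_in_group refl_group_inv simple_roots)
  qed
  have r: "s b \<in> refl_group D (simple D)" if b: "b \<in> roots D" for b
    using pos_or_neg[OF b] * refl_neg[OF b] by metis
  show "W \<subseteq> refl_group D (simple D)"
  proof
    fix w assume "w \<in> W"
    then show "w \<in> refl_group D (simple D)"
      unfolding weyl_def
      by (induction rule: refl_group.induct) (rule refl_group.one, rule refl_group_comp[OF r])
  qed
qed

lemma root_orbit:
  assumes "b \<in> roots D"
  shows "\<exists>w\<in>W. \<exists>a\<in>simple D. w a = b"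
proof (cases "pos b")
  case True
  then show ?thesis using pos_orbit weyl_simple by metis
next
  case False
  then obtain w a where w: "w \<in> W" "a \<in> simple D" "- b = w a"
    using assms pos_orbit[of "- b"] weyl_simple by (auto simp: pos_neg_iff)
  then have "b = (w \<circ> s a) a" by (simp add: refl_self weyl_neg) (metis add.inverse_inverse)
  moreover have "w \<circ> s a \<in> W" using w by (simp add: weyl_simps)
  ultimately show ?thesis using w(2) by metis
qed


section \<open>Words, lengths and inversions\<close>

lemma word_prod_simps [simp]:
  "word_prod D [] = id" "word_prod D (a # as) = s a \<circ> word_prod D as"
  "word_prod D (as @ bs) = word_prod D as \<circ> word_prod D bs"
  by (simp_all add: word_prod_def) (induction as, simp_all add: word_prod_def comp_assoc)

lemma refl_group_word: "w \<in> refl_group D A \<longleftrightarrow> (\<exists>as. set as \<subseteq> A \<and> word_prod D as = w)"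
proof
  show "w \<in> refl_group D A \<Longrightarrow> \<exists>as. set as \<subseteq> A \<and> word_prod D as = w"
  proof (induction rule: refl_group.induct)
    case one
    show ?case by (rule exI[of _ "[]"]) simp
  next
    case (step a w)
    then obtain as where "set as \<subseteq> A" "word_prod D as = w" by auto
    then show ?case using step(1) by (intro exI[of _ "a # as"]) simp
  qed
  show "\<exists>as. set as \<subseteq> A \<and> word_prod D as = w \<Longrightarrow> w \<in> refl_group D A"
  proof (elim exE conjE)
    fix as show "set as \<subseteq> A \<Longrightarrow> word_prod D as = w \<Longrightarrow> w \<in> refl_group D A"
      by (induction as arbitrary: w) (auto intro: refl_group.step simp: refl_group.one simp del: o_apply)
  qed
qed

lemma word_weyl: "set as \<subseteq> simple D \<Longrightarrow> word_prod D as \<in> W"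
  using refl_group_word weyl_simple by blast

lemma word_exists: "w \<in> W \<Longrightarrow> \<exists>as. reduced_word D w as"
proof -
  assume "w \<in> W"
  then have "\<exists>n as. set as \<subseteq> simple D \<and> length as = n \<and> word_prod D as = w"
    using refl_group_word weyl_simple by blast
  from LeastI_ex[OF this] show ?thesis by (auto simp: reduced_word_def len_def)
qed

lemma len_le: "set as \<subseteq> simple D \<Longrightarrow> word_prod D as = w \<Longrightarrow> len D w \<le> length as"
  unfolding len_def by (rule Least_le) auto

lemma reduced_wordD:
  "reduced_word D w as \<Longrightarrow> set as \<subseteq> simple D"
  "reduced_word D w as \<Longrightarrow> word_prod D as = w"
  "reduced_word D w as \<Longrightarrow> length as = len D w"
  by (simp_all add: reduced_word_def)

text \<open>  A shorter word for one of the two factors would shorten the word for the product.\<close>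

lemma reduced_word_append:
  assumes "reduced_word D w (as @ bs)"
  shows "reduced_word D (word_prod D as) as" "reduced_word D (word_prod D bs) bs"
proof -
  note r = reduced_wordD[OF assms]
  obtain as' bs' where ab: "reduced_word D (word_prod D as) as'" "reduced_word D (word_prod D bs) bs'"
    using r(1) word_exists[OF word_weyl] by (metis le_sup_iff set_append)
  have "len D w \<le> length (as' @ bs')"
    by (rule len_le) (use reduced_wordD[OF ab(1)] reduced_wordD[OF ab(2)] r in auto)
  moreover have "length as' \<le> length as" "length bs' \<le> length bs"
    using reduced_wordD[OF ab(1)] reduced_wordD[OF ab(2)] r len_le by auto
  ultimately have "length as' = length as" "length bs' = length bs" using r(3) by auto
  then show "reduced_word D (word_prod D as) as" "reduced_word D (word_prod D bs) bs"
    using r reduced_wordD[OF ab(1)] reduced_wordD[OF ab(2)] by (auto simp: reduced_word_def)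
qed

lemma len_comp_le: "v \<in> W \<Longrightarrow> w \<in> W \<Longrightarrow> len D (v \<circ> w) \<le> len D v + len D w"
proof -
  assume "v \<in> W" "w \<in> W"
  then obtain as bs where a: "reduced_word D v as" and b: "reduced_word D w bs" using word_exists by blast
  show ?thesis
    using len_le[of "as @ bs" "v \<circ> w"] reduced_wordD[OF a] reduced_wordD[OF b] by auto
qed

lemma len_refl_le: "a \<in> simple D \<Longrightarrow> len D (s a) \<le> 1" using len_le[of "[a]" "s a"] by simp

lemma len_0: "w \<in> W \<Longrightarrow> len D w = 0 \<Longrightarrow> w = id"
  using word_exists[of w] reduced_wordD[of w] by fastforce

text \<open>  While the letters of the word act one after the other, the root changes sign at some letter, and there it
  must equal that simple root.\<close>

lemma exchange:
  assumes "set as \<subseteq> simple D" "pos b" "\<not> pos (word_prod D as b)"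
  shows "\<exists>bs c cs. as = bs @ c # cs \<and> word_prod D cs b = c"
  using assms(1,3)
proof (induction as)
  case Nil
  then show ?case using assms(2) by simp
next
  case (Cons a as)
  show ?case
  proof (cases "pos (word_prod D as b)")
    case True
    then have "word_prod D as b = a" using Cons pos_refl[of a] by auto
    then show ?thesis by (intro exI[of _ "[]"]) auto
  next
    case False
    then obtain bs c cs where "as = bs @ c # cs" "word_prod D cs b = c" using Cons by auto
    then show ?thesis by (intro exI[of _ "a # bs"]) auto
  qed
qed

text \<open>  Otherwise \<open>exchange\<close> turns the last letter into an earlier one by conjugation, the two cancel,
  and the word was not reduced.\<close>

lemma reduced_last:
  assumes "reduced_word D w (as @ [a])"
  shows "\<not> pos (w a)" "pos (word_prod D as a)"
proof -
  note r = reduced_wordD[OF assms]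
  let ?v = "word_prod D as"
  have a: "a \<in> simple D" and as: "set as \<subseteq> simple D" and w: "w = ?v \<circ> s a" using r by auto
  have v: "?v \<in> W" using as word_weyl by auto
  show p: "pos (?v a)"
  proof (rule ccontr)
    assume "\<not> pos (?v a)"
    then obtain bs c cs where b: "as = bs @ c # cs" "word_prod D cs a = c"
      using exchange[OF as pos_simple[OF a]] by auto
    have cs: "word_prod D cs \<in> W" using as b word_weyl by auto
    have "s c \<circ> word_prod D cs = word_prod D cs \<circ> s a"
      using refl_conj_comp[OF cs, of a] b(2) a by simp
    then have "w = word_prod D (bs @ cs)"
      unfolding w b(1) using refl_comp_refl[of a] a by (simp add: comp_assoc)
    then have "len D w \<le> length (bs @ cs)" using len_le[of "bs @ cs" w] as b by auto
    then show False using r(3) b by simp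
  qed
  then show "\<not> pos (w a)" unfolding w using a v not_pos_neg by (simp add: refl_self weyl_neg)
qed

definition inversions :: "('v \<Rightarrow> 'v) \<Rightarrow> 'v set" where
  "inversions w = {b. pos b \<and> \<not> pos (w b)}"

lemma finite_inversions: "finite (inversions w)"
  by (rule finite_subset[OF _ finite_roots]) (auto simp: inversions_def pos_root)

lemma inversions_refl:
  assumes w: "w \<in> W" and a: "a \<in> simple D" and p: "pos (w a)"
  shows "inversions (w \<circ> s a) = insert a (s a ` inversions w)" "a \<notin> s a ` inversions w"
proof -
  have na: "\<not> pos (w (- a))" using p not_pos_neg weyl_neg[OF w] by auto
  have neg: "\<not> pos (- a)" using not_pos_neg pos_simple[OF a] by auto
  show "a \<notin> s a ` inversions w"
  proof
    assume "a \<in> s a ` inversions w"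
    then obtain c where c: "pos c" "a = s a c" by (auto simp: inversions_def)
    then have "c = s a a" using a refl_refl[of a c] by simp
    then show False using c neg a by (simp add: refl_self)
  qed
  show "inversions (w \<circ> s a) = insert a (s a ` inversions w)"
  proof (intro equalityI subsetI)
    fix b assume b: "b \<in> inversions (w \<circ> s a)"
    show "b \<in> insert a (s a ` inversions w)"
    proof (cases "b = a")
      case False
      then have "s a b \<in> inversions w" using b pos_refl[OF a] by (auto simp: inversions_def)
      moreover have "b = s a (s a b)" using a by simp
      ultimately show ?thesis by blast
    qed simp
  next
    fix b assume "b \<in> insert a (s a ` inversions w)"
    then consider "b = a" | c where "c \<in> inversions w" "b = s a c" by auto
    then show "b \<in> inversions (w \<circ> s a)"
    proof cases
      case 1
      then show ?thesis using a na pos_simple by (simp add: inversions_def refl_self)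
    next
      case 2
      then have "c \<noteq> a" using p by (auto simp: inversions_def)
      then show ?thesis using 2 a pos_refl[OF a] by (auto simp: inversions_def)
    qed
  qed
qed

lemma card_inversions_refl:
  assumes w: "w \<in> W" and a: "a \<in> simple D" and p: "pos (w a)"
  shows "card (inversions (w \<circ> s a)) = Suc (card (inversions w))"
proof -
  have "inj (s a)" using bij_refl[of a] a by (simp add: bij_is_inj)
  then have "card (s a ` inversions w) = card (inversions w)"
    by (metis card_image inj_on_subset subset_UNIV)
  then show ?thesis
    unfolding inversions_refl(1)[OF w a p]
    using inversions_refl(2)[OF w a p] finite_inversions by (subst card_insert_disjoint) auto
qed

text \<open>  Each letter of a reduced word adds one inversion, by \<open>inversions_refl\<close> and \<open>reduced_last\<close>.\<close>

lemma len_card: "w \<in> W \<Longrightarrow> len D w = card (inversions w)"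
proof -
  assume "w \<in> W"
  then obtain as where "reduced_word D w as" using word_exists by auto
  then have "length as = card (inversions w)"
  proof (induction as arbitrary: w rule: rev_induct)
    case Nil
    then show ?case using reduced_wordD[OF Nil] by (auto simp: inversions_def)
  next
    case (snoc a as)
    let ?v = "word_prod D as"
    have a: "a \<in> simple D" and v: "?v \<in> W" and w: "w = ?v \<circ> s a"
      using reduced_wordD[OF snoc(2)] word_weyl by auto
    have p: "pos (?v a)" using reduced_last[OF snoc(2)] by simp
    have "card (inversions w) = Suc (card (inversions ?v))"
      unfolding w by (rule card_inversions_refl[OF v a p])
    then show ?case
      using snoc(1)[OF reduced_word_append(1)[OF snoc(2)]] by simp
  qed
  then show ?thesis using reduced_wordD(3)[OF \<open>reduced_word D w as\<close>] by simp
qed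

lemma len_step_up:
  assumes w: "w \<in> W" and a: "a \<in> simple D" and p: "pos (w a)"
  shows "len D (w \<circ> s a) = len D w + 1"
proof -
  have "card (inversions (w \<circ> s a)) = Suc (card (inversions w))"
    by (rule card_inversions_refl[OF w a p])
  then show ?thesis
    using len_card[OF w] len_card[OF weyl_comp[OF w refl_weyl]] a by simp
qed

lemma len_step_down:
  assumes w: "w \<in> W" and a: "a \<in> simple D" and p: "\<not> pos (w a)"
  shows "len D w = len D (w \<circ> s a) + 1"
proof -
  have "pos ((w \<circ> s a) a)"
    using w a p by (simp add: refl_self weyl_neg pos_neg_iff weyl_root)
  then have "len D ((w \<circ> s a) \<circ> s a) = len D (w \<circ> s a) + 1"
    using len_step_up[OF weyl_comp[OF w refl_weyl] a] a by simp
  then show ?thesis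
    using refl_comp_refl[of a] a by (simp add: comp_assoc)
qed

text \<open>  In particular the Weyl group acts faithfully on the roots, although these need not span.\<close>

lemma weyl_id_iff: "w \<in> W \<Longrightarrow> (\<And>b. pos b \<Longrightarrow> pos (w b)) \<Longrightarrow> w = id"
proof -
  assume w: "w \<in> W" and p: "\<And>b. pos b \<Longrightarrow> pos (w b)"
  have "inversions w = {}" using p by (auto simp: inversions_def)
  then show "w = id" using len_card[OF w] len_0[OF w] by simp
qed

lemma len_bound: "w \<in> W \<Longrightarrow> len D w \<le> card (roots D)"
  unfolding len_card by (rule card_mono[OF finite_roots]) (auto simp: inversions_def pos_root)

lemma finite_weyl: "finite W"
proof (rule finite_subset)
  show "finite (word_prod D ` {as. set as \<subseteq> simple D \<and> length as \<le> card (roots D)})"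
    by (intro finite_imageI finite_lists_length_le finite_simple)
  show "W \<subseteq> word_prod D ` {as. set as \<subseteq> simple D \<and> length as \<le> card (roots D)}"
    using word_exists len_bound by (fastforce simp: reduced_word_def)
qed

section \<open>Parabolic subgroups\<close>

text \<open>  The roots in the span of \<open>P\<close>, described by coordinates because the parabolic subgroup preserves
  the coordinates outside \<open>P\<close>.\<close>

definition par_root :: "'v set \<Rightarrow> 'v \<Rightarrow> bool" where
  "par_root P b \<longleftrightarrow> b \<in> roots D \<and> (\<forall>a\<in>simple D - P. coord a b = 0)"

lemma par_weyl: "P \<subseteq> simple D \<Longrightarrow> v \<in> refl_group D P \<Longrightarrow> v \<in> W"
  using refl_group_weyl simple_roots by blast

lemma par_inv: "P \<subseteq> simple D \<Longrightarrow> v \<in> refl_group D P \<Longrightarrow> inv v \<in> refl_group D P"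
  using refl_group_inv simple_roots by blast

lemma coord_par:
  assumes "P \<subseteq> simple D" "v \<in> refl_group D P" "a \<in> simple D - P"
  shows "coord a (v x) = coord a x"
  using assms(2)
proof (induction rule: refl_group.induct)
  case (step b w)
  then show ?case using assms coord_refl[of a b "w x"] by auto
qed simp

lemma par_root_weyl:
  "P \<subseteq> simple D \<Longrightarrow> v \<in> refl_group D P \<Longrightarrow> b \<in> roots D \<Longrightarrow> par_root P (v b) \<longleftrightarrow> par_root P b"
  using coord_par[of P v] par_weyl[of P v] by (auto simp: par_root_def weyl_root)

lemma inversions_par:
  assumes P: "P \<subseteq> simple D" and v: "v \<in> refl_group D P" and b: "b \<in> inversions v"
  shows "par_root P b"
proof (rule ccontr)
  assume "\<not> par_root P b"
  moreover have pb: "pos b" using b by (simp add: inversions_def)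
  ultimately obtain a where a: "a \<in> simple D - P" "coord a b \<noteq> 0" by (auto simp: par_root_def pos_def)
  then have "coord a (v b) > 0" using coord_par[OF P v a(1), of b] pb by (auto simp: pos_def less_le)
  then have "pos (v b)" using posI[of "v b" a] a par_weyl[OF P v] pb by (auto simp: weyl_root pos_root)
  then show False using b by (simp add: inversions_def)
qed

lemma pos_par: "P \<subseteq> simple D \<Longrightarrow> v \<in> refl_group D P \<Longrightarrow> pos b \<Longrightarrow> \<not> par_root P b \<Longrightarrow> pos (v b)"
  using inversions_par by (auto simp: inversions_def)

lemma par_root_expand:
  assumes P: "P \<subseteq> simple D" and b: "par_root P b"
  shows "b = (\<Sum>a\<in>P. coord a b *\<^sub>R a)"
proof -
  have "b = (\<Sum>a\<in>simple D. coord a b *\<^sub>R a)" using root_expand b by (simp add: par_root_def)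
  also have "\<dots> = (\<Sum>a\<in>P. coord a b *\<^sub>R a)"
    by (rule sum.mono_neutral_right) (use P b finite_simple in \<open>auto simp: par_root_def\<close>)
  finally show ?thesis .
qed

text \<open>  The root theoretic form of being a minimal coset representative, see \<open>min_reps_iff\<close>.\<close>

definition par_min :: "'v set \<Rightarrow> ('v \<Rightarrow> 'v) \<Rightarrow> bool" where
  "par_min P w \<longleftrightarrow> w \<in> W \<and> (\<forall>a\<in>P. pos (w a))"

lemma par_min_pos:
  assumes P: "P \<subseteq> simple D" and u: "par_min P u" and b: "pos b" "par_root P b"
  shows "pos (u b)"
proof -
  have uW: "u \<in> W" using u by (simp add: par_min_def)
  have "coord c (u b) \<ge> 0" if c: "c \<in> simple D" for c
  proof -
    have "u b = (\<Sum>a\<in>P. coord a b *\<^sub>R u a)"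
      using arg_cong[OF par_root_expand[OF P b(2)], of u]
      by (simp add: linear_sum[OF weyl_linear[OF uW]] linear_scale[OF weyl_linear[OF uW]])
    then have "coord c (u b) = (\<Sum>a\<in>P. coord a b * coord c (u a))"
      by (simp add: coord_simps(3,6))
    also have "\<dots> \<ge> 0"
      by (rule sum_nonneg) (use P u b c in \<open>auto simp: pos_def par_min_def intro!: mult_nonneg_nonneg\<close>)
    finally show ?thesis .
  qed
  then show ?thesis using uW b by (simp add: pos_def weyl_root)
qed

lemma par_root_neg: "par_root P b \<Longrightarrow> par_root P (- b)"
  by (simp add: par_root_def neg_root coord_simps(4))

text \<open>  The inversions of \<open>u \<circ> v\<close> are those of \<open>v\<close>, which lie in the subsystem of \<open>P\<close>, and the images under
  \<open>inv v\<close> of those of \<open>u\<close>, which lie outside; so the lengths add up.\<close>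

lemma len_par:
  assumes P: "P \<subseteq> simple D" and u: "par_min P u" and v: "v \<in> refl_group D P"
  shows "len D (u \<circ> v) = len D u + len D v"
proof -
  have uW: "u \<in> W" using u by (simp add: par_min_def)
  have vW: "v \<in> W" using par_weyl[OF P v] .
  have npu: "\<not> par_root P g" if "g \<in> inversions u" for g
    using that par_min_pos[OF P u] by (auto simp: inversions_def)
  have "inversions (u \<circ> v) = inversions v \<union> inv v ` inversions u"
  proof (intro equalityI subsetI)
    fix b assume b: "b \<in> inversions (u \<circ> v)"
    show "b \<in> inversions v \<union> inv v ` inversions u"
    proof (cases "pos (v b)")
      case True
      then have "v b \<in> inversions u" using b by (simp add: inversions_def)
      then show ?thesis using vW by (metis UnCI image_eqI weyl_inv1)
    qed (use b in \<open>simp add: inversions_def\<close>)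
  next
    fix b assume "b \<in> inversions v \<union> inv v ` inversions u"
    then show "b \<in> inversions (u \<circ> v)"
    proof
      assume b: "b \<in> inversions v"
      then have r: "pos b" "b \<in> roots D" "\<not> pos (v b)" "par_root P b"
        using inversions_par[OF P v] by (auto simp: inversions_def pos_root)
      have "pos (- v b)" "par_root P (- v b)"
        using r vW par_root_weyl[OF P v] by (auto simp: pos_neg_iff weyl_root par_root_neg)
      then have "pos (- u (v b))" using par_min_pos[OF P u] weyl_neg[OF uW] by metis
      then have "\<not> pos (u (v b))" using not_pos_neg by auto
      then show ?thesis using r by (simp add: inversions_def)
    next
      assume "b \<in> inv v ` inversions u"
      then obtain g where g: "g \<in> inversions u" "b = inv v g" by auto
      have "pos b" using g npu[OF g(1)] pos_par[OF P par_inv[OF P v], of g] by (auto simp: inversions_def)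
      then show ?thesis using g vW by (simp add: inversions_def)
    qed
  qed
  moreover have "inversions v \<inter> inv v ` inversions u = {}"
    using vW by (auto simp: inversions_def)
  moreover have "card (inv v ` inversions u) = card (inversions u)"
    by (rule card_image) (metis bij_is_inj inj_on_subset subset_UNIV vW weyl_bij weyl_inv)
  ultimately show ?thesis
    using uW vW finite_inversions by (simp add: len_card weyl_simps card_Un_disjoint)
qed

lemma min_reps_iff: 
  assumes P: "P \<subseteq> simple D"
  shows "w \<in> min_reps D P \<longleftrightarrow> par_min P w"
proof
  assume w: "w \<in> min_reps D P"
  then have wW: "w \<in> W" by (simp add: min_reps_def)
  have "pos (w a)" if a: "a \<in> P" for a
  proof (rule ccontr)
    assume "\<not> pos (w a)"
    then have "len D w = len D (w \<circ> s a) + 1" using len_step_down[OF wW] a P by auto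
    moreover have "len D w \<le> len D (w \<circ> s a)"
      using w refl_in_group[OF a] by (simp add: min_reps_def)
    ultimately show False by simp
  qed
  then show "par_min P w" using wW by (simp add: par_min_def)
next
  assume "par_min P w"
  then show "w \<in> min_reps D P" using len_par[OF P] by (auto simp: min_reps_def par_min_def)
qed

lemma min_rep_exists:
  assumes P: "P \<subseteq> simple D" and w: "w \<in> W"
  shows "\<exists>u\<in>min_reps D P. \<exists>v\<in>refl_group D P. w = u \<circ> v"
proof -
  define v where "v = arg_min_on (\<lambda>v. len D (w \<circ> v)) (refl_group D P)"
  have fin: "finite (refl_group D P)" "refl_group D P \<noteq> {}"
    using finite_subset[OF _ finite_weyl] par_weyl[OF P] refl_group.one by blast+
  have v: "v \<in> refl_group D P" unfolding v_def by (rule arg_min_if_finite(1)[OF fin])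
  have "w \<circ> v \<in> min_reps D P"
    unfolding min_reps_def
  proof (intro CollectI conjI ballI)
    show "w \<circ> v \<in> W" using w par_weyl[OF P v] by (simp add: weyl_simps)
    fix v' assume "v' \<in> refl_group D P"
    then show "len D (w \<circ> v) \<le> len D (w \<circ> v \<circ> v')"
      using arg_min_least[OF fin, of "v \<circ> v'" "\<lambda>v. len D (w \<circ> v)"] refl_group_comp[OF v, of v']
      by (simp add: v_def comp_assoc)
  qed
  moreover have "w = (w \<circ> v) \<circ> inv v" using par_weyl[OF P v] by simp
  ultimately show ?thesis using par_inv[OF P v] by blast
qed

lemma min_rep_unique:
  assumes P: "P \<subseteq> simple D" and u: "u \<in> min_reps D P" "u \<circ> v \<in> min_reps D P" and v: "v \<in> refl_group D P"
  shows "v = id"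
proof -
  have vW: "v \<in> W" using par_weyl[OF P v] .
  have "len D (u \<circ> v) = len D u + len D v"
    using len_par[OF P _ v, of u] u(1) min_reps_iff[OF P] by simp
  moreover have "len D (u \<circ> v \<circ> inv v) = len D (u \<circ> v) + len D (inv v)"
    using len_par[OF P _ par_inv[OF P v], of "u \<circ> v"] u(2) min_reps_iff[OF P] by blast
  moreover have "u \<circ> v \<circ> inv v = u" using vW by (rule weyl_inv_comp)
  ultimately have "len D u + len D v \<le> len D u" by simp
  then show ?thesis using len_0[OF vW] by simp
qed

section \<open>Longest elements\<close>

lemma longest:
  assumes P: "P \<subseteq> simple D"
  shows "longest D P \<in> refl_group D P" "v \<in> refl_group D P \<Longrightarrow> len D v \<le> len D (longest D P)"
proof -
  have b: "\<forall>y. y \<in> refl_group D P \<longrightarrow> len D y < Suc (card (roots D))"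
    using par_weyl[OF P] len_bound by (simp add: less_Suc_eq_le)
  show "longest D P \<in> refl_group D P"
    unfolding longest_def arg_max_on_def using arg_max_natI[OF refl_group.one b] .
  show "v \<in> refl_group D P \<Longrightarrow> len D v \<le> len D (longest D P)"
    unfolding longest_def arg_max_on_def using arg_max_nat_le[of "\<lambda>x. x \<in> refl_group D P", OF _ b] .
qed

lemma longest_weyl: "P \<subseteq> simple D \<Longrightarrow> longest D P \<in> W"
  using longest(1) par_weyl by blast

lemma longest_neg:
  assumes P: "P \<subseteq> simple D" and b: "pos b" "par_root P b"
  shows "pos (- longest D P b)" "par_root P (- longest D P b)"
proof -
  let ?v = "longest D P"
  have vW: "?v \<in> W" using longest_weyl[OF P] .
  show "par_root P (- ?v b)"
    using par_root_weyl[OF P longest(1)[OF P]] b by (simp add: par_root_neg pos_root)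
  have a: "\<not> pos (?v a)" if a: "a \<in> P" for a
  proof
    assume "pos (?v a)"
    then have "len D (?v \<circ> s a) = len D ?v + 1" using len_step_up[OF vW] a P by auto
    moreover have "?v \<circ> s a \<in> refl_group D P"
      using longest(1)[OF P] a by (simp add: refl_group_comp refl_in_group)
    ultimately show False using longest(2)[OF P] by fastforce
  qed
  have "coord c (- ?v b) \<ge> 0" if c: "c \<in> simple D" for c
  proof -
    have "- ?v b = (\<Sum>a\<in>P. coord a b *\<^sub>R (- ?v a))"
      using arg_cong[OF par_root_expand[OF P b(2)], of "\<lambda>x. - ?v x"]
      by (simp add: linear_sum[OF weyl_linear[OF vW]] linear_scale[OF weyl_linear[OF vW]] sum_negf)
    then have "coord c (- ?v b) = (\<Sum>a\<in>P. coord a b * coord c (- ?v a))"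
      by (simp only: coord_simps(3,6) real_scaleR_def)
    also have "\<dots> \<ge> 0"
    proof (rule sum_nonneg)
      fix x assume x: "x \<in> P"
      then have "pos (- ?v x)" using a[OF x] P vW by (auto simp: pos_neg_iff weyl_root)
      then show "0 \<le> coord x b * coord c (- ?v x)" using c b x P by (auto simp: pos_def)
    qed
    finally show ?thesis .
  qed
  then show "pos (- ?v b)" using vW b by (simp add: pos_def weyl_root neg_root)
qed

text \<open>  The map \<open>- longest D P\<close> permutes the positive roots of the subsystem of \<open>P\<close> and is linear. If a simple
  root \<open>a\<close> is the image of a positive root \<open>b\<close>, then \<open>a\<close> is a nonnegative combination of the
  positive roots that are images of the simple constituents of \<open>b\<close>; as \<open>a\<close> is indecomposable, one of these
  images is \<open>a\<close>.\<close>

lemma longest_perm: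
  assumes P: "P \<subseteq> simple D"
  shows "(\<lambda>a. - longest D P a) ` P = P"
proof -
  let ?v = "longest D P"
  let ?u = "\<lambda>a. - ?v a"
  let ?X = "{b. pos b \<and> par_root P b}"
  have vW: "?v \<in> W" using longest_weyl[OF P] .
  have finP: "finite P" using P finite_simple finite_subset by blast
  have inj: "inj ?u" by (rule injI) (metis neg_equal_iff_equal vW weyl_inv1)
  have simpleX: "a \<in> ?X" if "a \<in> P" for a
    using that P by (auto simp: par_root_def pos_simple coord_simple)
  have "finite ?X" by (rule finite_subset[OF _ finite_roots]) (auto simp: pos_root)
  moreover have sub: "?u ` ?X \<subseteq> ?X" using longest_neg[OF P] by auto
  ultimately have surj: "?u ` ?X = ?X"
    using endo_inj_surj inj by (metis inj_on_subset subset_UNIV)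
  have "P \<subseteq> ?u ` P"
  proof
    fix a assume a: "a \<in> P"
    then obtain b where b: "pos b" "par_root P b" "a = ?u b" using simpleX surj by blast
    have "a = (\<Sum>g\<in>P. coord g b *\<^sub>R (?u g))"
      using arg_cong[OF par_root_expand[OF P b(2)], of ?u] b(3)
      by (simp add: linear_sum[OF weyl_linear[OF vW]] linear_scale[OF weyl_linear[OF vW]] sum_negf)
    then have exp: "coord c a = (\<Sum>g\<in>P. coord g b * coord c (?u g))" for c
      using arg_cong[of a _ "coord c"] by (simp only: coord_simps(3,6) real_scaleR_def)
    have "\<exists>g\<in>P. coord g b \<noteq> 0"
    proof (rule ccontr)
      assume "\<not> (\<exists>g\<in>P. coord g b \<noteq> 0)"
      then have "b = 0" using par_root_expand[OF P b(2)] by simp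
      then show False using root_nonzero pos_root b(1) by blast
    qed
    then obtain g where g: "g \<in> P" "coord g b > 0" using b(1) P by (force simp: pos_def)
    have pg: "pos (?u g)" "par_root P (?u g)" using longest_neg[OF P] simpleX[OF g(1)] by auto
    have "?u g = a"
    proof (rule pos_single[OF pg(1)])
      show "a \<in> simple D" using a P by auto
      fix c assume c: "c \<in> simple D" "c \<noteq> a"
      have "(\<Sum>g\<in>P. coord g b * coord c (?u g)) = 0"
        using exp[of c] c a P coord_simple[of a c] by auto
      moreover have "0 \<le> coord x b * coord c (?u x)" if x: "x \<in> P" for x
        using x longest_neg(1)[OF P] simpleX[OF x] b(1) c P by (auto simp: pos_def)
      ultimately have "coord g b * coord c (?u g) = 0"
        using sum_nonneg_eq_0_iff[OF finP, of "\<lambda>g. coord g b * coord c (?u g)"] g(1) by simp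
      then show "coord c (?u g) = 0" using g(2) by simp
    qed
    then show "a \<in> ?u ` P" using g(1) by auto
  qed
  moreover have "card (?u ` P) = card P" using inj by (simp add: card_image inj_on_subset[OF inj])
  ultimately show ?thesis using finP by (metis card_subset_eq finite_imageI)
qed

lemma longest_simple_invol: "longest D (simple D) \<circ> longest D (simple D) = id"
proof -
  let ?w = "longest D (simple D)"
  have w: "?w \<in> W" by (rule longest_weyl) simp
  have pr: "par_root (simple D) b \<longleftrightarrow> b \<in> roots D" for b by (simp add: par_root_def)
  show ?thesis
  proof (rule weyl_id_iff)
    show "?w \<circ> ?w \<in> W" using w by (simp add: weyl_simps)
    fix b assume "pos b"
    then have "pos (- ?w b)" using longest_neg(1)[of "simple D" b] pr pos_root by auto
    then have "pos (- ?w (- ?w b))" using longest_neg(1)[of "simple D"] pr pos_root by auto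
    then show "pos ((?w \<circ> ?w) b)" using weyl_neg[OF w] by simp
  qed
qed

lemma dual_par_simple: "P \<subseteq> simple D \<Longrightarrow> dual_par D P \<subseteq> simple D"
  using longest_perm[of "simple D"] by (auto simp: dual_par_def)

context
  fixes P assumes P: "P \<subseteq> simple D"
begin

lemma w0_weyl: "(w_up D P) \<in> W"
  using longest_weyl[OF dual_par_simple[OF P]] longest_weyl[of "simple D"] by (simp add: w_up_def weyl_simps)

text \<open>  Both longest elements map their simple roots to negatives of simple roots, so the signs cancel in the product
  that defines \<open>w_up\<close>.\<close>

lemma w0_image: "(w_up D P) ` (dual_par D P) = P"
proof -
  let ?w = "longest D (simple D)" and ?v = "longest D (dual_par D P)"
  have w: "?w \<in> W" by (rule longest_weyl) simp
  have "(w_up D P) a = ?w (- (- ?v a))" for a by (simp add: w_up_def)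
  then have "(w_up D P) ` (dual_par D P) = (\<lambda>a. ?w (- a)) ` ((\<lambda>a. - ?v a) ` (dual_par D P))" by (simp add: image_image)
  also have "\<dots> = (\<lambda>a. ?w (- a)) ` (dual_par D P)" using longest_perm[OF dual_par_simple[OF P]] by simp
  also have "\<dots> = (\<lambda>a. (?w \<circ> ?w) a) ` P" by (simp add: dual_par_def image_image)
  also have "\<dots> = P" by (simp add: longest_simple_invol)
  finally show ?thesis .
qed

lemma w0_min: "par_min (dual_par D P) (w_up D P)"
  using w0_weyl w0_image P pos_simple by (auto simp: par_min_def)

lemma w0_min_reps: "(w_up D P) \<in> min_reps D (dual_par D P)"
  using w0_min min_reps_iff[OF dual_par_simple[OF P]] by simp

lemma w0_conj: "m \<in> refl_group D P \<Longrightarrow> inv (w_up D P) \<circ> m \<circ> (w_up D P) \<in> refl_group D (dual_par D P)"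
proof (induction rule: refl_group.induct)
  case one
  show ?case unfolding comp_id weyl_inv_comp(1)[OF w0_weyl] by (rule refl_group.one)
next
  case (step a w)
  obtain b where b: "b \<in> (dual_par D P)" "a = (w_up D P) b" using w0_image step(1) by blast
  have "s a \<circ> (w_up D P) = (w_up D P) \<circ> s b"
    using b refl_conj_comp[OF w0_weyl, of b] dual_par_simple[OF P] by auto
  then have "s b = inv (w_up D P) \<circ> s a \<circ> (w_up D P)" using w0_weyl by (simp add: comp_assoc)
  then have "inv (w_up D P) \<circ> (s a \<circ> w) \<circ> (w_up D P) = s b \<circ> (inv (w_up D P) \<circ> w \<circ> (w_up D P))"
    using w0_weyl by (simp add: comp_assoc)
  then show ?case using step(3) b(1) refl_group.step by metis
qed

text \<open>  The longest element of the parabolic subgroup permutes the positive roots outside the subsystem, and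
  the longest element of the whole group then makes all of them negative.\<close>

lemma inversions_w0: "inversions (w_up D P) = {b. pos b \<and> \<not> par_root (dual_par D P) b}"
proof (intro equalityI subsetI)
  fix b assume "b \<in> inversions (w_up D P)"
  then show "b \<in> {b. pos b \<and> \<not> par_root (dual_par D P) b}"
    using par_min_pos[OF dual_par_simple[OF P] w0_min] by (auto simp: inversions_def)
next
  fix b assume "b \<in> {b. pos b \<and> \<not> par_root (dual_par D P) b}"
  then have b: "pos b" "\<not> par_root (dual_par D P) b" by auto
  let ?v = "longest D (dual_par D P)" and ?w = "longest D (simple D)"
  have "pos (?v b)" using pos_par[OF dual_par_simple[OF P] longest(1)[OF dual_par_simple[OF P]] b] .
  then have "pos (- ?w (?v b))"
    using longest_neg(1)[of "simple D"] by (simp add: par_root_def pos_root)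
  then show "b \<in> inversions (w_up D P)" using b not_pos_neg by (auto simp: inversions_def w_up_def)
qed

text \<open>  Multiplying on the right by the same element of the parabolic subgroup takes \<open>w_up D P\<close> to the longest
  element of the Weyl group, and lengths add up for every minimal representative.\<close>

lemma len_min_reps_le_w0:
  assumes u: "u \<in> min_reps D (dual_par D P)"
  shows "len D u \<le> len D (w_up D P)"
proof -
  note dual = dual_par_simple[OF P]
  let ?v = "longest D (dual_par D P)" and ?w = "longest D (simple D)"
  have v: "inv ?v \<in> refl_group D (dual_par D P)" using par_inv[OF dual longest(1)[OF dual]] .
  have "len D u + len D (inv ?v) = len D (u \<circ> inv ?v)"
    using len_par[OF dual _ v] u min_reps_iff[OF dual] by simp
  also have "\<dots> \<le> len D ?w"
    using longest(2)[of "simple D"] u par_weyl[OF dual v] by (simp add: weyl_simple[symmetric] weyl_simps min_reps_def)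
  also have "?w = (w_up D P) \<circ> inv ?v" using longest_weyl[OF dual] by (simp add: w_up_def comp_assoc)
  also have "len D ((w_up D P) \<circ> inv ?v) = len D (w_up D P) + len D (inv ?v)"
    using len_par[OF dual w0_min v] .
  finally show ?thesis by simp
qed

end

lemma par_inversions_stable:
  assumes Q: "Q \<subseteq> simple D" and m: "m \<in> refl_group D Q"
  shows "m ` {b. pos b \<and> \<not> par_root Q b} = {b. pos b \<and> \<not> par_root Q b}"
proof -
  have *: "m ` {b. pos b \<and> \<not> par_root Q b} \<subseteq> {b. pos b \<and> \<not> par_root Q b}"
    if "m \<in> refl_group D Q" for m
    using pos_par[OF Q that] par_root_weyl[OF Q that] by (auto simp: pos_root)
  have "x \<in> m ` {b. pos b \<and> \<not> par_root Q b}" if "x \<in> {b. pos b \<and> \<not> par_root Q b}" for x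
    using *[OF par_inv[OF Q m]] that par_weyl[OF Q m]
    by (intro image_eqI[of _ _ "inv m x"]) auto
  then show ?thesis using *[OF m] by blast
qed

section \<open>Parameters of roots\<close>

text \<open>  The parameter \<open>k\<^sub>\<beta>\<close> of a root, taken from any simple root in its orbit. The choice is harmless
  because the parameters of conjugate simple roots agree (\<open>root_param_orbit\<close>).\<close>

definition root_param :: "'v \<Rightarrow> real" where
  "root_param b = param D (SOME a. a \<in> simple D \<and> (\<exists>w\<in>W. w a = b))"

lemma root_param_orbit:
  assumes a: "a \<in> simple D" and w: "w \<in> W"
  shows "root_param (w a) = param D a"
proof -
  let ?c = "SOME c. c \<in> simple D \<and> (\<exists>v\<in>W. v c = w a)"
  have "?c \<in> simple D \<and> (\<exists>v\<in>W. v ?c = w a)" using a w by (intro someI_ex[of "\<lambda>c. c \<in> simple D \<and> (\<exists>v\<in>W. v c = w a)"]) auto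
  then obtain v where v: "?c \<in> simple D" "v \<in> W" "v ?c = w a" by auto
  then have "(inv w \<circ> v) ?c = a" using w by simp
  moreover have "inv w \<circ> v \<in> W" using v w by (simp add: weyl_simps)
  ultimately have "param D ?c = param D a"
    using root_datum v(1) a unfolding root_datum_def by blast
  then show ?thesis by (simp add: root_param_def)
qed

lemma root_param_simple: "a \<in> simple D \<Longrightarrow> root_param a = param D a"
  using root_param_orbit[OF _ id_weyl] by simp

lemma root_param_weyl: "b \<in> roots D \<Longrightarrow> w \<in> W \<Longrightarrow> root_param (w b) = root_param b"
proof -
  assume b: "b \<in> roots D" and w: "w \<in> W"
  obtain v a where v: "v \<in> W" "a \<in> simple D" "v a = b" using root_orbit[OF b] by auto
  have "root_param ((w \<circ> v) a) = param D a" using root_param_orbit v w weyl_comp by blast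
  then show ?thesis using root_param_orbit[OF v(2,1)] v(3) by simp
qed

end

section \<open>The symmetric algebra\<close>

lemma ring_hom_funD:
  assumes "ring_hom_fun f"
  shows "f 1 = 1" "f (x + y) = f x + f y" "f (x * y) = f x * f y" "f 0 = 0" "f (- x) = - f x" "f (x - y) = f x - f y"
    "f (sum g A) = (\<Sum>i\<in>A. f (g i))"
proof -
  show 1: "f 1 = 1" "f (x + y) = f x + f y" "f (x * y) = f x * f y" for x y
    using assms by (auto simp: ring_hom_fun_def)
  show 2: "f 0 = 0" using 1(2)[of 0 0] by simp
  show 3: "f (- x) = - f x" for x using 1(2)[of x "- x"] 2 minus_unique[of "f x" "f (- x)"] by simp
  show "f (x - y) = f x - f y" using 1(2)[of x "- y"] 3[of y] by simp
  show "f (sum g A) = (\<Sum>i\<in>A. f (g i))"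
    by (induction A rule: infinite_finite_induct) (simp_all add: 1 2)
qed

locale symalg =
  fixes c :: "complex \<Rightarrow> 's::idom" and \<iota> :: "'v::real_vector \<Rightarrow> 's"
  assumes symalg_axiom: "symmetric_algebra c \<iota>"
begin

lemma c_hom: "ring_hom_fun c"
  and inc_add: "\<iota> (x + y) = \<iota> x + \<iota> y"
  and inc_scale: "\<iota> (r *\<^sub>R x) = c (of_real r) * \<iota> x"
  using symalg_axiom by (auto simp: symmetric_algebra_def)

lemmas c_simps = ring_hom_funD[OF c_hom]

lemma inc_0: "\<iota> 0 = 0" using inc_scale[of 0 0] by (simp add: c_simps)
lemma inc_neg: "\<iota> (- x) = - \<iota> x" using inc_add[of x "- x"] inc_0 minus_unique[of "\<iota> x" "\<iota> (- x)"] by simp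
lemma inc_diff: "\<iota> (x - y) = \<iota> x - \<iota> y" using inc_add[of x "- y"] inc_neg by simp
lemma inc_sum: "\<iota> (sum g A) = (\<Sum>i\<in>A. \<iota> (g i))"
  by (induction A rule: infinite_finite_induct) (simp_all add: inc_add inc_0)

lemma c_eq_0: "c z = 0 \<longleftrightarrow> z = 0"
proof
  assume z: "c z = 0"
  show "z = 0"
  proof (rule ccontr)
    assume "z \<noteq> 0"
    then have "c (z * inverse z) = 1" by (simp add: c_simps)
    then show False using z by (simp only: c_simps) simp
  qed
qed (simp add: c_simps)

lemma basis:
  "\<exists>B. finite B \<and> span B = UNIV \<and> (\<forall>a. \<exists>!p::('v \<Rightarrow> nat) \<Rightarrow> complex.
           finite {e. p e \<noteq> 0} \<and> (\<forall>e. p e \<noteq> 0 \<longrightarrow> (\<forall>b. b \<notin> B \<longrightarrow> e b = 0)) \<and>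
           a = (\<Sum>e | p e \<noteq> 0. c (p e) * (\<Prod>b\<in>B. \<iota> b ^ e b)))"
  using symalg_axiom unfolding symmetric_algebra_def by (elim conjE exE) (intro exI conjI, assumption+)

lemma sym_induct [case_names const inc add mult]:
  assumes "\<And>z. Q (c z)" "\<And>v. Q (\<iota> v)" "\<And>a b. Q a \<Longrightarrow> Q b \<Longrightarrow> Q (a + b)" "\<And>a b. Q a \<Longrightarrow> Q b \<Longrightarrow> Q (a * b)"
  shows "Q a"
proof -
  have one: "Q 1" "Q 0" using assms(1)[of 1] assms(1)[of 0] by (simp_all add: c_simps)
  have pow: "Q (x ^ n)" if "Q x" for x n using that one by (induction n) (auto intro: assms)
  have prod: "Q (prod g A)" if "\<And>i. Q (g i)" for g :: "'i \<Rightarrow> 's" and A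
    by (induction A rule: infinite_finite_induct) (use that one assms in auto)
  have sum: "Q (sum g A)" if "\<And>i. Q (g i)" for g :: "'i \<Rightarrow> 's" and A
    by (induction A rule: infinite_finite_induct) (use that one assms in auto)
  obtain B where "\<exists>!p::('v \<Rightarrow> nat) \<Rightarrow> complex.
           finite {e. p e \<noteq> 0} \<and> (\<forall>e. p e \<noteq> 0 \<longrightarrow> (\<forall>b. b \<notin> B \<longrightarrow> e b = 0)) \<and>
           a = (\<Sum>e | p e \<noteq> 0. c (p e) * (\<Prod>b\<in>B. \<iota> b ^ e b))"
    using basis by (elim exE conjE) (drule spec)
  then obtain p where "a = (\<Sum>e | p e \<noteq> 0. c (p e) * (\<Prod>b\<in>B. \<iota> b ^ e b))"
    by (elim ex1E conjE)
  moreover have "Q (\<Sum>e | p e \<noteq> 0. c (p e) * (\<Prod>b\<in>B. \<iota> b ^ e b))"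
    by (intro sum assms(4) prod pow assms(1,2))
  ultimately show ?thesis by (rule ssubst)
qed

text \<open>  Expand an element in monomials of the given basis and substitute. The map is well defined and additive since
  the expansion is unique; multiplicativity can be checked on monomials.\<close>

lemma universal:
  fixes f :: "'v \<Rightarrow> 's"
  assumes fadd: "\<And>x y. f (x + y) = f x + f y" and fscale: "\<And>r x. f (r *\<^sub>R x) = c (of_real r) * f x"
  obtains \<tau> where "ring_hom_fun \<tau>" "\<And>z. \<tau> (c z) = c z" "\<And>v. \<tau> (\<iota> v) = f v"
proof -
  obtain B where B: "finite B" "span B = UNIV" and U: "\<forall>a. \<exists>!p::('v \<Rightarrow> nat) \<Rightarrow> complex.
           finite {e. p e \<noteq> 0} \<and> (\<forall>e. p e \<noteq> 0 \<longrightarrow> (\<forall>b. b \<notin> B \<longrightarrow> e b = 0)) \<and>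
           a = (\<Sum>e | p e \<noteq> 0. c (p e) * (\<Prod>b\<in>B. \<iota> b ^ e b))"
    using basis by (elim exE conjE)
  note uniq = spec[OF U]
  define adm where "adm = {e::'v \<Rightarrow> nat. \<forall>b. b \<notin> B \<longrightarrow> e b = 0}"
  define mon where "mon e = (\<Prod>b\<in>B. \<iota> b ^ e b)" for e
  define tmon where "tmon e = (\<Prod>b\<in>B. f b ^ e b)" for e
  define rep where "rep a = (THE p. finite {e. p e \<noteq> 0} \<and> (\<forall>e. p e \<noteq> 0 \<longrightarrow> (\<forall>b. b \<notin> B \<longrightarrow> e b = 0)) \<and>
           a = (\<Sum>e | p e \<noteq> 0. c (p e) * (\<Prod>b\<in>B. \<iota> b ^ e b)))" for a
  define \<tau> where "\<tau> a = (\<Sum>e | rep a e \<noteq> 0. c (rep a e) * tmon e)" for a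
  have rep: "finite {e. rep a e \<noteq> 0}" "{e. rep a e \<noteq> 0} \<subseteq> adm"
    "(\<Sum>e | rep a e \<noteq> 0. c (rep a e) * mon e) = a" for a
    using theI'[OF uniq[of a]] unfolding rep_def[symmetric] by (auto simp: adm_def mon_def)
  have rep_eq: "rep (\<Sum>e\<in>E. c (q e) * mon e) = q" if E: "finite E" "E \<subseteq> adm" "\<And>e. e \<notin> E \<Longrightarrow> q e = 0" for E q
    unfolding rep_def
  proof (rule the1_equality[OF uniq], intro conjI)
    show "finite {e. q e \<noteq> 0}" by (rule finite_subset[OF _ E(1)]) (use E(3) in auto)
    show "\<forall>e. q e \<noteq> 0 \<longrightarrow> (\<forall>b. b \<notin> B \<longrightarrow> e b = 0)" using E by (auto simp: adm_def)
    show "(\<Sum>e\<in>E. c (q e) * mon e) = (\<Sum>e | q e \<noteq> 0. c (q e) * (\<Prod>b\<in>B. \<iota> b ^ e b))"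
      unfolding mon_def by (rule sum.mono_neutral_right) (use E c_simps in auto)
  qed
  have tau_eq: "\<tau> (\<Sum>e\<in>E. c (q e) * mon e) = (\<Sum>e\<in>E. c (q e) * tmon e)"
    if E: "finite E" "E \<subseteq> adm" "\<And>e. e \<notin> E \<Longrightarrow> q e = 0" for E q
  proof -
    have r: "rep (\<Sum>e\<in>E. c (q e) * mon e) = q" by (rule rep_eq) (use E in auto)
    show ?thesis
      unfolding \<tau>_def r by (rule sum.mono_neutral_left) (use E c_simps in auto)
  qed
  have tau_mono: "\<tau> (c z * mon e) = c z * tmon e" if "e \<in> adm" for z e
    using tau_eq[of "{e}" "\<lambda>x. if x = e then z else 0"] that by simp
  have ext: "(\<Sum>e | rep a e \<noteq> 0. c (rep a e) * g e) = (\<Sum>e\<in>E. c (rep a e) * g e)"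
    if "finite E" "{e. rep a e \<noteq> 0} \<subseteq> E" for a E g
    by (rule sum.mono_neutral_left) (use that c_simps in auto)
  have tau_add: "\<tau> (a + a') = \<tau> a + \<tau> a'" for a a'
  proof -
    let ?E = "{e. rep a e \<noteq> 0} \<union> {e. rep a' e \<noteq> 0}"
    have fE: "finite ?E" "?E \<subseteq> adm" using rep by auto
    have "a + a' = (\<Sum>e\<in>?E. c (rep a e + rep a' e) * mon e)"
      using ext[OF fE(1), of a mon] ext[OF fE(1), of a' mon] rep(3)[of a] rep(3)[of a']
      by (auto simp: c_simps distrib_right sum.distrib)
    then have "\<tau> (a + a') = (\<Sum>e\<in>?E. c (rep a e + rep a' e) * tmon e)"
      using tau_eq[OF fE, of "\<lambda>e. rep a e + rep a' e"] by simp
    also have "\<dots> = \<tau> a + \<tau> a'"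
      using ext[OF fE(1), of a tmon] ext[OF fE(1), of a' tmon]
      by (auto simp: \<tau>_def c_simps distrib_right sum.distrib)
    finally show ?thesis .
  qed
  have tau_0: "\<tau> 0 = 0" using tau_mono[of "\<lambda>_. 0" 0] by (simp add: adm_def c_simps)
  have tau_sum: "\<tau> (sum g A) = (\<Sum>i\<in>A. \<tau> (g i))" for g :: "'i \<Rightarrow> 's" and A
    by (induction A rule: infinite_finite_induct) (simp_all add: tau_0 tau_add)
  have mon_add: "mon (\<lambda>b. e b + e' b) = mon e * mon e'" "tmon (\<lambda>b. e b + e' b) = tmon e * tmon e'" for e e'
    by (simp_all add: mon_def tmon_def power_add prod.distrib)
  have tau_mult: "\<tau> (a * a') = \<tau> a * \<tau> a'" for a a'
  proof -
    let ?E = "{e. rep a e \<noteq> 0}" and ?F = "{e. rep a' e \<noteq> 0}"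
    have "a * a' = (\<Sum>e\<in>?E. \<Sum>e'\<in>?F. (c (rep a e) * mon e) * (c (rep a' e') * mon e'))"
      using sum_product[of "\<lambda>e. c (rep a e) * mon e" ?E "\<lambda>e. c (rep a' e) * mon e" ?F]
      unfolding rep(3) .
    also have "\<dots> = (\<Sum>e\<in>?E. \<Sum>e'\<in>?F. c (rep a e * rep a' e') * mon (\<lambda>b. e b + e' b))"
      by (simp add: mon_add c_simps mult_ac)
    finally have "\<tau> (a * a') = (\<Sum>e\<in>?E. \<Sum>e'\<in>?F. \<tau> (c (rep a e * rep a' e') * mon (\<lambda>b. e b + e' b)))"
      by (simp add: tau_sum)
    also have "\<dots> = (\<Sum>e\<in>?E. \<Sum>e'\<in>?F. c (rep a e * rep a' e') * tmon (\<lambda>b. e b + e' b))"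
      by (intro sum.cong refl tau_mono) (use rep(2) in \<open>fastforce simp: adm_def\<close>)
    also have "\<dots> = \<tau> a * \<tau> a'"
      unfolding \<tau>_def sum_product by (simp add: mon_add c_simps mult_ac)
    finally show ?thesis .
  qed
  have z: "(\<lambda>_. 0) \<in> adm" by (simp add: adm_def)
  have tau_c: "\<tau> (c z) = c z" for z
    using tau_mono[OF z, of z] by (simp add: mon_def tmon_def)
  have tau_b: "\<tau> (\<iota> b) = f b" if b: "b \<in> B" for b
  proof -
    let ?e = "\<lambda>x. if x = b then 1 else 0 :: nat"
    have "?e \<in> adm" using b by (auto simp: adm_def)
    moreover have "mon ?e = \<iota> b" "tmon ?e = f b"
      using b B(1) by (simp_all add: mon_def tmon_def if_distrib prod.delta cong: if_cong)
    ultimately show ?thesis using tau_mono[of ?e 1] by (simp add: c_simps)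
  qed
  have f0: "f 0 = 0" using fscale[of 0 0] by (simp add: c_simps)
  have fsum: "f (sum g A) = (\<Sum>i\<in>A. f (g i))" for g :: "'v \<Rightarrow> 'v" and A
    by (induction A rule: infinite_finite_induct) (simp_all add: f0 fadd)
  have tau_inc: "\<tau> (\<iota> v) = f v" for v
  proof -
    have "v \<in> range (\<lambda>r. \<Sum>b\<in>B. r b *\<^sub>R b)"
      unfolding span_finite[OF B(1), symmetric] B(2) by (rule UNIV_I)
    then obtain r where "v = (\<Sum>b\<in>B. r b *\<^sub>R b)" by (rule imageE)
    then show ?thesis
      by (simp add: inc_sum fsum tau_sum inc_scale fscale tau_mult tau_c tau_b)
  qed
  show thesis
  proof (rule that)
    show "ring_hom_fun \<tau>"
      using tau_c[of 1] by (auto simp: ring_hom_fun_def tau_add tau_mult c_simps)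
  qed (simp_all add: tau_c tau_inc)
qed

lemma functional_exists:
  assumes "(v::'v) \<noteq> 0"
  obtains g :: "'v \<Rightarrow> real" where "linear g" "g v = 1"
proof -
  have "independent {v}" using assms by simp
  from linear_independent_extend[OF this, of "\<lambda>_. 1::real"] that show ?thesis by auto
qed

text \<open>  Constants and linear forms are separated by substitutions: first of zero, then of a functional with the
  value one at the vector.\<close>

lemma inc_eq_c:
  assumes "\<iota> v = c z"
  shows "v = 0" "z = 0"
proof -
  obtain \<tau> where t: "\<And>z. \<tau> (c z) = c z" "\<And>v. \<tau> (\<iota> v) = (0::'s)"
    by (rule universal[of "\<lambda>_. 0"]) auto
  have "c z = 0" using assms t by metis
  then show z: "z = 0" by (simp add: c_eq_0)
  show "v = 0"
  proof (rule ccontr)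
    assume "v \<noteq> 0"
    then obtain g :: "'v \<Rightarrow> real" where g: "linear g" "g v = 1" by (rule functional_exists)
    obtain \<tau> where t: "\<And>z. \<tau> (c z) = c z" "\<And>v. \<tau> (\<iota> v) = c (of_real (g v))"
      by (rule universal[of "\<lambda>v. c (of_real (g v))"]) (auto simp: linear_add[OF g(1)] linear_scale[OF g(1)] c_simps)
    have "c 1 = c 0" using assms z t(1)[of 0] t(2)[of v] g(2) by simp
    then show False by (simp add: c_simps)
  qed
qed

lemma inc_inj: "\<iota> x = \<iota> y \<longleftrightarrow> x = y"
  using inc_eq_c(1)[of "x - y" 0] by (auto simp: inc_diff c_simps)

lemma affine_form_nonzero: "k \<noteq> 0 \<or> b \<noteq> 0 \<Longrightarrow> c k - \<iota> b \<noteq> 0"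
  using inc_eq_c[of b k] by auto

text \<open>  Let \<open>l = c k - \<iota> b\<close>. Choose a functional \<open>g\<close> with \<open>g b = 1\<close> and substitute \<open>\<iota> v + g(v) l\<close> for \<open>\<iota> v\<close>.
  This endomorphism \<open>\<tau>\<close> kills \<open>l\<close> and is the identity modulo \<open>l\<close>, so its kernel is the ideal of \<open>l\<close>,
  which is prime because the ring is a domain. The image of a nonzero linear form is nonzero, as \<open>k \<noteq> 0\<close>.\<close>

lemma affine_form_prime:
  assumes k: "k \<noteq> 0" and b: "b' \<noteq> 0" and d: "c k - \<iota> b dvd \<iota> b' * a"
  shows "c k - \<iota> b dvd a"
proof (cases "b = 0")
  case True
  then have "(c k - \<iota> b) * c (inverse k) = 1" using k by (simp add: inc_0 flip: c_simps(1,3))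
  then have "a = (c k - \<iota> b) * (c (inverse k) * a)" by (simp add: mult.assoc[symmetric])
  then show ?thesis by (metis dvd_triv_left)
next
  case False
  then obtain g :: "'v \<Rightarrow> real" where g: "linear g" "g b = 1" by (rule functional_exists)
  let ?l = "c k - \<iota> b"
  obtain \<tau> where t: "ring_hom_fun \<tau>" "\<And>z. \<tau> (c z) = c z" "\<And>v. \<tau> (\<iota> v) = \<iota> v + c (of_real (g v)) * ?l"
    by (rule universal[of "\<lambda>v. \<iota> v + c (of_real (g v)) * ?l"])
       (auto simp: linear_add[OF g(1)] linear_scale[OF g(1)] c_simps inc_add inc_scale algebra_simps)
  note ts = ring_hom_funD[OF t(1)]
  have l0: "\<tau> ?l = 0" using g(2) by (simp add: ts t c_simps)
  have cong: "?l dvd x - \<tau> x" for x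
  proof (induction x rule: sym_induct)
    case (const z) then show ?case by (simp add: t)
  next
    case (inc v) then show ?case by (simp add: t)
  next
    case (add x y)
    have "x + y - \<tau> (x + y) = (x - \<tau> x) + (y - \<tau> y)" by (simp add: ts)
    then show ?case using add by (metis dvd_add)
  next
    case (mult x y)
    have "x * y - \<tau> (x * y) = x * (y - \<tau> y) + (x - \<tau> x) * \<tau> y" by (simp add: ts algebra_simps)
    then show ?case using mult by (metis dvd_add dvd_mult dvd_mult2)
  qed
  obtain q where "\<iota> b' * a = ?l * q" using d by (auto elim: dvdE)
  then have "\<tau> (\<iota> b') * \<tau> a = 0" using l0 by (metis mult_zero_left ts(3))
  moreover have "\<tau> (\<iota> b') \<noteq> 0"
  proof
    assume "\<tau> (\<iota> b') = 0"
    then have "\<iota> (g b' *\<^sub>R b - b') = c (of_real (g b') * k)"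
      by (simp add: t inc_diff inc_scale c_simps algebra_simps)
    then have "g b' *\<^sub>R b - b' = 0" "of_real (g b') * k = 0" using inc_eq_c by blast+
    then show False using k b by simp
  qed
  ultimately have "\<tau> a = 0" by simp
  then show ?thesis using cong[of a] by simp
qed

end


section \<open>The rational Hecke algebra\<close>

locale hecke =
  fixes D :: "('v::real_vector, 'd::real_vector, 's::idom, 'h::ring_1, 'g::ring_1) hecke"
  assumes graded_hecke: "graded_hecke D"
begin

sublocale rdat D
  by unfold_locales (use graded_hecke in \<open>simp add: graded_hecke_def\<close>)

sublocale symalg "const D" "inc D"
  by unfold_locales (use graded_hecke in \<open>simp add: graded_hecke_def\<close>)

text \<open>  Most of the work takes place in the rational extension; the following are the images of the group
  elements, of the polynomials and of the rational functions there.\<close>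

abbreviation "t w \<equiv> emb D (tw D w)"
abbreviation "E a \<equiv> emb D (pol D a)"
abbreviation "r \<equiv> rat D"
abbreviation "K a \<equiv> const D (of_real (param D a))"

lemma weyl_action: "weyl_action D"
  and hecke_relations: "graded_hecke_algebra D"
  and star_op: "star_operation D"
  and rat_ext: "rational_extension D"
  using graded_hecke by (simp_all add: graded_hecke_def)

lemma wact_hom: "w \<in> W \<Longrightarrow> ring_hom_fun (wact D w)"
  and wact_const [simp]: "w \<in> W \<Longrightarrow> wact D w (const D z) = const D z"
  and wact_inc [simp]: "w \<in> W \<Longrightarrow> wact D w (inc D v) = inc D (w v)"
  using weyl_action by (simp_all add: weyl_action_def)

lemmas wact_simps = ring_hom_funD[OF wact_hom]

lemma wact_prod: "w \<in> W \<Longrightarrow> wact D w (prod g A) = (\<Prod>i\<in>A. wact D w (g i))"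
  by (induction A rule: infinite_finite_induct) (simp_all add: wact_simps)

lemma sym_hom_eqI:
  assumes "ring_hom_fun f" "ring_hom_fun g" "\<And>z. f (const D z) = g (const D z)" "\<And>v. f (inc D v) = g (inc D v)"
  shows "f a = (g a :: 's)"
  by (induction a rule: sym_induct)
     (use assms in \<open>simp_all add: ring_hom_funD[OF assms(1)] ring_hom_funD[OF assms(2)]\<close>)

lemma wact_id: "wact D id a = a"
proof (rule sym_hom_eqI[of "wact D id" "\<lambda>a. a"])
  show "ring_hom_fun (wact D id)" using id_weyl by (rule wact_hom)
  show "ring_hom_fun (\<lambda>a::'s. a)" unfolding ring_hom_fun_def by blast
  show "wact D id (const D z) = const D z" for z using id_weyl by (rule wact_const)
  show "wact D id (inc D v) = inc D v" for v using wact_inc[OF id_weyl, of v] by simp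
qed

lemma wact_comp:
  assumes "v \<in> W" "w \<in> W"
  shows "wact D (v \<circ> w) a = wact D v (wact D w a)"
proof (rule sym_hom_eqI[of "wact D (v \<circ> w)" "\<lambda>a. wact D v (wact D w a)"])
  show "ring_hom_fun (wact D (v \<circ> w))" using weyl_comp[OF assms] by (rule wact_hom)
  show "ring_hom_fun (\<lambda>a. wact D v (wact D w a))"
    using assms unfolding ring_hom_fun_def by (simp add: wact_simps)
  show "wact D (v \<circ> w) (const D z) = wact D v (wact D w (const D z))" for z
    using assms wact_const[OF weyl_comp[OF assms]] by simp
  show "wact D (v \<circ> w) (inc D x) = wact D v (wact D w (inc D x))" for x
    using assms wact_inc[OF weyl_comp[OF assms]] by simp
qed

lemma wact_inv: "w \<in> W \<Longrightarrow> wact D (inv w) (wact D w a) = a"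
  "w \<in> W \<Longrightarrow> wact D w (wact D (inv w) a) = a"
  using wact_comp[of "inv w" w a] wact_comp[of w "inv w" a] weyl_inv[of w] wact_id[of a]
  by simp_all

lemma wact_eq_0: "w \<in> W \<Longrightarrow> wact D w a = 0 \<longleftrightarrow> a = 0"
  using wact_inv(1)[of w a] by (metis wact_simps(4) weyl_inv)

lemma wact_faithful:
  assumes "v \<in> W" "w \<in> W" "\<And>a. wact D v a = wact D w a"
  shows "v = w"
proof
  fix x
  show "v x = w x" using assms(3)[of "inc D x"] assms(1,2) by (simp add: inc_inj)
qed

lemma inc_root: "b \<in> roots D \<Longrightarrow> inc D b \<noteq> 0"
  using inc_inj[of b 0] root_nonzero by (simp add: inc_0)

text \<open>  The set of polynomials for which the quotient exists contains the generators and is closed under products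
  by the twisted Leibniz rule.\<close>

lemma divided_diff:
  assumes a: "a \<in> simple D"
  shows "inc D a * divided_diff D a b = b - wact D (s a) b"
proof -
  have sW: "s a \<in> W" using a by (simp add: refl_weyl)
  have "\<exists>q. inc D a * q = b - wact D (s a) b"
  proof (induction b rule: sym_induct)
    case (const z) show ?case using sW by (intro exI[of _ 0]) simp
  next
    case (inc v)
    show ?case using sW
      by (intro exI[of _ "const D (of_real (pairing D v (coroot D a)))"])
         (simp add: refl_def inc_diff inc_scale)
  next
    case (add x y)
    then obtain p q where "inc D a * p = x - wact D (s a) x" "inc D a * q = y - wact D (s a) y" by auto
    then show ?case using sW by (intro exI[of _ "p + q"]) (simp add: wact_simps distrib_left)
  next
    case (mult x y)
    then obtain p q where "inc D a * p = x - wact D (s a) x" "inc D a * q = y - wact D (s a) y" by auto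
    then have "x * (inc D a * q) + (inc D a * p) * wact D (s a) y = x * (y - wact D (s a) y) + (x - wact D (s a) x) * wact D (s a) y"
      by simp
    then have "inc D a * (x * q + p * wact D (s a) y) = x * y - wact D (s a) x * wact D (s a) y"
      by (simp add: distrib_left right_diff_distrib left_diff_distrib mult_ac)
    then show ?case using sW
      by (intro exI[of _ "x * q + p * wact D (s a) y"]) (simp only: wact_simps)
  qed
  then obtain q where q: "inc D a * q = b - wact D (s a) b" ..
  show ?thesis unfolding divided_diff_def
  proof (rule theI[of "\<lambda>q. inc D a * q = b - wact D (s a) b", OF q])
    fix p assume "inc D a * p = b - wact D (s a) b"
    then have "inc D a * p = inc D a * q" using q by simp
    then show "p = q" using inc_root[of a] a by simp
  qed
qed

lemma pol_hom: "ring_hom_fun (pol D)"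
  and tw_id: "tw D id = 1"
  and tw_comp: "v \<in> W \<Longrightarrow> w \<in> W \<Longrightarrow> tw D (v \<circ> w) = tw D v * tw D w"
  and pol_tw_simple: "a \<in> simple D \<Longrightarrow> pol D b * tw D (s a) =
          tw D (s a) * pol D (wact D (s a) b) + pol D (K a * divided_diff D a b)"
  using hecke_relations by (simp_all add: graded_hecke_algebra_def scal_def ring_hom_funD)

lemma emb_hom: "ring_hom_fun (emb D)"
  and rat_hom: "ring_hom_fun (rat D)"
  and emb_pol: "E a = r (Fract a 1)"
  using rat_ext by (simp_all add: rational_extension_def)

lemmas pol_simps = ring_hom_funD[OF pol_hom]
lemmas emb_simps = ring_hom_funD[OF emb_hom]
lemmas rat_simps = ring_hom_funD[OF rat_hom]

lemma r_commute: "r f * r g = r g * r f"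
  by (simp add: mult.commute flip: rat_simps(3))

lemma t_id: "t id = 1" by (simp add: tw_id emb_simps)
lemma t_comp: "v \<in> W \<Longrightarrow> w \<in> W \<Longrightarrow> t (v \<circ> w) = t v * t w" by (simp add: tw_comp emb_simps)

lemma t_inv: "w \<in> W \<Longrightarrow> t (inv w) * t w = 1" "w \<in> W \<Longrightarrow> t w * t (inv w) = 1"
  using t_comp[of "inv w" w] t_comp[of w "inv w"] weyl_inv[of w] by (simp_all add: t_id)

lemma pol_t_simple: "a \<in> simple D \<Longrightarrow> E b * t (s a) =
   t (s a) * E (wact D (s a) b) + E (K a * divided_diff D a b)"
  using arg_cong[OF pol_tw_simple, of a "emb D" b] by (simp add: emb_simps)

text \<open>  The coefficient of \<open>t w\<close>, with rational functions written on the right; the value is zero outside the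
  Weyl group.\<close>

definition cf :: "'g \<Rightarrow> ('v \<Rightarrow> 'v) \<Rightarrow> 's fract" where
  "cf x = (THE f. (\<forall>w. w \<notin> W \<longrightarrow> f w = 0) \<and> x = (\<Sum>w\<in>W. t w * r (f w)))"

lemma cf_ex1: "\<exists>!f. (\<forall>w. w \<notin> W \<longrightarrow> f w = 0) \<and> x = (\<Sum>w\<in>W. t w * r (f w))"
  using rat_ext by (simp add: rational_extension_def)

lemma cf_outside: "w \<notin> W \<Longrightarrow> cf x w = 0"
  using theI'[OF cf_ex1[of x]] unfolding cf_def[symmetric] by blast

lemma cf_expand: "(\<Sum>w\<in>W. t w * r (cf x w)) = x"
  using theI'[OF cf_ex1[of x]] unfolding cf_def[symmetric] by (elim conjE) (rule sym, assumption)

lemma cf_eqI: "(\<And>w. w \<notin> W \<Longrightarrow> f w = 0) \<Longrightarrow> x = (\<Sum>w\<in>W. t w * r (f w)) \<Longrightarrow> cf x = f"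
  unfolding cf_def by (rule the1_equality[OF cf_ex1]) auto

lemma cf_ext: "(\<And>w. w \<in> W \<Longrightarrow> cf x w = cf y w) \<Longrightarrow> x = y"
proof -
  assume "\<And>w. w \<in> W \<Longrightarrow> cf x w = cf y w"
  then have "(\<Sum>w\<in>W. t w * r (cf x w)) = (\<Sum>w\<in>W. t w * r (cf y w))" by simp
  then show "x = y" unfolding cf_expand .
qed

lemma cf_add: "cf (x + y) w = cf x w + cf y w"
proof -
  have "cf (x + y) = (\<lambda>w. cf x w + cf y w)"
    by (rule cf_eqI) (simp_all add: cf_outside rat_simps distrib_left sum.distrib cf_expand)
  then show ?thesis by simp
qed

lemma cf_0: "cf 0 w = 0" using cf_add[of 0 0 w] by (metis add_0 add_cancel_right_right)
lemma cf_neg: "cf (- x) w = - cf x w" using cf_add[of x "- x" w] minus_unique[of "cf x w" "cf (- x) w"] by (simp add: cf_0)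
lemma cf_diff: "cf (x - y) w = cf x w - cf y w" using cf_add[of x "- y" w] by (simp add: cf_neg)
lemma cf_sum: "cf (sum g A) w = (\<Sum>i\<in>A. cf (g i) w)"
  by (induction A rule: infinite_finite_induct) (simp_all add: cf_0 cf_add)

lemma cf_right: "cf (x * r f) w = cf x w * f"
proof -
  have "x * r f = (\<Sum>w\<in>W. t w * r (cf x w * f))"
    using arg_cong[OF cf_expand[of x], of "\<lambda>x. x * r f"] by (simp add: sum_distrib_right rat_simps mult.assoc)
  then have "cf (x * r f) = (\<lambda>w. cf x w * f)"
    by (intro cf_eqI) (simp_all add: cf_outside)
  then show ?thesis by simp
qed

lemma cf_t: "v \<in> W \<Longrightarrow> cf (t v) w = (if w = v then 1 else 0)"
proof -
  assume v: "v \<in> W"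
  have "t v = (\<Sum>w\<in>W. t w * r (if w = v then 1 else 0))"
    using v finite_weyl by (simp add: rat_simps if_distrib sum.delta cong: if_cong)
  then have "cf (t v) = (\<lambda>w. if w = v then 1 else 0)" by (intro cf_eqI) (use v in auto)
  then show ?thesis by simp
qed

lemma cf_t_rat: "v \<in> W \<Longrightarrow> cf (t v * r f) w = (if w = v then f else 0)"
  by (simp add: cf_right cf_t)

lemma cf_left:
  assumes v: "v \<in> W" and w: "w \<in> W"
  shows "cf (t v * x) w = cf x (inv v \<circ> w)"
proof -
  have "t v * x = (\<Sum>u\<in>W. t v * (t u * r (cf x u)))"
    using cf_expand[of x] by (simp flip: sum_distrib_left)
  then have "cf (t v * x) w = (\<Sum>u\<in>W. cf (t v * (t u * r (cf x u))) w)" by (simp add: cf_sum)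
  also have "\<dots> = (\<Sum>u\<in>W. if u = inv v \<circ> w then cf x u else 0)"
  proof (rule sum.cong[OF refl])
    fix u assume u: "u \<in> W"
    have "w = v \<circ> u \<longleftrightarrow> u = inv v \<circ> w" using v by (metis weyl_inv_comp(3,4))
    then show "cf (t v * (t u * r (cf x u))) w = (if u = inv v \<circ> w then cf x u else 0)"
      using cf_t_rat[OF weyl_comp[OF v u], of "cf x u" w] v u by (simp add: t_comp mult.assoc)
  qed
  also have "\<dots> = cf x (inv v \<circ> w)" using v w finite_weyl by (simp add: weyl_simps)
  finally show ?thesis .
qed

definition supp :: "('v \<Rightarrow> 'v) set \<Rightarrow> 'g set" where
  "supp A = {x. \<forall>w. w \<notin> A \<longrightarrow> cf x w = 0}"

lemma supp_0: "0 \<in> supp A" by (simp add: supp_def cf_0)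
lemma supp_add: "x \<in> supp A \<Longrightarrow> y \<in> supp A \<Longrightarrow> x + y \<in> supp A" by (simp add: supp_def cf_add)
lemma supp_diff: "x \<in> supp A \<Longrightarrow> y \<in> supp A \<Longrightarrow> x - y \<in> supp A" by (simp add: supp_def cf_diff)
lemma supp_sum: "(\<And>i. i \<in> I \<Longrightarrow> g i \<in> supp A) \<Longrightarrow> sum g I \<in> supp A" by (simp add: supp_def cf_sum)
lemma supp_rat: "x \<in> supp A \<Longrightarrow> x * r f \<in> supp A" by (simp add: supp_def cf_right)
lemma supp_pol: "x \<in> supp A \<Longrightarrow> x * E a \<in> supp A" by (simp add: emb_pol supp_rat)
lemma supp_t: "v \<in> W \<Longrightarrow> v \<in> A \<Longrightarrow> t v \<in> supp A" by (auto simp: supp_def cf_t)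
lemma supp_mono: "A \<subseteq> A' \<Longrightarrow> x \<in> supp A \<Longrightarrow> x \<in> supp A'" by (auto simp: supp_def)
lemma suppD: "x \<in> supp A \<Longrightarrow> w \<notin> A \<Longrightarrow> cf x w = 0" by (simp add: supp_def)

lemma supp_expand: "x \<in> supp A \<Longrightarrow> x = (\<Sum>w\<in>W \<inter> A. t w * r (cf x w))"
proof -
  assume "x \<in> supp A"
  then have "(\<Sum>w\<in>W. t w * r (cf x w)) = (\<Sum>w\<in>W \<inter> A. t w * r (cf x w))"
    by (intro sum.mono_neutral_right) (auto simp: finite_weyl suppD rat_simps)
  then show ?thesis using cf_expand[of x] by simp
qed

lemma supp_left:
  assumes v: "v \<in> W" and x: "x \<in> supp A" and A: "\<And>w. w \<in> W \<Longrightarrow> w \<in> A \<Longrightarrow> v \<circ> w \<in> A'"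
  shows "t v * x \<in> supp A'"
proof -
  have "cf (t v * x) w = 0" if w: "w \<notin> A'" for w
  proof (cases "w \<in> W")
    case True
    have "v \<circ> (inv v \<circ> w) = w" using v by simp
    then have "inv v \<circ> w \<notin> A" using A[of "inv v \<circ> w"] True v w by (metis weyl_comp weyl_inv)
    then show ?thesis using cf_left[OF v True] suppD[OF x] by simp
  qed (rule cf_outside)
  then show ?thesis by (simp add: supp_def)
qed

lemma fract_cancel_1: "q \<noteq> 0 \<Longrightarrow> Fract (q::'s) q = 1"
  by (simp add: One_fract_def eq_fract)

text \<open>  For a polynomial \<open>q\<close> the commutation relation reads \<open>q t = t s(q) + e\<close>; multiplying by the
  inverses of \<open>q\<close> on the left and of \<open>s(q)\<close> on the right gives it for \<open>1 / q\<close>.\<close>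

lemma rat_t_simple:
  assumes a: "a \<in> simple D"
  shows "\<exists>f' g'. r f * t (s a) = t (s a) * r f' + r g'"
proof -
  obtain b q where f: "f = Fract b q" "q \<noteq> 0" by (cases f) auto
  let ?e = "K a * divided_diff D a q" and ?e' = "K a * divided_diff D a b" and ?sq = "wact D (s a) q"
  have sq: "?sq \<noteq> 0" using wact_eq_0[of "s a" q] a f by (simp add: refl_weyl)
  have inv: "r (Fract 1 q) * E q = 1" "E ?sq * r (Fract 1 ?sq) = 1"
    using f sq by (simp_all add: emb_pol rat_simps(1) fract_cancel_1 flip: rat_simps(3))
  have "r (Fract 1 q) * t (s a) = r (Fract 1 q) * (t (s a) * E ?sq) * r (Fract 1 ?sq)"
    using inv by (simp add: mult.assoc)
  also have "t (s a) * E ?sq = E q * t (s a) - E ?e" using pol_t_simple[OF a, of q] by simp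
  also have "r (Fract 1 q) * (E q * t (s a) - E ?e) * r (Fract 1 ?sq)
     = t (s a) * r (Fract 1 ?sq) - r (Fract 1 q) * E ?e * r (Fract 1 ?sq)"
    using inv by (simp add: algebra_simps flip: mult.assoc)
  finally have 1: "r (Fract 1 q) * t (s a) = t (s a) * r (Fract 1 ?sq) - r (Fract 1 q) * E ?e * r (Fract 1 ?sq)" .
  have "f = Fract 1 q * Fract b 1" by (simp add: f)
  then have "r f = r (Fract 1 q) * E b" by (simp only: rat_simps emb_pol)
  then have "r f * t (s a) = r (Fract 1 q) * t (s a) * E (wact D (s a) b) + r (Fract 1 q) * E ?e'"
    by (simp add: mult.assoc pol_t_simple[OF a] distrib_left)
  also have "\<dots> = t (s a) * (r (Fract 1 ?sq) * E (wact D (s a) b)) +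
     (r (Fract 1 q) * E ?e' - r (Fract 1 q) * E ?e * r (Fract 1 ?sq) * E (wact D (s a) b))"
    unfolding 1 by (simp add: algebra_simps)
  finally show ?thesis unfolding emb_pol by (simp only: flip: rat_simps(3,6)) blast
qed

lemma supp_mult_simple:
  assumes a: "a \<in> simple D" and x: "x \<in> supp A" and A: "\<And>w. w \<in> W \<Longrightarrow> w \<in> A \<Longrightarrow> w \<in> A' \<and> w \<circ> s a \<in> A'"
  shows "x * t (s a) \<in> supp A'"
proof -
  have "t w * r (cf x w) * t (s a) \<in> supp A'" if w: "w \<in> W \<inter> A" for w
  proof -
    obtain f' g' where "r (cf x w) * t (s a) = t (s a) * r f' + r g'" using rat_t_simple[OF a] by blast
    then have "t w * r (cf x w) * t (s a) = t (w \<circ> s a) * r f' + t w * r g'"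
      using w a by (simp add: mult.assoc distrib_left t_comp refl_weyl)
    then show ?thesis using w a A by (auto intro!: supp_add supp_rat supp_t weyl_simps)
  qed
  then have "(\<Sum>w\<in>W \<inter> A. t w * r (cf x w) * t (s a)) \<in> supp A'" by (intro supp_sum)
  then show ?thesis unfolding sum_distrib_right[symmetric] supp_expand[OF x, symmetric] .
qed

text \<open>  With \<open>A\<close> the parabolic subgroup itself this makes the elements supported on it a subring; with \<open>A\<close> its
  complement it yields the right linearity of the projection (\<open>eps_mult_right\<close>).\<close>

lemma supp_mult:
  assumes Q: "Q \<subseteq> simple D" and x: "x \<in> supp A" and y: "y \<in> supp (refl_group D Q)"
    and A: "\<And>w v. w \<in> W \<Longrightarrow> w \<in> A \<Longrightarrow> v \<in> refl_group D Q \<Longrightarrow> w \<circ> v \<in> A"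
  shows "x * y \<in> supp A"
proof -
  have t: "x * t v \<in> supp A" if "v \<in> refl_group D Q" for v
    using that x
  proof (induction arbitrary: x rule: refl_group.induct)
    case one
    then show ?case unfolding t_id by simp
  next
    case (step a w)
    have "a \<in> simple D" "w \<in> W" using step Q par_weyl[OF Q] by auto
    then have "x * t (s a \<circ> w) = (x * t (s a)) * t w" by (simp add: t_comp refl_weyl mult.assoc)
    moreover have "x * t (s a) \<in> supp A"
      by (rule supp_mult_simple[OF _ step(4)])
         (use \<open>a \<in> simple D\<close> A[OF _ _ refl_in_group[OF step(1)]] in auto)
    ultimately show ?case using step(3) by (simp only:)
  qed
  have "x * y = (\<Sum>w\<in>W \<inter> refl_group D Q. x * t w * r (cf y w))"
    using arg_cong[OF supp_expand[OF y], of "\<lambda>y. x * y"] by (simp add: sum_distrib_left mult.assoc)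
  then show ?thesis using t by (auto intro!: supp_sum supp_rat)
qed


section \<open>Filtration by length\<close>

abbreviation Low :: "nat \<Rightarrow> 'g set" where
  "Low n \<equiv> supp {w. len D w < n}"

lemma Low_mono: "m \<le> n \<Longrightarrow> x \<in> Low m \<Longrightarrow> x \<in> Low n"
  by (erule supp_mono[rotated]) auto

lemma Low_refl_left:
  assumes a: "a \<in> simple D" and x: "x \<in> Low n"
  shows "t (s a) * x \<in> Low (Suc n)"
proof (rule supp_left[OF _ x])
  show "s a \<in> W" using a by (simp add: refl_weyl)
  fix w assume "w \<in> W" "w \<in> {w. len D w < n}"
  then show "s a \<circ> w \<in> {w. len D w < Suc n}"
    using len_comp_le[of "s a" w] len_refl_le[OF a] a refl_weyl[of a] by simp
qed

lemma Low_refl_right: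
  assumes a: "a \<in> simple D" and x: "x \<in> Low n"
  shows "x * t (s a) \<in> Low (Suc n)"
proof (rule supp_mult_simple[OF a x])
  fix w assume "w \<in> W" "w \<in> {w. len D w < n}"
  then show "w \<in> {w. len D w < Suc n} \<and> w \<circ> s a \<in> {w. len D w < Suc n}"
    using len_comp_le[of w "s a"] len_refl_le[OF a] a refl_weyl[of a] by simp
qed

text \<open>  Moving a polynomial past \<open>t w\<close>, one letter of a reduced word after the other, each divided difference
  deletes a letter and so contributes shorter elements only.\<close>

lemma pol_t:
  assumes "w \<in> W"
  shows "E a * t w - t w * E (wact D (inv w) a) \<in> Low (len D w)"
proof -
  obtain as where "reduced_word D w as" using word_exists[OF assms] ..
  then show ?thesis
  proof (induction as arbitrary: w a)
    case Nil
    then have w: "w = id" using reduced_wordD(2)[OF Nil] by simp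
    show ?case unfolding w inv_id t_id wact_id by (simp add: supp_0)
  next
    case (Cons b as)
    let ?v = "word_prod D as"
    have b: "b \<in> simple D" and v: "?v \<in> W" and w: "w = s b \<circ> ?v" and sb: "s b \<in> W"
      using reduced_wordD[OF Cons(2)] word_weyl by (auto simp: refl_weyl)
    have rv: "reduced_word D ?v as" using reduced_word_append(2)[of w "[b]" as] Cons(2) by simp
    have len: "len D w = Suc (len D ?v)" using reduced_wordD(3)[OF Cons(2)] reduced_wordD(3)[OF rv] by simp
    let ?sa = "wact D (s b) a" and ?e = "K b * divided_diff D b a"
    have 1: "t (s b) * (E ?sa * t ?v - t ?v * E (wact D (inv ?v) ?sa)) \<in> Low (len D w)"
      unfolding len by (rule Low_refl_left[OF b Cons(1)[OF rv]])
    have "t ?v * E (wact D (inv ?v) ?e) \<in> Low (len D w)"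
      using v len by (intro supp_pol supp_t) auto
    from supp_add[OF Low_mono[OF _ Cons(1)[OF rv, of ?e], of "len D w"] this]
    have 2: "E ?e * t ?v \<in> Low (len D w)" using len by simp
    have iw: "wact D (inv w) a = wact D (inv ?v) ?sa"
      unfolding w weyl_inv_distrib[OF sb v]
      using wact_comp[OF weyl_inv[OF v] weyl_inv[OF sb]] inv_refl[of b] b by simp
    have tw: "t w = t (s b) * t ?v" unfolding w using t_comp[OF sb v] .
    have "E a * t w - t w * E (wact D (inv w) a)
       = t (s b) * (E ?sa * t ?v - t ?v * E (wact D (inv ?v) ?sa)) + E ?e * t ?v"
      unfolding tw iw mult.assoc[symmetric] pol_t_simple[OF b] by (simp add: algebra_simps)
    then show ?case using supp_add[OF 1 2] by simp
  qed
qed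

lemma pol_t_obtain:
  assumes "w \<in> W"
  obtains l where "l \<in> Low (len D w)" "E a * t w = t w * E (wact D (inv w) a) + l"
  using pol_t[OF assms, of a] by (metis add_diff_cancel_left' diff_add_cancel add.commute)

text \<open>  At an element \<open>u\<close> of maximal length in the support of \<open>X\<close>, the two sides of the hypothesis have the
  coefficients \<open>u\<inverse>(a) x\<close> and \<open>w\<inverse>(a) x\<close>, by \<open>pol_t\<close>. Since the action on polynomials is faithful, \<open>u = w\<close>.\<close>

lemma intertwiner_0:
  assumes w: "w \<in> W" and X: "\<And>a. E a * X = X * E (wact D (inv w) a)" and z: "cf X w = 0"
  shows "X = 0"
proof (rule ccontr)
  assume "X \<noteq> 0"
  let ?A = "{u \<in> W. cf X u \<noteq> 0}"
  have "?A \<noteq> {}" using \<open>X \<noteq> 0\<close> cf_ext[of X 0] by (auto simp: cf_0)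
  moreover have fin: "finite ?A" using finite_weyl by simp
  ultimately have "Max (len D ` ?A) \<in> len D ` ?A" by (intro Max_in) auto
  then obtain u where u0: "u \<in> ?A" "len D u = Max (len D ` ?A)" by (metis (no_types, lifting) imageE)
  then have u: "u \<in> ?A" "\<And>v. v \<in> ?A \<Longrightarrow> len D v \<le> len D u" using fin by (auto intro: Max_ge)
  have uW: "u \<in> W" using u by simp
  have "wact D (inv u) a = wact D (inv w) a" for a
  proof -
    have "E a * X = (\<Sum>v\<in>W. E a * t v * r (cf X v))"
      using arg_cong[OF cf_expand[of X], of "\<lambda>x. E a * x"] by (simp add: sum_distrib_left mult.assoc)
    then have "cf (E a * X) u = (\<Sum>v\<in>W. cf (E a * t v) u * cf X v)"
      by (simp add: cf_sum cf_right)
    also have "\<dots> = (\<Sum>v\<in>W. if v = u then Fract (wact D (inv u) a) 1 * cf X u else 0)"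
    proof (rule sum.cong[OF refl])
      fix v assume v: "v \<in> W"
      show "cf (E a * t v) u * cf X v = (if v = u then Fract (wact D (inv u) a) 1 * cf X u else 0)"
      proof (cases "cf X v = 0")
        case False
        then have le: "len D v \<le> len D u" using u v by simp
        obtain l where l: "l \<in> Low (len D v)" "E a * t v = t v * E (wact D (inv v) a) + l"
          using pol_t_obtain[OF v] .
        have "cf l u = 0" using suppD[OF l(1)] le by simp
        then have "cf (E a * t v) u = (if u = v then Fract (wact D (inv v) a) 1 else 0)"
          unfolding l(2) cf_add using v by (simp add: emb_pol cf_t_rat)
        then show ?thesis by auto
      qed (use u in auto)
    qed
    also have "\<dots> = Fract (wact D (inv u) a) 1 * cf X u" using uW finite_weyl by simp
    finally have "cf (E a * X) u = Fract (wact D (inv u) a) 1 * cf X u" .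
    moreover have "cf (E a * X) u = cf X u * Fract (wact D (inv w) a) 1"
      unfolding X[of a] by (simp add: emb_pol cf_right)
    ultimately have "cf X u * Fract (wact D (inv w) a) 1 = Fract (wact D (inv u) a) 1 * cf X u"
      by (simp only:)
    then show ?thesis using u(1) by (simp add: mult.commute eq_fract)
  qed
  then have "inv u = inv w" using wact_faithful uW w weyl_inv by blast
  then have "u = w" using uW w by (metis weyl_inv_inv)
  then show False using u z by simp
qed


section \<open>Intertwining elements\<close>

lemma E_hom: "ring_hom_fun (\<lambda>a. E a)"
  unfolding ring_hom_fun_def by (simp add: emb_simps pol_simps)

lemmas E_simps = ring_hom_funD[OF E_hom]

lemma E_commute: "E a * E b = E b * E a"
  by (simp add: mult.commute flip: E_simps(3))

lemma E_rat_inverse: "q \<noteq> 0 \<Longrightarrow> E q * r (Fract 1 q) = 1" "q \<noteq> 0 \<Longrightarrow> r (Fract 1 q) * E q = 1"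
  by (simp_all add: emb_pol fract_cancel_1 rat_simps(1) flip: rat_simps(3))

lemma rat_Fract: "q \<noteq> 0 \<Longrightarrow> r (Fract b q) = E b * r (Fract 1 q)"
  by (simp add: emb_pol flip: rat_simps(3))

lemma E_cancel_right: "q \<noteq> 0 \<Longrightarrow> x * E q = y * E q \<Longrightarrow> x = y"
  using E_rat_inverse(1)[of q] by (metis mult.assoc mult.right_neutral)

text \<open>  The element \<open>R\<close> of a simple root without its denominator. It lies in the Hecke algebra itself, and it
  intertwines the polynomials by the commutation relation.\<close>

definition tau :: "'v \<Rightarrow> 'g" where
  "tau a = t (s a) * E (inc D a) - E (K a)"

lemma K_minus_root: "a \<in> roots D \<Longrightarrow> K a - inc D a \<noteq> 0" "a \<in> roots D \<Longrightarrow> K a + inc D a \<noteq> 0"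
  using affine_form_nonzero[of "of_real (param D a)" a] affine_form_nonzero[of "of_real (param D a)" "- a"] root_nonzero[of a]
  by (auto simp: inc_neg)

lemma R_simple_tau: "a \<in> simple D \<Longrightarrow> R_simple D a = tau a * r (Fract 1 (K a - inc D a))"
  using K_minus_root(1)[of a] rat_Fract[of "K a - inc D a" "inc D a"] rat_Fract[of "K a - inc D a" "K a"]
  by (simp add: R_simple_def Let_def tau_def algebra_simps)

lemma tau_pol: "a \<in> simple D \<Longrightarrow> E b * tau a = tau a * E (wact D (s a) b)"
proof -
  assume a: "a \<in> simple D"
  let ?b' = "wact D (s a) b" and ?al = "inc D a"
  have eq: "K a * divided_diff D a b * ?al - b * K a = - (K a * ?b')"
  proof -
    have "K a * (?al * divided_diff D a b) - b * K a = - (K a * ?b')"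
      unfolding divided_diff[OF a] by (simp add: algebra_simps)
    then show ?thesis by (simp add: mult_ac)
  qed
  have "E b * tau a = E b * t (s a) * E ?al - E b * E (K a)"
    by (simp add: tau_def right_diff_distrib mult.assoc)
  also have "\<dots> = t (s a) * E (?b' * ?al) + E (K a * divided_diff D a b * ?al - b * K a)"
    unfolding pol_t_simple[OF a] by (simp only: E_simps(3,6) distrib_right mult.assoc) simp
  also have "\<dots> = t (s a) * E (?al * ?b') - E (K a * ?b')"
    unfolding eq by (simp only: E_simps(5) mult.commute[of ?b']) simp
  also have "\<dots> = tau a * E ?b'"
    by (simp only: tau_def E_simps(3) left_diff_distrib mult.assoc)
  finally show ?thesis .
qed

lemma R_simple_pol: "a \<in> simple D \<Longrightarrow> E b * R_simple D a = R_simple D a * E (wact D (s a) b)"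
  using tau_pol[of a b] r_commute[of "Fract 1 (K a - inc D a)" "Fract (wact D (s a) b) 1"]
  by (simp add: R_simple_tau mult.assoc[symmetric] emb_pol) (simp add: mult.assoc)

lemma t_refl_sq: "a \<in> simple D \<Longrightarrow> t (s a) * t (s a) = 1"
  using t_inv(1)[of "s a"] by (simp add: refl_weyl inv_refl)

lemma wact_refl_self: "a \<in> simple D \<Longrightarrow> wact D (s a) (inc D a) = - inc D a"
  using wact_inc[OF refl_weyl[OF simple_root], of a a] refl_self[OF simple_root, of a] inc_neg[of a] by metis

lemma tau_sq: "a \<in> simple D \<Longrightarrow> tau a * tau a = E ((K a + inc D a) * (K a - inc D a))"
proof -
  assume a: "a \<in> simple D"
  let ?al = "inc D a"
  have al: "E ?al * tau a = tau a * E (- ?al)" using tau_pol[OF a, of ?al] wact_refl_self[OF a] by simp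
  have k: "E (K a) * tau a = tau a * E (K a)" using tau_pol[OF a, of "K a"] a by (simp add: refl_weyl)
  have tt: "t (s a) * tau a = E ?al - t (s a) * E (K a)"
    using t_refl_sq[OF a] by (simp add: tau_def right_diff_distrib flip: mult.assoc)
  have "tau a * tau a = t (s a) * (E ?al * tau a) - E (K a) * tau a"
    by (simp add: tau_def left_diff_distrib mult.assoc)
  also have "\<dots> = t (s a) * tau a * E (- ?al) - tau a * E (K a)" unfolding al k by (simp add: mult.assoc)
  also have "\<dots> = (E ?al - t (s a) * E (K a)) * E (- ?al) - (t (s a) * E ?al - E (K a)) * E (K a)"
    unfolding tt by (simp add: tau_def)
  also have "\<dots> = E (?al * - ?al) - t (s a) * E (K a * - ?al) - t (s a) * E (?al * K a) + E (K a * K a)"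
    by (simp only: E_simps(3) left_diff_distrib mult.assoc) simp
  also have "\<dots> = E ((K a + ?al) * (K a - ?al))"
  proof -
    have "E (K a * - ?al) = - E (?al * K a)" by (simp only: E_simps(5)[symmetric]) (simp add: mult.commute)
    moreover have "E ((K a + ?al) * (K a - ?al)) = E (?al * - ?al) + E (K a * K a)"
      by (simp only: E_simps(2)[symmetric]) (simp add: algebra_simps)
    ultimately show ?thesis by simp
  qed
  finally show ?thesis .
qed

lemma R_simple_sq: "a \<in> simple D \<Longrightarrow> R_simple D a * R_simple D a = 1"
proof -
  assume a: "a \<in> simple D"
  let ?m = "K a - inc D a" and ?p = "K a + inc D a"
  have m: "?m \<noteq> 0" "?p \<noteq> 0" using K_minus_root a by auto
  have ws: "wact D (s a) ?m = ?p" using a by (simp add: refl_weyl wact_simps refl_self inc_neg)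
  have "R_simple D a * R_simple D a * E ?p = R_simple D a * (E ?m * R_simple D a)"
    unfolding R_simple_pol[OF a] ws by (simp only: mult.assoc)
  also have "\<dots> = tau a * (r (Fract 1 ?m) * E ?m) * tau a * r (Fract 1 ?m)"
    using a by (simp add: R_simple_tau mult.assoc)
  also have "\<dots> = E ?p * (E ?m * r (Fract 1 ?m))"
    using E_rat_inverse(2)[OF m(1)] tau_sq[OF a] by (simp add: E_simps(3) mult.assoc)
  also have "\<dots> = 1 * E ?p" using E_rat_inverse(1)[OF m(1)] by simp
  finally show ?thesis by (rule E_cancel_right[OF m(2)])
qed

abbreviation R_word :: "'v list \<Rightarrow> 'g" where
  "R_word as \<equiv> prod_list (map (R_simple D) as)"

lemma R_word_pol:
  "set as \<subseteq> simple D \<Longrightarrow> E b * R_word as = R_word as * E (wact D (inv (word_prod D as)) b)"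
proof (induction as arbitrary: b)
  case Nil
  show ?case unfolding word_prod_simps inv_id wact_id by simp
next
  case (Cons a as)
  let ?v = "word_prod D as"
  have v: "?v \<in> W" "s a \<in> W" "a \<in> simple D" using Cons by (auto simp: word_weyl refl_weyl)
  have "inv (s a \<circ> ?v) = inv ?v \<circ> s a"
    using weyl_inv_distrib[OF v(2,1)] inv_refl[of a] v by simp
  then have "wact D (inv (word_prod D (a # as))) b = wact D (inv ?v) (wact D (s a) b)"
    unfolding word_prod_simps using wact_comp[OF weyl_inv[OF v(1)] v(2)] by simp
  moreover have "E b * R_word (a # as) = R_simple D a * (E (wact D (s a) b) * R_word as)"
    using R_simple_pol[OF v(3), of b] by (simp flip: mult.assoc)
  moreover have "E (wact D (s a) b) * R_word as = R_word as * E (wact D (inv ?v) (wact D (s a) b))"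
    using Cons by simp
  ultimately show ?case by (simp only: mult.assoc list.map prod_list.Cons)
qed

lemma R_word_inverse:
  "set as \<subseteq> simple D \<Longrightarrow> R_word (rev as) * R_word as = 1"
proof (induction as)
  case (Cons a as)
  have "R_word (rev (a # as)) * R_word (a # as) = R_word (rev as) * (R_simple D a * R_simple D a) * R_word as"
    by (simp add: mult.assoc)
  then show ?case using Cons R_simple_sq by simp
qed simp

text \<open>  Denominator and numerator of the leading coefficient of \<open>R\<close> at a simple root. If the parameter is
  zero then \<open>\<beta> / (k - \<beta>)\<close> is \<open>- 1\<close>; cancelling \<open>\<beta>\<close> in this case keeps denominators and numerators
  coprime.\<close>

definition den :: "'v \<Rightarrow> 's" where
  "den b = (if root_param b = 0 then 1 else const D (of_real (root_param b)) - inc D b)"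

definition num :: "'v \<Rightarrow> 's" where
  "num b = (if root_param b = 0 then - 1 else inc D b)"

definition den_prod :: "('v \<Rightarrow> 'v) \<Rightarrow> 's" where "den_prod w = (\<Prod>b\<in>inversions w. den b)"
definition num_prod :: "('v \<Rightarrow> 'v) \<Rightarrow> 's" where "num_prod w = (\<Prod>b\<in>inversions w. num b)"

lemma den_nonzero: "b \<in> roots D \<Longrightarrow> den b \<noteq> 0"
  using affine_form_nonzero[of "of_real (root_param b)" b] root_nonzero[of b] by (simp add: den_def)

lemma den_prod_nonzero: "den_prod w \<noteq> 0"
  using den_nonzero finite_inversions by (auto simp: den_prod_def inversions_def pos_root)

lemma wact_den: "w \<in> W \<Longrightarrow> b \<in> roots D \<Longrightarrow> wact D w (den b) = den (w b)"
  and wact_num: "w \<in> W \<Longrightarrow> b \<in> roots D \<Longrightarrow> wact D w (num b) = num (w b)"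
  by (simp_all add: den_def num_def root_param_weyl wact_simps)

lemma
  assumes w: "w \<in> W" and a: "a \<in> simple D" and p: "pos (w a)"
  shows den_prod_step: "den_prod (w \<circ> s a) = wact D (s a) (den_prod w) * den a"
    and num_prod_step: "num_prod (w \<circ> s a) = wact D (s a) (num_prod w) * num a"
proof -
  have sa: "s a \<in> W" using a by (simp add: refl_weyl)
  have inj: "inj_on (s a) (inversions w)"
    using weyl_bij[OF sa] by (metis bij_is_inj inj_on_subset subset_UNIV)
  have r: "b \<in> inversions w \<Longrightarrow> b \<in> roots D" for b by (simp add: inversions_def pos_root)
  show "den_prod (w \<circ> s a) = wact D (s a) (den_prod w) * den a"
    unfolding den_prod_def inversions_refl(1)[OF w a p]
    using inversions_refl(2)[OF w a p] finite_inversions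
    by (simp add: prod.reindex[OF inj] wact_prod[OF sa] wact_den[OF sa r] mult.commute)
  show "num_prod (w \<circ> s a) = wact D (s a) (num_prod w) * num a"
    unfolding num_prod_def inversions_refl(1)[OF w a p]
    using inversions_refl(2)[OF w a p] finite_inversions
    by (simp add: prod.reindex[OF inj] wact_prod[OF sa] wact_num[OF sa r] mult.commute)
qed

lemma R_simple_den: "a \<in> simple D \<Longrightarrow> R_simple D a * E (den a) = t (s a) * E (num a) - E (K a)"
proof -
  assume a: "a \<in> simple D"
  let ?m = "K a - inc D a"
  have m: "?m \<noteq> 0" using K_minus_root a by auto
  show ?thesis
  proof (cases "param D a = 0")
    case True
    then have K0: "K a = 0" by (simp add: c_simps)
    have al: "inc D a \<noteq> 0" using inc_root a by simp
    have "E (inc D a) * r (Fract 1 (- inc D a)) = r (Fract (inc D a) (- inc D a))"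
      using al by (simp add: emb_pol flip: rat_simps(3))
    also have "Fract (inc D a) (- inc D a) = - 1"
      using al by (simp add: One_fract_def eq_fract)
    finally have e: "E (inc D a) * r (Fract 1 (- inc D a)) = - 1" by (simp only: rat_simps(1,5))
    have "R_simple D a = t (s a) * (E (inc D a) * r (Fract 1 (- inc D a)))"
      using a K0 by (simp add: R_simple_tau tau_def E_simps mult.assoc)
    then show ?thesis
      unfolding e using True a K0 by (simp add: den_def num_def root_param_simple E_simps)
  next
    case False
    then have "den a = ?m" "num a = inc D a" using a by (simp_all add: den_def num_def root_param_simple)
    then show ?thesis using a E_rat_inverse(2)[OF m] by (simp add: R_simple_tau tau_def mult.assoc)
  qed
qed

text \<open>  Appending a letter moves the denominator so far to the right, where the intertwining property reflects it, and
  adds the denominator of the new letter (\<open>den_prod_step\<close>); this clears all denominators.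
  In the resulting product only the term \<open>t w\<close> has maximal length.\<close>

lemma R_word_leading:
  assumes "reduced_word D w as"
  shows "R_word as * E (den_prod w) \<in> range (emb D)"
    "R_word as * E (den_prod w) - t w * E (num_prod w) \<in> Low (len D w)"
proof -
  have "R_word as * E (den_prod w) \<in> range (emb D) \<and>
    R_word as * E (den_prod w) - t w * E (num_prod w) \<in> Low (len D w)"
    using assms
  proof (induction as arbitrary: w rule: rev_induct)
    case Nil
    have w: "w = id" using reduced_wordD(2)[OF Nil] by simp
    have "inversions w = {}" unfolding w by (auto simp: inversions_def)
    then have e: "E (den_prod w) = 1" "E (num_prod w) = 1" by (simp_all add: den_prod_def num_prod_def E_simps)
    show ?case unfolding e unfolding w t_id using emb_simps(1) by (auto simp: supp_0 intro: range_eqI[of _ _ 1])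
  next
    case (snoc a as)
    let ?v = "word_prod D as"
    have a: "a \<in> simple D" and v: "?v \<in> W" and w: "w = ?v \<circ> s a" and sa: "s a \<in> W"
      using reduced_wordD[OF snoc(2)] word_weyl by (auto simp: refl_weyl)
    have p: "pos (?v a)" using reduced_last[OF snoc(2)] by simp
    have rv: "reduced_word D ?v as" using reduced_word_append(1)[OF snoc(2)] .
    have len: "len D w = Suc (len D ?v)" unfolding w using len_step_up[OF v a p] by simp
    let ?X = "R_word as * E (den_prod ?v)"
    let ?n = "num_prod ?v" and ?e = "K a * divided_diff D a (num_prod ?v)"
    define l where "l = ?X - t ?v * E ?n"
    have l: "l \<in> Low (len D ?v)" and X: "?X \<in> range (emb D)"
      unfolding l_def using snoc(1)[OF rv] by auto
    have eq: "R_word (as @ [a]) * E (den_prod w) = ?X * (t (s a) * E (num a) - E (K a))"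
    proof -
      have "R_word (as @ [a]) * E (den_prod w)
          = R_word as * (R_simple D a * E (wact D (s a) (den_prod ?v))) * E (den a)"
        unfolding w den_prod_step[OF v a p] by (simp add: E_simps(3) mult.assoc)
      also have "\<dots> = ?X * (R_simple D a * E (den a))"
        unfolding R_simple_pol[OF a, symmetric] by (simp add: mult.assoc)
      finally show ?thesis unfolding R_simple_den[OF a] .
    qed
    have "R_word (as @ [a]) * E (den_prod w) \<in> range (emb D)"
    proof -
      obtain h where "?X = emb D h" using X by auto
      then have "?X * (t (s a) * E (num a) - E (K a)) = emb D (h * (tw D (s a) * pol D (num a) - pol D (K a)))"
        by (simp add: emb_simps)
      then show ?thesis unfolding eq by blast
    qed
    moreover have "R_word (as @ [a]) * E (den_prod w) - t w * E (num_prod w) \<in> Low (len D w)"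
    proof -
      have "?X * (t (s a) * E (num a) - E (K a)) = (t ?v * E ?n + l) * (t (s a) * E (num a) - E (K a))"
        by (simp add: l_def)
      also have "\<dots> = t ?v * (E ?n * t (s a)) * E (num a) + l * t (s a) * E (num a) - t ?v * E ?n * E (K a) - l * E (K a)"
        by (simp add: algebra_simps)
      also have "t ?v * (E ?n * t (s a)) * E (num a)
         = t w * E (num_prod w) + t ?v * E ?e * E (num a)"
        unfolding pol_t_simple[OF a] w num_prod_step[OF v a p] t_comp[OF v sa]
        by (simp add: E_simps(3) algebra_simps E_commute)
      finally have "R_word (as @ [a]) * E (den_prod w) - t w * E (num_prod w)
         = t ?v * E ?e * E (num a) + l * t (s a) * E (num a) - t ?v * E ?n * E (K a) - l * E (K a)"
        unfolding eq by simp
      also have "\<dots> \<in> Low (len D w)"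
        unfolding len
        by (intro supp_diff supp_add supp_pol Low_refl_right[OF a l] Low_mono[OF _ l])
           (use v in \<open>auto intro!: supp_t\<close>)
      finally show ?thesis .
    qed
    ultimately show ?case by blast
  qed
  then show "R_word as * E (den_prod w) \<in> range (emb D)"
    "R_word as * E (den_prod w) - t w * E (num_prod w) \<in> Low (len D w)" by auto
qed

lemma R_word_leading_coeff:
  assumes r: "reduced_word D w as"
  shows "cf (R_word as) w * Fract (den_prod w) 1 = Fract (num_prod w) 1"
proof -
  have w: "w \<in> W" using reduced_wordD[OF r] word_weyl by blast
  have "cf (R_word as * E (den_prod w) - t w * E (num_prod w)) w = 0"
    using suppD[OF R_word_leading(2)[OF r], of w] by simp
  then show ?thesis using w by (simp add: cf_diff emb_pol cf_right cf_t)
qed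

text \<open>  The difference of the two words intertwines like \<open>w\<close> and has coefficient zero at \<open>w\<close>.\<close>

lemma R_word_unique:
  assumes r: "reduced_word D w as" "reduced_word D w bs"
  shows "R_word as = R_word bs"
proof -
  have w: "w \<in> W" using reduced_wordD[OF r(1)] word_weyl by blast
  have "R_word as - R_word bs = 0"
  proof (rule intertwiner_0[OF w])
    show "E a * (R_word as - R_word bs) = (R_word as - R_word bs) * E (wact D (inv w) a)" for a
      using R_word_pol[of as a] R_word_pol[of bs a] reduced_wordD[OF r(1)] reduced_wordD[OF r(2)]
      by (simp add: algebra_simps)
    have "Fract (den_prod w) 1 \<noteq> 0" using den_prod_nonzero by (simp add: Zero_fract_def eq_fract)
    then show "cf (R_word as - R_word bs) w = 0"
      using R_word_leading_coeff[OF r(1)] R_word_leading_coeff[OF r(2)]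
      by (simp add: cf_diff) (metis mult_right_cancel)
  qed
  then show ?thesis by simp
qed

lemma R_elt_word: "reduced_word D w as \<Longrightarrow> R_elt D w = R_word as"
  unfolding R_elt_def by (rule R_word_unique[OF someI]) 

lemma R_elt_pol: "w \<in> W \<Longrightarrow> E b * R_elt D w = R_elt D w * E (wact D (inv w) b)"
proof -
  assume "w \<in> W"
  then obtain as where r: "reduced_word D w as" using word_exists by blast
  show ?thesis using R_word_pol[of as b] reduced_wordD[OF r] R_elt_word[OF r] by simp
qed

lemma R_elt_inverse:
  assumes "w \<in> W"
  obtains Y where "Y * R_elt D w = 1" "R_elt D w * Y = 1"
proof -
  obtain as where r: "reduced_word D w as" using word_exists[OF assms] by blast
  show thesis
    using that[of "R_word (rev as)"] R_word_inverse[of as] R_word_inverse[of "rev as"]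
      reduced_wordD[OF r] R_elt_word[OF r] by simp
qed

lemma R_elt_leading:
  assumes "w \<in> W"
  shows "R_elt D w * E (den_prod w) \<in> range (emb D)"
    "cf (R_elt D w) w * Fract (den_prod w) 1 = Fract (num_prod w) 1"
proof -
  obtain as where r: "reduced_word D w as" using word_exists[OF assms] by blast
  show "R_elt D w * E (den_prod w) \<in> range (emb D)"
    "cf (R_elt D w) w * Fract (den_prod w) 1 = Fract (num_prod w) 1"
    using R_word_leading[OF r] R_word_leading_coeff[OF r] by (simp_all add: R_elt_word[OF r])
qed

text \<open>  Both products are \<open>R\<close>-words for \<open>s b \<circ> w = w \<circ> s a\<close>, and they are reduced since \<open>w a\<close> is positive.\<close>

lemma R_elt_commute:
  assumes w: "w \<in> W" and a: "a \<in> simple D" and b: "b \<in> simple D" and wa: "w a = b"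
  shows "R_simple D b * R_elt D w = R_elt D w * R_simple D a"
proof -
  obtain as where r: "reduced_word D w as" using word_exists[OF w] by blast
  have c: "s b \<circ> w = w \<circ> s a" using refl_conj_comp[OF w, of a] a wa by simp
  have "pos (w a)" using wa b pos_simple by simp
  then have l: "len D (w \<circ> s a) = Suc (len D w)" using len_step_up[OF w a] by simp
  have 1: "reduced_word D (w \<circ> s a) (as @ [a])"
    using reduced_wordD[OF r] a l unfolding reduced_word_def by simp
  have 2: "reduced_word D (w \<circ> s a) (b # as)"
    using reduced_wordD[OF r] b l c unfolding reduced_word_def by simp
  from R_word_unique[OF 1 2] show ?thesis by (simp add: R_elt_word[OF r])
qed

text \<open>  The element \<open>t (s a)\<close> is a combination of \<open>R\<close> at \<open>a\<close> and of polynomials after multiplication by \<open>a\<close>,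
  and \<open>a\<close> can be cancelled in the rational extension.\<close>

lemma t_R_elt_commute:
  assumes w: "w \<in> W" and a: "a \<in> simple D" and b: "b \<in> simple D" and wa: "w a = b"
  shows "t (s b) * R_elt D w = R_elt D w * t (s a)"
proof -
  let ?R = "R_elt D w"
  have K: "K b = K a" using root_param_orbit[OF a w] root_param_simple[OF b] wa by simp
  have iw: "inv w b = a" using wa w by auto
  have tE: "t (s c) * E (inc D c) = R_simple D c * E (K c - inc D c) + E (K c)" if "c \<in> simple D" for c
    using that E_rat_inverse(2)[of "K c - inc D c"] K_minus_root(1)[of c]
    by (simp add: R_simple_tau tau_def mult.assoc)
  have P: "E c * ?R = ?R * E (wact D (inv w) c)" for c using R_elt_pol[OF w] .
  have pb: "E (K b - inc D b) * ?R = ?R * E (K a - inc D a)" "E (K b) * ?R = ?R * E (K a)"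
    "E (inc D b) * ?R = ?R * E (inc D a)"
    using P w by (simp_all add: weyl_inv wact_simps iw K)
  have "t (s b) * ?R * E (inc D a) = t (s b) * E (inc D b) * ?R" using pb by (simp add: mult.assoc)
  also have "\<dots> = R_simple D b * (E (K b - inc D b) * ?R) + E (K b) * ?R"
    unfolding tE[OF b] by (simp only: distrib_right mult.assoc)
  also have "\<dots> = (R_simple D b * ?R) * E (K a - inc D a) + ?R * E (K a)" unfolding pb by (simp only: mult.assoc)
  also have "\<dots> = ?R * (R_simple D a * E (K a - inc D a) + E (K a))"
    unfolding R_elt_commute[OF assms] by (simp only: distrib_left mult.assoc)
  also have "\<dots> = ?R * t (s a) * E (inc D a)" unfolding tE[OF a, symmetric] by (simp only: mult.assoc)
  finally show ?thesis by (rule E_cancel_right[OF inc_root[OF simple_root[OF a]]])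
qed

end

section \<open>Parabolic subalgebras\<close>

lemma subring_gen_0: "0 \<in> subring_gen A"
  using subring_gen.diff[OF subring_gen.one subring_gen.one, of A] by simp

lemma subring_gen_add: "x \<in> subring_gen A \<Longrightarrow> y \<in> subring_gen A \<Longrightarrow> x + y \<in> subring_gen A"
  using subring_gen.diff[OF _ subring_gen.diff[OF subring_gen_0], of x A y] by simp

lemma subring_gen_sum: "(\<And>i. i \<in> I \<Longrightarrow> g i \<in> subring_gen A) \<Longrightarrow> sum g I \<in> subring_gen A"
  by (induction I rule: infinite_finite_induct) (simp_all add: subring_gen_0 subring_gen_add)

context hecke begin

lemma emb_coeffs:
  obtains f where "h = (\<Sum>w\<in>W. tw D w * pol D (f w))" "\<And>w. w \<in> W \<Longrightarrow> cf (emb D h) w = Fract (f w) 1"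
proof -
  have "\<exists>!f. (\<forall>w. w \<notin> W \<longrightarrow> f w = 0) \<and> h = (\<Sum>w\<in>W. tw D w * pol D (f w))"
    using hecke_relations by (simp add: graded_hecke_algebra_def)
  then obtain f where f: "\<forall>w. w \<notin> W \<longrightarrow> f w = 0" "h = (\<Sum>w\<in>W. tw D w * pol D (f w))"
    by (elim ex1E conjE)
  have "cf (emb D h) = (\<lambda>w. Fract (f w) 1)"
  proof (rule cf_eqI)
    show "Fract (f w) 1 = 0" if "w \<notin> W" for w using f(1) that by (simp add: Zero_fract_def)
    show "emb D h = (\<Sum>w\<in>W. t w * r (Fract (f w) 1))"
      unfolding f(2) by (simp add: emb_simps flip: emb_pol)
  qed
  then show thesis using that f(2) by simp
qed

lemma emb_inj: "emb D h = emb D h' \<Longrightarrow> h = h'"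
proof -
  assume eq: "emb D h = emb D h'"
  obtain f where f: "h = (\<Sum>w\<in>W. tw D w * pol D (f w))" "\<And>w. w \<in> W \<Longrightarrow> cf (emb D h) w = Fract (f w) 1"
    using emb_coeffs[of h] by blast
  obtain f' where f': "h' = (\<Sum>w\<in>W. tw D w * pol D (f' w))" "\<And>w. w \<in> W \<Longrightarrow> cf (emb D h') w = Fract (f' w) 1"
    using emb_coeffs[of h'] by blast
  have "f w = f' w" if "w \<in> W" for w using f(2)[OF that] f'(2)[OF that] eq by (simp add: eq_fract)
  then show ?thesis unfolding f(1) f'(1) by simp
qed

lemma par_alg_tw: "m \<in> refl_group D Q \<Longrightarrow> tw D m \<in> par_alg D Q"
  and par_alg_pol: "pol D a \<in> par_alg D Q"
  unfolding par_alg_def by (auto intro: subring_gen.gen)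

lemma par_alg_diff: "x \<in> par_alg D Q \<Longrightarrow> y \<in> par_alg D Q \<Longrightarrow> x - y \<in> par_alg D Q"
  and par_alg_add: "x \<in> par_alg D Q \<Longrightarrow> y \<in> par_alg D Q \<Longrightarrow> x + y \<in> par_alg D Q"
  and par_alg_mult: "x \<in> par_alg D Q \<Longrightarrow> y \<in> par_alg D Q \<Longrightarrow> x * y \<in> par_alg D Q"
  unfolding par_alg_def by (auto intro: subring_gen.intros subring_gen_add)

lemma par_alg_induct [consumes 1, case_names tw pol diff mult]:
  assumes "n \<in> par_alg D Q"
    and "\<And>m. m \<in> refl_group D Q \<Longrightarrow> T (tw D m)" "\<And>a. T (pol D a)"
    and "\<And>x y. x \<in> par_alg D Q \<Longrightarrow> y \<in> par_alg D Q \<Longrightarrow> T x \<Longrightarrow> T y \<Longrightarrow> T (x - y)"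
    and "\<And>x y. x \<in> par_alg D Q \<Longrightarrow> y \<in> par_alg D Q \<Longrightarrow> T x \<Longrightarrow> T y \<Longrightarrow> T (x * y)"
  shows "T n"
  using assms(1) unfolding par_alg_def
proof (induction rule: subring_gen.induct)
  case (gen x)
  then show ?case using assms(2,3) by auto
next
  case one
  show ?case using assms(3)[of 1] by (simp add: pol_simps)
next
  case (diff x y)
  then show ?case using assms(4) by (simp add: par_alg_def)
next
  case (mult x y)
  then show ?case using assms(5) by (simp add: par_alg_def)
qed

context
  fixes Q assumes Q: "Q \<subseteq> simple D"
begin

lemma supp_par_mult: "x \<in> supp (refl_group D Q) \<Longrightarrow> y \<in> supp (refl_group D Q) \<Longrightarrow> x * y \<in> supp (refl_group D Q)"
  by (rule supp_mult[OF Q]) (auto intro: refl_group_comp)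

lemma supp_par_t: "m \<in> refl_group D Q \<Longrightarrow> t m \<in> supp (refl_group D Q)"
  by (rule supp_t) (use par_weyl[OF Q] in auto)

lemma supp_par_rat: "r f \<in> supp (refl_group D Q)"
  using supp_rat[OF supp_par_t[OF refl_group.one], of f] unfolding t_id by simp

lemma emb_par_alg: "n \<in> par_alg D Q \<Longrightarrow> emb D n \<in> supp (refl_group D Q)"
proof (induction rule: par_alg_induct)
  case (pol a)
  show ?case using supp_par_rat by (simp add: emb_pol)
qed (simp_all add: supp_par_t supp_diff supp_par_mult emb_simps)

text \<open>  The defining condition on the components in \<open>eps\<close> thereby becomes a condition on coefficients.\<close>

lemma par_alg_rat_eq: "par_alg_rat D Q = supp (refl_group D Q)"
proof
  show "par_alg_rat D Q \<subseteq> supp (refl_group D Q)"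
  proof
    fix x assume "x \<in> par_alg_rat D Q"
    then show "x \<in> supp (refl_group D Q)"
      unfolding par_alg_rat_def
    proof (induction rule: subring_gen.induct)
      case (gen x)
      then show ?case using supp_par_t supp_par_rat by auto
    next
      case one
      show ?case using supp_par_rat[of 1] by (simp add: rat_simps)
    qed (simp_all add: supp_diff supp_par_mult)
  qed
  show "supp (refl_group D Q) \<subseteq> par_alg_rat D Q"
  proof
    fix x assume x: "x \<in> supp (refl_group D Q)"
    have "(\<Sum>w\<in>W \<inter> refl_group D Q. t w * r (cf x w)) \<in> par_alg_rat D Q"
      unfolding par_alg_rat_def
      by (intro subring_gen_sum subring_gen.mult subring_gen.gen) auto
    then show "x \<in> par_alg_rat D Q" using supp_expand[OF x] by (rule back_subst[OF _ sym])
  qed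
qed

lemma cf_par_sum:
  assumes "A \<subseteq> W"
  shows "cf (\<Sum>m\<in>A. t m * r (f m)) w = (if w \<in> A then f w else 0)"
proof -
  have "cf (\<Sum>m\<in>A. t m * r (f m)) w = (\<Sum>m\<in>A. if w = m then f m else 0)"
    unfolding cf_sum by (rule sum.cong[OF refl]) (use assms in \<open>auto simp: cf_t_rat\<close>)
  then show ?thesis using finite_subset[OF assms finite_weyl] by (simp add: sum.delta)
qed

text \<open>  Existence and uniqueness of the minimal representative of the coset of \<open>w\<close>, in the form in which it selects
  a single term from a sum over \<open>min_reps\<close>.\<close>

lemma coset_rep:
  assumes w: "w \<in> W"
  shows "\<exists>u0\<in>min_reps D Q. \<forall>u\<in>min_reps D Q. inv u \<circ> w \<in> refl_group D Q \<longleftrightarrow> u = u0"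
proof -
  obtain u0 v0 where u0: "u0 \<in> min_reps D Q" and v0: "v0 \<in> refl_group D Q" and ww: "w = u0 \<circ> v0"
    using min_rep_exists[OF Q w] by blast
  have J: "u \<in> W" if "u \<in> min_reps D Q" for u using that by (simp add: min_reps_def)
  have "u = u0" if u: "u \<in> min_reps D Q" and g: "inv u \<circ> w \<in> refl_group D Q" for u
  proof -
    let ?g = "(inv u \<circ> w) \<circ> inv v0"
    have g': "?g \<in> refl_group D Q" using g par_inv[OF Q v0] by (rule refl_group_comp)
    have "u0 = u \<circ> ?g"
      unfolding ww using J[OF u] par_weyl[OF Q v0] by (simp add: comp_assoc)
    then have "?g = id" using min_rep_unique[OF Q u _ g'] u0 by metis
    then show ?thesis using \<open>u0 = u \<circ> ?g\<close> by (metis comp_id)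
  qed
  moreover have "inv u0 \<circ> w \<in> refl_group D Q"
    unfolding ww weyl_inv_comp(3)[OF J[OF u0]] by (rule v0)
  ultimately show ?thesis using u0 by blast
qed

lemma id_min_reps: "id \<in> min_reps D Q"
  unfolding min_reps_iff[OF Q] par_min_def using id_weyl Q pos_simple by auto

lemma finite_min_reps: "finite (min_reps D Q)"
  by (rule finite_subset[OF _ finite_weyl]) (auto simp: min_reps_def)

lemma cf_min_rep_sum:
  assumes m: "\<And>u. u \<in> min_reps D Q \<Longrightarrow> m u \<in> supp (refl_group D Q)"
    and u: "u \<in> min_reps D Q" and v: "v \<in> refl_group D Q"
  shows "cf (\<Sum>u\<in>min_reps D Q. t u * m u) (u \<circ> v) = cf (m u) v"
proof -
  have J: "u \<in> W" if "u \<in> min_reps D Q" for u using that by (simp add: min_reps_def)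
  have w: "u \<circ> v \<in> W" using J[OF u] par_weyl[OF Q v] by (simp add: weyl_simps)
  obtain u0 where u0: "\<And>u'. u' \<in> min_reps D Q \<Longrightarrow> inv u' \<circ> (u \<circ> v) \<in> refl_group D Q \<longleftrightarrow> u' = u0"
    using coset_rep[OF w] by blast
  have e: "inv u \<circ> (u \<circ> v) = v" using J[OF u] by (rule weyl_inv_comp)
  have "u = u0" using u0[OF u] v unfolding e by simp
  have "cf (\<Sum>u\<in>min_reps D Q. t u * m u) (u \<circ> v) = (\<Sum>u'\<in>min_reps D Q. cf (m u') (inv u' \<circ> (u \<circ> v)))"
    unfolding cf_sum by (rule sum.cong[OF refl], rule cf_left[OF J w])
  also have "\<dots> = (\<Sum>u'\<in>min_reps D Q. if u' = u then cf (m u) v else 0)"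
  proof (rule sum.cong[OF refl])
    fix u' assume u': "u' \<in> min_reps D Q"
    show "cf (m u') (inv u' \<circ> (u \<circ> v)) = (if u' = u then cf (m u) v else 0)"
    proof (cases "u' = u")
      case True
      show ?thesis unfolding True e by simp
    next
      case False
      then have "inv u' \<circ> (u \<circ> v) \<notin> refl_group D Q" using u0[OF u'] \<open>u = u0\<close> by blast
      then show ?thesis using suppD[OF m[OF u']] False by (simp only: if_False)
    qed
  qed
  also have "\<dots> = cf (m u) v" using u finite_min_reps by simp
  finally show ?thesis .
qed

text \<open>  The component of \<open>x\<close> at a minimal representative \<open>u\<close> collects the coefficients of \<open>x\<close> on the coset of \<open>u\<close>
  (\<open>cf_min_rep_sum\<close>); the coset of the identity is the parabolic subgroup.\<close>

lemma eps_eq: "eps D Q x = (\<Sum>m\<in>refl_group D Q. t m * r (cf x m))"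
proof -
  let ?J = "min_reps D Q" and ?G = "refl_group D Q"
  define C where "C m \<longleftrightarrow> (\<forall>w. w \<notin> ?J \<longrightarrow> m w = 0) \<and> (\<forall>w\<in>?J. m w \<in> supp ?G) \<and> x = (\<Sum>w\<in>?J. t w * m w)" for m
  define m0 where "m0 u = (if u \<in> ?J then \<Sum>v\<in>?G. t v * r (cf x (u \<circ> v)) else 0)" for u
  have G: "?G \<subseteq> W" using par_weyl[OF Q] by blast
  have cf0: "cf (m0 u) v = (if v \<in> ?G then cf x (u \<circ> v) else 0)" if "u \<in> ?J" for u v
    unfolding m0_def using that cf_par_sum[OF G, of "\<lambda>v. cf x (u \<circ> v)"] by (simp only: if_True)
  have s0: "m0 u \<in> supp ?G" if "u \<in> ?J" for u using cf0[OF that] by (simp add: supp_def)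
  have C0: "C m0"
    unfolding C_def
  proof (intro conjI)
    show "\<forall>w. w \<notin> ?J \<longrightarrow> m0 w = 0" by (simp add: m0_def)
    show "\<forall>w\<in>?J. m0 w \<in> supp ?G" using s0 by blast
    show "x = (\<Sum>w\<in>?J. t w * m0 w)"
    proof (rule cf_ext)
      fix w assume "w \<in> W"
      then obtain u v where uv: "u \<in> ?J" "v \<in> ?G" "w = u \<circ> v" using min_rep_exists[OF Q] by blast
      have "cf (\<Sum>w\<in>?J. t w * m0 w) (u \<circ> v) = cf (m0 u) v"
        by (rule cf_min_rep_sum[OF _ uv(1,2)]) (rule s0)
      then show "cf x w = cf (\<Sum>w\<in>?J. t w * m0 w) w"
        unfolding uv(3) cf0[OF uv(1)] using uv(2) by (simp only: if_True)
    qed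
  qed
  have uniq: "m = m0" if m: "C m" for m
  proof
    fix u
    show "m u = m0 u"
    proof (cases "u \<in> ?J")
      case True
      have s: "\<And>u. u \<in> ?J \<Longrightarrow> m u \<in> supp ?G" and x: "x = (\<Sum>w\<in>?J. t w * m w)" using m unfolding C_def by blast+
      show ?thesis
      proof (rule cf_ext)
        fix v
        show "cf (m u) v = cf (m0 u) v"
        proof (cases "v \<in> ?G")
          case v: True
          have "cf x (u \<circ> v) = cf (m u) v"
            using cf_min_rep_sum[OF s True v] x by (simp only:)
          then show ?thesis unfolding cf0[OF True] using v by (simp only: if_True)
        next
          case False
          then show ?thesis unfolding cf0[OF True] using suppD[OF s[OF True]] by (simp only: if_False)
        qed
      qed
    qed (use m in \<open>simp add: C_def m0_def\<close>)
  qed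
  have "(THE m. C m) = m0" using C0 uniq by (rule the_equality)
  then have "eps D Q x = m0 id" unfolding eps_def C_def par_alg_rat_eq by (simp only:)
  also have "\<dots> = (\<Sum>m\<in>?G. t m * r (cf x m))" unfolding m0_def using id_min_reps by (simp only: if_True id_comp)
  finally show ?thesis .
qed

lemma cf_eps: "cf (eps D Q x) w = (if w \<in> refl_group D Q then cf x w else 0)"
  unfolding eps_eq by (rule cf_par_sum) (use par_weyl[OF Q] in blast)

lemma eps_supp: "eps D Q x \<in> supp (refl_group D Q)"
  by (simp add: supp_def cf_eps)

lemma eps_add: "eps D Q (x + y) = eps D Q x + eps D Q y"
  by (rule cf_ext) (simp add: cf_eps cf_add)

lemma eps_mult_right:
  assumes y: "y \<in> supp (refl_group D Q)"
  shows "eps D Q (x * y) = eps D Q x * y"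
proof -
  let ?G = "refl_group D Q"
  define x' where "x' = x - eps D Q x"
  have x': "x' \<in> supp (- ?G)" by (simp add: x'_def supp_def cf_diff cf_eps)
  have "x' * y \<in> supp (- ?G)"
  proof (rule supp_mult[OF Q x' y])
    fix w v assume w: "w \<in> W" "w \<in> - ?G" and v: "v \<in> ?G"
    show "w \<circ> v \<in> - ?G"
    proof
      assume "w \<circ> v \<in> ?G"
      then have "(w \<circ> v) \<circ> inv v \<in> ?G" using par_inv[OF Q v] by (rule refl_group_comp)
      moreover have "(w \<circ> v) \<circ> inv v = w" using par_weyl[OF Q v] by (rule weyl_inv_comp)
      ultimately show False using w by simp
    qed
  qed
  moreover have "eps D Q x * y \<in> supp ?G" using eps_supp y by (rule supp_par_mult)
  moreover have "x * y = eps D Q x * y + x' * y" by (simp add: x'_def algebra_simps)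
  ultimately show ?thesis
    by (intro cf_ext) (auto simp: cf_eps cf_add supp_def)
qed

lemma eps_emb: "\<exists>n\<in>par_alg D Q. eps D Q (emb D h) = emb D n"
proof -
  obtain f where f: "h = (\<Sum>w\<in>W. tw D w * pol D (f w))" "\<And>w. w \<in> W \<Longrightarrow> cf (emb D h) w = Fract (f w) 1"
    using emb_coeffs[of h] by blast
  let ?n = "\<Sum>m\<in>refl_group D Q. tw D m * pol D (f m)"
  have "eps D Q (emb D h) = emb D ?n"
    unfolding eps_eq emb_simps(7,3) emb_pol
    by (rule sum.cong[OF refl]) (use f(2) par_weyl[OF Q] in simp)
  moreover have "?n \<in> par_alg D Q"
    unfolding par_alg_def by (intro subring_gen_sum subring_gen.mult subring_gen.gen) auto
  ultimately show ?thesis by blast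
qed

end


section \<open>Transfer of parabolic subalgebras\<close>

context
  fixes P assumes P: "P \<subseteq> simple D"
begin

abbreviation "Pd \<equiv> dual_par D P"
abbreviation "w0 \<equiv> w_up D P"
abbreviation "R0 \<equiv> R_elt D w0"

lemma Pd: "Pd \<subseteq> simple D" using P by (rule dual_par_simple)
lemma w0: "w0 \<in> W" using P by (rule w0_weyl)

lemma R0_cancel: "R0 * x = R0 * y \<Longrightarrow> x = y" "x * R0 = y * R0 \<Longrightarrow> x = y"
proof -
  obtain Y where Y: "Y * R0 = 1" "R0 * Y = 1" using R_elt_inverse[OF w0] by blast
  show "R0 * x = R0 * y \<Longrightarrow> x = y" using Y(1) by (metis mult.assoc mult_1)
  show "x * R0 = y * R0 \<Longrightarrow> x = y" using Y(2) by (metis mult.assoc mult.right_neutral)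
qed

lemma conj_refl:
  assumes "a \<in> P"
  obtains b where "b \<in> Pd" "w0 b = a" "s a \<circ> w0 = w0 \<circ> s b"
proof -
  obtain b where b: "b \<in> Pd" "a = w0 b" using w0_image[OF P] assms by blast
  then have "s a \<circ> w0 = w0 \<circ> s b" using refl_conj_comp[OF w0, of b] Pd by auto
  then show thesis using that b by simp
qed

text \<open>  This is \<open>t_R_elt_commute\<close> letter by letter: \<open>w0\<close> maps \<open>Pd\<close> onto \<open>P\<close>.\<close>

lemma t_R0: "m \<in> refl_group D P \<Longrightarrow> t m * R0 = R0 * t (inv w0 \<circ> m \<circ> w0)"
proof (induction rule: refl_group.induct)
  case one
  show ?case unfolding comp_id weyl_inv_comp(1)[OF w0] t_id by simp
next
  case (step a w)
  obtain b where b: "b \<in> Pd" "w0 b = a" "s a \<circ> w0 = w0 \<circ> s b" using conj_refl[OF step(1)] .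
  have wW: "w \<in> W" "s a \<in> W" "s b \<in> W" using par_weyl[OF P step(2)] step(1) P b(1) Pd by (auto simp: refl_weyl)
  let ?w' = "inv w0 \<circ> w \<circ> w0"
  have w': "?w' \<in> W" using wW(1) w0 by (intro weyl_comp weyl_inv)
  have "s b = inv w0 \<circ> s a \<circ> w0" unfolding comp_assoc b(3) weyl_inv_comp(3)[OF w0] ..
  then have e: "inv w0 \<circ> (s a \<circ> w) \<circ> w0 = s b \<circ> ?w'"
    by (simp only: comp_assoc weyl_inv_comp(4)[OF w0])
  have "t (s a \<circ> w) * R0 = t (s a) * (t w * R0)" unfolding t_comp[OF wW(2,1)] by (simp add: mult.assoc)
  also have "\<dots> = (t (s a) * R0) * t ?w'" unfolding step(3) by (simp add: mult.assoc)
  also have "t (s a) * R0 = R0 * t (s b)" by (rule t_R_elt_commute[OF w0]) (use step(1) P b Pd in auto)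
  also have "R0 * t (s b) * t ?w' = R0 * t (s b \<circ> ?w')" unfolding t_comp[OF wW(3) w'] by (simp add: mult.assoc)
  finally show ?case unfolding e .
qed

lemma conj_surj: "m \<in> refl_group D Pd \<Longrightarrow> \<exists>n\<in>refl_group D P. m = inv w0 \<circ> n \<circ> w0"
proof (induction rule: refl_group.induct)
  case one
  show ?case unfolding bex_simps by (rule bexI[of _ id]) (simp_all only: comp_id weyl_inv_comp(1)[OF w0] refl_group.one)
next
  case (step b w)
  then obtain n where n: "n \<in> refl_group D P" "w = inv w0 \<circ> n \<circ> w0" by blast
  have "w0 b \<in> P" using w0_image[OF P] step(1) by blast
  moreover have "s (w0 b) \<circ> w0 = w0 \<circ> s b" using refl_conj_comp[OF w0, of b] step(1) Pd by auto
  then have "s b = inv w0 \<circ> s (w0 b) \<circ> w0" using weyl_inv_comp(3)[OF w0] by (simp only: comp_assoc)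
  then have "s b \<circ> w = inv w0 \<circ> (s (w0 b) \<circ> n) \<circ> w0"
    unfolding n(2) by (simp only: comp_assoc weyl_inv_comp(4)[OF w0])
  ultimately show ?case using n(1) refl_group.step by blast
qed

lemma R0_pol: "E a * R0 = R0 * E (wact D (inv w0) a)" using R_elt_pol[OF w0] .

lemma conj_ring:
  assumes x: "emb D x * R0 = R0 * emb D m" and y: "emb D y * R0 = R0 * emb D m'"
  shows "emb D (x + y) * R0 = R0 * emb D (m + m')" "emb D (x - y) * R0 = R0 * emb D (m - m')"
    "emb D (x * y) * R0 = R0 * emb D (m * m')"
proof -
  show "emb D (x + y) * R0 = R0 * emb D (m + m')" "emb D (x - y) * R0 = R0 * emb D (m - m')"
    using x y by (simp_all add: emb_simps algebra_simps)
  have "emb D (x * y) * R0 = emb D x * (emb D y * R0)" by (simp add: emb_simps mult.assoc)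
  also have "\<dots> = emb D x * R0 * emb D m'" unfolding y by (simp add: mult.assoc)
  also have "\<dots> = R0 * emb D (m * m')" unfolding x by (simp add: emb_simps mult.assoc)
  finally show "emb D (x * y) * R0 = R0 * emb D (m * m')" .
qed

lemma conj_exists: "n \<in> par_alg D P \<Longrightarrow> \<exists>m\<in>par_alg D Pd. emb D n * R0 = R0 * emb D m"
proof (induction rule: par_alg_induct)
  case (tw m)
  show ?case using t_R0[OF tw] par_alg_tw[OF w0_conj[OF P tw]] by blast
next
  case (pol a)
  show ?case using R0_pol par_alg_pol by blast
next
  case (diff x y)
  then show ?case using conj_ring(2) par_alg_diff by blast
next
  case (mult x y)
  then show ?case using conj_ring(3) par_alg_mult by blast
qed

lemma conj_exists': "m \<in> par_alg D Pd \<Longrightarrow> \<exists>n\<in>par_alg D P. emb D n * R0 = R0 * emb D m"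
proof (induction rule: par_alg_induct)
  case (tw m)
  then obtain n where "n \<in> refl_group D P" "m = inv w0 \<circ> n \<circ> w0" using conj_surj by blast
  then show ?case using t_R0 par_alg_tw by blast
next
  case (pol a)
  have "E (wact D w0 a) * R0 = R0 * E a" using R0_pol[of "wact D w0 a"] wact_inv(1)[OF w0] by simp
  then show ?case using par_alg_pol by blast
next
  case (diff x y)
  then show ?case using conj_ring(2) par_alg_diff by blast
next
  case (mult x y)
  then show ?case using conj_ring(3) par_alg_mult by blast
qed

lemma wact_cvec: "w \<in> W \<Longrightarrow> wact D w (cvec D u v) = cvec D (w u) (w v)"
  by (simp add: cvec_def wact_simps)

text \<open>  Conjugation by the invertible element \<open>R0\<close> has all required properties.\<close>

lemma transfer_exists: "\<exists>\<phi>. is_transfer D P \<phi>"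
proof -
  define \<phi> where "\<phi> n = (THE m. emb D n * R0 = R0 * emb D m)" for n
  have phi: "\<phi> n = m" if "emb D n * R0 = R0 * emb D m" for n m
    unfolding \<phi>_def by (rule the_equality, rule that) (use that R0_cancel(1) emb_inj in metis)
  have phiP: "\<phi> n \<in> par_alg D Pd" "emb D n * R0 = R0 * emb D (\<phi> n)" if "n \<in> par_alg D P" for n
    using conj_exists[OF that] phi by auto
  have "is_transfer D P \<phi>"
    unfolding is_transfer_def
  proof (intro conjI ballI allI)
    show "bij_betw \<phi> (par_alg D P) (par_alg D Pd)"
      unfolding bij_betw_def
    proof
      show "inj_on \<phi> (par_alg D P)"
      proof (rule inj_onI)
        fix x y assume xy: "x \<in> par_alg D P" "y \<in> par_alg D P" "\<phi> x = \<phi> y"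
        then have "emb D x * R0 = emb D y * R0" using phiP(2)[of x] phiP(2)[of y] by (simp only:)
        then show "x = y" using R0_cancel(2) emb_inj by blast
      qed
      show "\<phi> ` par_alg D P = par_alg D Pd"
      proof
        show "\<phi> ` par_alg D P \<subseteq> par_alg D Pd" using phiP(1) by blast
        show "par_alg D Pd \<subseteq> \<phi> ` par_alg D P"
        proof
          fix m assume "m \<in> par_alg D Pd"
          then obtain n where n: "n \<in> par_alg D P" "emb D n * R0 = R0 * emb D m" using conj_exists' by blast
          show "m \<in> \<phi> ` par_alg D P" using phi[OF n(2)] n(1) by blast
        qed
      qed
    qed
    fix x y assume xy: "x \<in> par_alg D P" "y \<in> par_alg D P"
    note c = conj_ring[OF phiP(2)[OF xy(1)] phiP(2)[OF xy(2)]]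
    show "\<phi> (x + y) = \<phi> x + \<phi> y" using c(1) by (rule phi)
    show "\<phi> (x * y) = \<phi> x * \<phi> y" using c(3) by (rule phi)
  next
    fix z show "\<phi> (scal D z) = scal D z"
      unfolding scal_def by (rule phi) (use R0_pol[of "const D z"] w0 in \<open>simp add: weyl_inv\<close>)
  next
    fix m assume "m \<in> refl_group D P"
    then show "\<phi> (tw D m) = tw D (inv w0 \<circ> m \<circ> w0)" by (intro phi t_R0)
  next
    fix u v show "\<phi> (pol D (cvec D u v)) = pol D (cvec D (inv w0 u) (inv w0 v))"
      by (rule phi) (use R0_pol[of "cvec D u v"] w0 in \<open>simp add: weyl_inv wact_cvec\<close>)
  qed
  then show ?thesis by blast
qed

lemma transfer: "is_transfer D P (transfer D P)"
  unfolding transfer_def using transfer_exists by (rule someI_ex)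

lemma transfer_simps:
  "x \<in> par_alg D P \<Longrightarrow> y \<in> par_alg D P \<Longrightarrow> transfer D P (x + y) = transfer D P x + transfer D P y"
  "x \<in> par_alg D P \<Longrightarrow> y \<in> par_alg D P \<Longrightarrow> transfer D P (x * y) = transfer D P x * transfer D P y"
  "transfer D P (scal D z) = scal D z"
  "m \<in> refl_group D P \<Longrightarrow> transfer D P (tw D m) = tw D (inv w0 \<circ> m \<circ> w0)"
  "transfer D P (pol D (cvec D u v)) = pol D (cvec D (inv w0 u) (inv w0 v))"
  using transfer unfolding is_transfer_def by blast+

lemma transfer_bij: "bij_betw (transfer D P) (par_alg D P) (par_alg D Pd)"
  using transfer unfolding is_transfer_def by blast

lemma transfer_diff:
  "x \<in> par_alg D P \<Longrightarrow> y \<in> par_alg D P \<Longrightarrow> transfer D P (x - y) = transfer D P x - transfer D P y"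
  using transfer_simps(1)[OF par_alg_diff, of x y y] by simp

lemma transfer_pol: "transfer D P (pol D a) = pol D (wact D (inv w0) a)"
proof (induction a rule: sym_induct)
  case (const z)
  show ?case using transfer_simps(3)[of z] w0 by (simp add: scal_def weyl_inv)
next
  case (inc v)
  have "cvec D v 0 = inc D v" "cvec D (inv w0 v) 0 = inc D (inv w0 v)" by (simp_all add: cvec_def inc_0)
  moreover have "inv w0 0 = 0" using weyl_linear[OF weyl_inv[OF w0]] linear_0 by blast
  ultimately show ?case using transfer_simps(5)[of v 0] w0 by (simp add: weyl_inv)
next
  case (add a b)
  then show ?case using transfer_simps(1)[OF par_alg_pol par_alg_pol, of a b] w0
    by (simp add: pol_simps wact_simps weyl_inv)
next
  case (mult a b)
  then show ?case using transfer_simps(2)[OF par_alg_pol par_alg_pol, of a b] w0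
    by (simp add: pol_simps wact_simps weyl_inv)
qed

text \<open>  The properties of a transfer determine it on generators, where it agrees with conjugation by \<open>R0\<close>.\<close>

lemma transfer_R0: "n \<in> par_alg D P \<Longrightarrow> emb D n * R0 = R0 * emb D (transfer D P n)"
proof (induction rule: par_alg_induct)
  case (tw m)
  then show ?case unfolding transfer_simps(4)[OF tw] by (rule t_R0)
next
  case (pol a)
  show ?case unfolding transfer_pol by (rule R0_pol)
next
  case (diff x y)
  show ?case unfolding transfer_diff[OF diff.hyps] using diff.IH by (rule conj_ring)
next
  case (mult x y)
  show ?case unfolding transfer_simps(2)[OF mult.hyps] using mult.IH by (rule conj_ring)
qed


section \<open>The top component\<close>

text \<open>  The coefficients on the coset of \<open>w0\<close>, translated to the parabolic subgroup, see \<open>cf_top\<close>.\<close>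

definition top_part :: "'g \<Rightarrow> 'g" where
  "top_part X = eps D Pd (t (inv w0) * X)"

lemma cf_top: "m \<in> W \<Longrightarrow> cf (top_part X) m = (if m \<in> refl_group D Pd then cf X (w0 \<circ> m) else 0)"
  unfolding top_part_def cf_eps[OF Pd] using cf_left[OF weyl_inv[OF w0], of m X] w0 by simp

lemma top_supp: "top_part X \<in> supp (refl_group D Pd)"
  unfolding top_part_def by (rule eps_supp[OF Pd])

lemma top_add: "top_part (X + Y) = top_part X + top_part Y"
  by (simp add: top_part_def distrib_left eps_add[OF Pd])

lemma top_0: "top_part 0 = 0"
  using top_add[of 0 0] by (metis add_0 add_cancel_right_right)

lemma top_diff: "top_part (X - Y) = top_part X - top_part Y"
  using top_add[of "X - Y" Y] by simp

lemma top_sum: "top_part (sum g I) = (\<Sum>i\<in>I. top_part (g i))"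
  by (induction I rule: infinite_finite_induct) (simp_all add: top_0 top_add)

lemma top_right: "y \<in> supp (refl_group D Pd) \<Longrightarrow> top_part (X * y) = top_part X * y"
  unfolding top_part_def mult.assoc[symmetric] by (rule eps_mult_right[OF Pd])

lemma top_t:
  assumes m: "m \<in> refl_group D P"
  shows "top_part (t m * X) = t (inv w0 \<circ> m \<circ> w0) * top_part X"
proof -
  let ?m = "inv w0 \<circ> m \<circ> w0"
  have mW: "m \<in> W" using par_weyl[OF P m] .
  have m': "?m \<in> refl_group D Pd" using w0_conj[OF P m] .
  have m'W: "?m \<in> W" using par_weyl[OF Pd m'] .
  show ?thesis
  proof (rule cf_ext)
    fix v assume v: "v \<in> W"
    show "cf (top_part (t m * X)) v = cf (t ?m * top_part X) v"
    proof (cases "v \<in> refl_group D Pd")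
      case True
      have iv: "inv ?m \<circ> v \<in> refl_group D Pd" using par_inv[OF Pd m'] True by (rule refl_group_comp)
      have "inv ?m = inv w0 \<circ> inv m \<circ> w0"
        using weyl_inv_distrib[OF weyl_comp[OF weyl_inv[OF w0] mW] w0] weyl_inv_distrib[OF weyl_inv[OF w0] mW] w0
        by (simp only: weyl_inv_inv comp_assoc)
      then have "w0 \<circ> (inv ?m \<circ> v) = inv m \<circ> (w0 \<circ> v)"
        using w0 by (simp only: comp_assoc weyl_inv_comp(4))
      then have "cf (t ?m * top_part X) v = cf X (inv m \<circ> (w0 \<circ> v))"
        unfolding cf_left[OF m'W v] cf_top[OF par_weyl[OF Pd iv]] using iv by (simp only: if_True)
      also have "\<dots> = cf (top_part (t m * X)) v"
        unfolding cf_top[OF v] cf_left[OF mW weyl_comp[OF w0 v]] using True by (simp only: if_True)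
      finally show ?thesis by (rule sym)
    next
      case False
      have "t ?m * top_part X \<in> supp (refl_group D Pd)"
        using supp_par_t[OF Pd m'] top_supp by (rule supp_par_mult[OF Pd])
      from suppD[OF this False] show ?thesis unfolding cf_top[OF v] using False by (simp only: if_False)
    qed
  qed
qed

text \<open>  Elements of the coset of \<open>w0\<close> are at least as long as \<open>w0\<close>, which is at least as long as \<open>u\<close>.\<close>

lemma top_low:
  assumes u: "u \<in> min_reps D Pd" and l: "l \<in> Low (len D u)"
  shows "top_part l = 0"
proof (rule cf_ext)
  fix m assume m: "m \<in> W"
  show "cf (top_part l) m = cf 0 m"
  proof (cases "m \<in> refl_group D Pd")
    case True
    have "len D u \<le> len D w0" using len_min_reps_le_w0[OF P u] .
    also have "\<dots> \<le> len D (w0 \<circ> m)" using w0_min_reps[OF P] True by (simp add: min_reps_def)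
    finally have "cf l (w0 \<circ> m) = 0" using suppD[OF l, of "w0 \<circ> m"] by simp
    then show ?thesis unfolding cf_top[OF m] using True by (simp only: if_True cf_0)
  next
    case False
    then show ?thesis unfolding cf_top[OF m] by (simp only: if_False cf_0)
  qed
qed

lemma top_t_other:
  assumes u: "u \<in> min_reps D Pd" "u \<noteq> w0"
  shows "top_part (t u) = 0"
proof (rule cf_ext)
  have uW: "u \<in> W" using u by (simp add: min_reps_def)
  fix m assume m: "m \<in> W"
  have "w0 \<circ> m \<noteq> u" if mG: "m \<in> refl_group D Pd"
  proof
    assume "w0 \<circ> m = u"
    then have "m = id" using min_rep_unique[OF Pd w0_min_reps[OF P] _ mG] u(1) by metis
    then show False using \<open>w0 \<circ> m = u\<close> u(2) by (metis comp_id)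
  qed
  then show "cf (top_part (t u)) m = cf 0 m"
    unfolding cf_top[OF m] cf_t[OF uW] cf_0 by auto
qed

lemma top_t_w0: "top_part (t w0) = 1"
proof (rule cf_ext)
  fix m assume m: "m \<in> W"
  have "w0 \<circ> m = w0 \<longleftrightarrow> m = id" using w0 by (metis comp_id weyl_inv_comp(1,3))
  moreover have "cf 1 m = (if m = id then 1 else 0)" using cf_t[OF id_weyl, of m] unfolding t_id .
  ultimately show "cf (top_part (t w0)) m = cf 1 m"
    unfolding cf_top[OF m] cf_t[OF w0] using refl_group.one by auto
qed

text \<open>  By right linearity it suffices to treat \<open>t u\<close> for a minimal representative \<open>u\<close>. Moving \<open>a\<close> to the
  right leaves \<open>t u\<close> times a polynomial and shorter terms; the latter have no top component by
  \<open>top_low\<close>, and the former has one only for \<open>u = w0\<close>.\<close>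

lemma top_pol: "top_part (E a * X) = E (wact D (inv w0) a) * top_part X"
proof -
  have E: "E b \<in> supp (refl_group D Pd)" for b unfolding emb_pol by (rule supp_par_rat[OF Pd])
  have step: "top_part (E a * t u) = E (wact D (inv w0) a) * top_part (t u)" if u: "u \<in> min_reps D Pd" for u
  proof -
    have uW: "u \<in> W" using u by (simp add: min_reps_def)
    obtain l where l: "l \<in> Low (len D u)" "E a * t u = t u * E (wact D (inv u) a) + l"
      using pol_t_obtain[OF uW] .
    have "top_part (E a * t u) = top_part (t u) * E (wact D (inv u) a)"
      unfolding l(2) top_add top_low[OF u l(1)] top_right[OF E] by simp
    then show ?thesis using top_t_other[OF u] top_t_w0 by (cases "u = w0") simp_all
  qed
  have G: "refl_group D Pd \<subseteq> W" using par_weyl[OF Pd] by blast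
  have t: "top_part (E a * t w * r f) = E (wact D (inv w0) a) * top_part (t w * r f)" if w: "w \<in> W" for w f
  proof -
    obtain u v where uv: "u \<in> min_reps D Pd" "v \<in> refl_group D Pd" "w = u \<circ> v" using min_rep_exists[OF Pd w] by blast
    have uW: "u \<in> W" "v \<in> W" using uv(1,2) par_weyl[OF Pd] by (simp_all add: min_reps_def)
    have y: "t v * r f \<in> supp (refl_group D Pd)" using uv(2) by (intro supp_rat supp_par_t[OF Pd])
    have 1: "t w * r f = t u * (t v * r f)" and 2: "E a * t w * r f = (E a * t u) * (t v * r f)"
      unfolding uv(3) t_comp[OF uW] by (simp_all add: mult.assoc)
    have "top_part (E a * t w * r f) = top_part (E a * t u) * (t v * r f)"
      unfolding 2 by (rule top_right[OF y])
    moreover have "top_part (t w * r f) = top_part (t u) * (t v * r f)"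
      unfolding 1 by (rule top_right[OF y])
    ultimately show ?thesis by (simp only: step[OF uv(1)] mult.assoc)
  qed
  have "E a * X = (\<Sum>w\<in>W. E a * t w * r (cf X w))"
    using arg_cong[OF cf_expand[of X], of "\<lambda>x. E a * x"] by (simp add: sum_distrib_left mult.assoc)
  then have "top_part (E a * X) = (\<Sum>w\<in>W. E (wact D (inv w0) a) * top_part (t w * r (cf X w)))"
    by (simp add: top_sum t)
  also have "\<dots> = E (wact D (inv w0) a) * top_part (\<Sum>w\<in>W. t w * r (cf X w))"
    by (simp add: top_sum sum_distrib_left)
  finally show ?thesis unfolding cf_expand .
qed

text \<open>  The balancing property in the second slot of the form; the projection \<open>eps\<close> itself is not linear on the
  left.\<close>

lemma top_left: "n \<in> par_alg D P \<Longrightarrow> top_part (emb D n * X) = emb D (transfer D P n) * top_part X"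
proof (induction arbitrary: X rule: par_alg_induct)
  case (tw m)
  show ?case unfolding transfer_simps(4)[OF tw] by (rule top_t[OF tw])
next
  case (pol a)
  show ?case unfolding transfer_pol by (rule top_pol)
next
  case (diff x y)
  then show ?case by (simp add: transfer_diff emb_simps left_diff_distrib top_diff)
next
  case (mult x y)
  then show ?case by (simp add: transfer_simps(2) emb_simps mult.assoc)
qed


section \<open>The denominator\<close>

text \<open>  The common denominator of \<open>R0\<close>.\<close>

abbreviation "q0 \<equiv> den_prod w0"

text \<open>  The inversions of \<open>w0\<close> are the positive roots outside the subsystem of \<open>Pd\<close>, and these are permuted.\<close>

lemma wact_q0: "m \<in> refl_group D Pd \<Longrightarrow> wact D m q0 = q0"
proof -
  assume m: "m \<in> refl_group D Pd"
  have mW: "m \<in> W" using par_weyl[OF Pd m] .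
  have inj: "inj_on m (inversions w0)" using weyl_bij[OF mW] by (metis bij_is_inj inj_on_subset subset_UNIV)
  have "wact D m q0 = (\<Prod>b\<in>inversions w0. den (m b))"
    unfolding den_prod_def wact_prod[OF mW]
    by (rule prod.cong[OF refl]) (use mW in \<open>auto simp: inversions_def pos_root wact_den\<close>)
  also have "\<dots> = (\<Prod>b\<in>m ` inversions w0. den b)" by (simp add: prod.reindex[OF inj])
  also have "m ` inversions w0 = inversions w0"
    unfolding inversions_w0[OF P] by (rule par_inversions_stable[OF Pd m])
  finally show ?thesis by (simp add: den_prod_def)
qed

lemma q0_central: "n \<in> par_alg D Pd \<Longrightarrow> pol D q0 * n = n * pol D q0"
proof (induction rule: par_alg_induct)
  case (tw m)
  then show ?case
  proof (induction rule: refl_group.induct)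
    case one
    show ?case unfolding tw_id by simp
  next
    case (step a w)
    have a: "a \<in> simple D" and w: "w \<in> W" using step Pd par_weyl[OF Pd] by auto
    have f: "wact D (s a) q0 = q0" using wact_q0 refl_in_group[OF step(1)] by blast
    then have "inc D a * divided_diff D a q0 = 0" using divided_diff[OF a] by simp
    then have d: "divided_diff D a q0 = 0" using inc_root[of a] a by simp
    have "pol D q0 * tw D (s a) = tw D (s a) * pol D q0"
      using pol_tw_simple[OF a, of q0] by (simp add: f d pol_simps)
    then have "pol D q0 * (tw D (s a) * tw D w) = tw D (s a) * (pol D q0 * tw D w)"
      by (simp flip: mult.assoc)
    then show ?case unfolding tw_comp[OF refl_weyl[OF simple_root[OF a]] w] step(3)
      by (simp add: mult.assoc)
  qed
next
  case (pol a)
  show ?case by (simp add: mult.commute flip: pol_simps(3))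
next
  case (diff x y)
  then show ?case by (simp add: algebra_simps)
next
  case (mult x y)
  have "pol D q0 * (x * y) = x * (pol D q0 * y)" using mult.IH(1) by (simp flip: mult.assoc)
  then show ?case unfolding mult.IH(2) by (simp add: mult.assoc)
qed

lemma top_den: "\<exists>n\<in>par_alg D Pd. top_part (emb D h * R0) * E q0 = emb D n"
proof -
  have E: "E q0 \<in> supp (refl_group D Pd)" unfolding emb_pol by (rule supp_par_rat[OF Pd])
  obtain g where g: "R0 * E q0 = emb D g" using R_elt_leading(1)[OF w0] by auto
  have "top_part (emb D h * R0) * E q0 = top_part (emb D h * (R0 * E q0))"
    using top_right[OF E, of "emb D h * R0"] by (simp add: mult.assoc)
  also have "\<dots> = eps D Pd (emb D (tw D (inv w0) * (h * g)))"
    unfolding g top_part_def by (simp add: emb_simps)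
  finally show ?thesis using eps_emb[OF Pd] by simp
qed

lemma form_elt_top: "form_elt D P h1 h2 = top_part (emb D (star D h2 * h1) * R0)"
  by (simp add: form_elt_def top_part_def emb_simps mult.assoc)

end

text \<open>  The denominators are one or prime, and a prime \<open>k - \<beta>\<close> with \<open>k \<noteq> 0\<close> divides no root
  (\<open>affine_form_prime\<close>).\<close>

lemma den_dvd_num_mult:
  assumes b: "b \<in> roots D" and A: "finite A" "A \<subseteq> roots D" and d: "den b dvd (\<Prod>c\<in>A. num c) * a"
  shows "den b dvd a"
  using A d
proof (induction A arbitrary: a rule: finite_induct)
  case (insert c A)
  have "den b dvd num c * ((\<Prod>c\<in>A. num c) * a)"
    using insert.prems(2) insert.hyps by (simp add: mult.assoc)
  moreover have "den b dvd x" if "den b dvd num c * x" for x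
  proof (cases "root_param b = 0 \<or> root_param c = 0")
    case True
    then show ?thesis using that by (auto simp: den_def num_def)
  next
    case False
    then show ?thesis
      using affine_form_prime[of "of_real (root_param b)" c b x] root_nonzero[of c] insert.prems(1) that
      by (simp add: den_def num_def)
  qed
  ultimately have "den b dvd (\<Prod>c\<in>A. num c) * a" by blast
  then show ?case using insert.IH insert.prems(1) by blast
qed simp

lemma den_prod_dvd:
  assumes "den_prod w dvd num_prod w * a"
  shows "den_prod w dvd a"
proof -
  have N: "inversions w \<subseteq> roots D" by (auto simp: inversions_def pos_root)
  have dvd: "(\<Prod>b\<in>A. den b) dvd a" if "finite A" "A \<subseteq> roots D" "(\<Prod>b\<in>A. den b) dvd num_prod w * a" for A a
    using that
  proof (induction A arbitrary: a rule: finite_induct)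
    case (insert b A)
    have b: "b \<in> roots D" using insert.prems(1) by simp
    have "den b dvd num_prod w * a" using insert.prems(2) insert.hyps dvd_mult_left by (metis prod.insert)
    then have "den b dvd a" unfolding num_prod_def by (rule den_dvd_num_mult[OF b finite_inversions N])
    then obtain a' where a': "a = den b * a'" by (rule dvdE)
    have "den b * (\<Prod>b\<in>A. den b) dvd den b * (num_prod w * a')"
      using insert.prems(2) insert.hyps by (simp add: a' mult_ac)
    then have "(\<Prod>b\<in>A. den b) dvd num_prod w * a'" using den_nonzero[OF b] by simp
    then have "(\<Prod>b\<in>A. den b) dvd a'" using insert.IH insert.prems(1) by blast
    then show ?case unfolding a' prod.insert[OF insert.hyps] by (rule mult_dvd_mono[OF dvd_refl])
  qed simp
  show ?thesis unfolding den_prod_def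
    by (rule dvd[OF finite_inversions N]) (use assms in \<open>simp only: den_prod_def\<close>)
qed

end


section \<open>Free abelian groups and the tensor product\<close>

text \<open>  The extension of a map to the free abelian group on its domain.\<close>

definition lift :: "('k \<Rightarrow> 'b::ring_1) \<Rightarrow> ('k \<Rightarrow>\<^sub>0 int) \<Rightarrow> 'b" where
  "lift g p = (\<Sum>x\<in>Poly_Mapping.keys p. of_int (Poly_Mapping.lookup p x) * g x)"

lemma lift_superset:
  "finite S \<Longrightarrow> Poly_Mapping.keys p \<subseteq> S \<Longrightarrow> lift g p = (\<Sum>x\<in>S. of_int (Poly_Mapping.lookup p x) * g x)"
  unfolding lift_def by (rule sum.mono_neutral_left) (auto simp: in_keys_iff)

lemma lift_diff: "lift g (p - q) = lift g p - lift g q"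
proof -
  let ?S = "Poly_Mapping.keys p \<union> Poly_Mapping.keys q"
  have k: "Poly_Mapping.keys (p - q) \<subseteq> ?S" by (auto simp: in_keys_iff lookup_minus)
  show ?thesis
    using lift_superset[of ?S "p - q" g] lift_superset[of ?S p g] lift_superset[of ?S q g] k
    by (simp add: lookup_minus left_diff_distrib sum_subtractf)
qed

lemma lift_0: "lift g 0 = 0" by (simp add: lift_def)

lemma lift_plus: "lift g (p + q) = lift g p + lift g q"
  using lift_diff[of g p "0 - q"] lift_diff[of g 0 q] by (simp add: lift_0)

lemma lift_single: "lift g (Poly_Mapping.single x k) = of_int k * g x"
  by (simp add: lift_def)

lemma lift_single_1: "lift g (Poly_Mapping.single x 1) = g x"
  by (simp add: lift_single)

lemma lift_sum: "lift g (sum f I) = (\<Sum>i\<in>I. lift g (f i))"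
  by (induction I rule: infinite_finite_induct) (simp_all add: lift_0 lift_plus)

lemma lift_add_fun: "lift (\<lambda>x. f x + g x) p = lift f p + lift g p"
  by (simp add: lift_def distrib_left sum.distrib)

lemma lift_scale_fun: "lift (\<lambda>x. (c::'b::comm_ring_1) * g x) p = c * lift g p"
  by (simp add: lift_def sum_distrib_left mult_ac)

lemma tensor_rel_neg: "p \<in> tensor_rel D P \<sigma> \<Longrightarrow> - p \<in> tensor_rel D P \<sigma>"
  using tensor_rel.diff[OF tensor_rel.zero] by fastforce

lemma tensor_rel_add: "p \<in> tensor_rel D P \<sigma> \<Longrightarrow> q \<in> tensor_rel D P \<sigma> \<Longrightarrow> p + q \<in> tensor_rel D P \<sigma>"
  using tensor_rel.diff[OF _ tensor_rel_neg, of p D P \<sigma> q] by simp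

lemma coset_self: "p \<in> coset D P \<sigma> p"
  by (simp add: coset_def tensor_rel.zero)

lemma coset_eq: "p - q \<in> tensor_rel D P \<sigma> \<Longrightarrow> coset D P \<sigma> p = coset D P \<sigma> q"
proof -
  assume pq: "p - q \<in> tensor_rel D P \<sigma>"
  have "x - p \<in> tensor_rel D P \<sigma> \<longleftrightarrow> x - q \<in> tensor_rel D P \<sigma>" for x
  proof
    assume "x - p \<in> tensor_rel D P \<sigma>"
    from tensor_rel_add[OF this pq] show "x - q \<in> tensor_rel D P \<sigma>" by simp
  next
    assume "x - q \<in> tensor_rel D P \<sigma>"
    from tensor_rel.diff[OF this pq] show "x - p \<in> tensor_rel D P \<sigma>" by simp
  qed
  then show ?thesis by (simp add: coset_def)
qed

definition balanced :: "('v::real_vector, 'd::real_vector, 's::idom, 'h::ring_1, 'g::ring_1) hecke \<Rightarrow> 'v set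
    \<Rightarrow> ('h \<Rightarrow> 'u::ab_group_add \<Rightarrow> 'u) \<Rightarrow> ('h \<times> 'u \<Rightarrow> 'b::ring_1) \<Rightarrow> bool" where
  "balanced D P \<sigma> g \<longleftrightarrow> (\<forall>h h' u. g (h + h', u) = g (h, u) + g (h', u)) \<and>
     (\<forall>h u u'. g (h, u + u') = g (h, u) + g (h, u')) \<and>
     (\<forall>h u. \<forall>m\<in>par_alg D P. g (h * m, u) = g (h, \<sigma> m u))"

lemma lift_tensor_rel:
  assumes "balanced D P \<sigma> g" "p \<in> tensor_rel D P \<sigma>"
  shows "lift g p = 0"
  using assms(2)
  by (induction rule: tensor_rel.induct)
     (use assms(1) in \<open>simp_all add: lift_0 lift_diff lift_single_1 balanced_def\<close>)

lemma lift_coset: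
  assumes "balanced D P \<sigma> g" "q \<in> coset D P \<sigma> p"
  shows "lift g q = lift g p"
  using lift_tensor_rel[OF assms(1), of "q - p"] assms(2) by (simp add: coset_def lift_diff)

lemma free_act_superset:
  "finite S \<Longrightarrow> Poly_Mapping.keys p \<subseteq> S \<Longrightarrow>
    free_act h p = (\<Sum>x\<in>S. Poly_Mapping.single (h * fst x, snd x) (Poly_Mapping.lookup p x))"
  unfolding free_act_def case_prod_unfold
  by (rule sum.mono_neutral_cong_left) (auto simp: in_keys_iff)

lemma free_act_diff: "free_act h (p - q) = free_act h p - free_act h q"
proof -
  let ?S = "Poly_Mapping.keys p \<union> Poly_Mapping.keys q"
  have k: "Poly_Mapping.keys (p - q) \<subseteq> ?S" by (auto simp: in_keys_iff lookup_minus)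
  show ?thesis
    using free_act_superset[of ?S "p - q" h] free_act_superset[of ?S p h] free_act_superset[of ?S q h] k
    by (simp add: lookup_minus single_diff sum_subtractf)
qed

lemma free_act_single: "free_act h (Poly_Mapping.single (g, u) 1) = Poly_Mapping.single (h * g, u) 1"
  by (simp add: free_act_def)

lemma free_act_tensor_rel:
  "p \<in> tensor_rel D P \<sigma> \<Longrightarrow> free_act h p \<in> tensor_rel D P \<sigma>"
proof (induction rule: tensor_rel.induct)
  case zero
  show ?case by (simp add: free_act_def tensor_rel.zero)
next
  case (diff p q)
  show ?case unfolding free_act_diff using diff.IH by (rule tensor_rel.diff)
next
  case (addl g g' u)
  show ?case unfolding free_act_diff free_act_single distrib_left by (rule tensor_rel.addl)
next
  case (addr g u u')
  show ?case unfolding free_act_diff free_act_single by (rule tensor_rel.addr)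
next
  case (bal m g u)
  then show ?case unfolding free_act_diff free_act_single mult.assoc[symmetric] by (rule tensor_rel.bal)
qed

lemma ind_act_coset: "ind_act D P \<sigma> h (coset D P \<sigma> p) = coset D P \<sigma> (free_act h p)"
proof -
  have "coset D P \<sigma> (free_act h q) = coset D P \<sigma> (free_act h p)" if "q \<in> coset D P \<sigma> p" for q
    using that free_act_tensor_rel[of "q - p" D P \<sigma> h] by (intro coset_eq) (simp add: coset_def free_act_diff)
  then show ?thesis unfolding ind_act_def using coset_self[of p D P \<sigma>] by blast
qed

lemma ind_add_coset: "ind_add (coset D P \<sigma> p) (coset D P \<sigma> q) = coset D P \<sigma> (p + q)"
proof (intro equalityI subsetI)
  fix x assume "x \<in> ind_add (coset D P \<sigma> p) (coset D P \<sigma> q)"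
  then obtain p' q' where x: "x = p' + q'" "p' - p \<in> tensor_rel D P \<sigma>" "q' - q \<in> tensor_rel D P \<sigma>"
    by (auto simp: ind_add_def coset_def)
  have "x - (p + q) = (p' - p) + (q' - q)" by (simp add: x(1))
  moreover have "\<dots> \<in> tensor_rel D P \<sigma>" using x(2,3) by (rule tensor_rel_add)
  ultimately show "x \<in> coset D P \<sigma> (p + q)" unfolding coset_def by (simp only: mem_Collect_eq)
next
  fix x assume "x \<in> coset D P \<sigma> (p + q)"
  then have "x - p \<in> coset D P \<sigma> q" by (simp add: coset_def diff_diff_eq)
  moreover have "x = p + (x - p)" by simp
  ultimately show "x \<in> ind_add (coset D P \<sigma> p) (coset D P \<sigma> q)"
    unfolding ind_add_def using coset_self[of p D P \<sigma>] by blast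
qed

lemma lift_free_act: "lift g (free_act h p) = lift (\<lambda>x. g (h * fst x, snd x)) p"
  unfolding free_act_superset[OF finite_keys subset_refl] lift_sum lift_single by (simp add: lift_def)


section \<open>The star operation\<close>

context hecke begin

lemma star_add: "star D (x + y) = star D x + star D y"
  and star_mult: "star D (x * y) = star D y * star D x"
  and star_scal_mult: "star D (scal D z * x) = scal D (cnj z) * star D x"
  and star_tw: "w \<in> W \<Longrightarrow> star D (tw D w) = tw D (inv w)"
  and star_cvec: "star D (pol D (cvec D u v)) = pol D (cvec D u (- v))"
  using star_op unfolding star_operation_def by blast+

lemma star_1: "star D 1 = 1"
  using star_tw[OF id_weyl] unfolding inv_id tw_id .

lemma star_0: "star D 0 = 0" using star_add[of 0 0] by (metis add_0 add_cancel_right_right)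

lemma star_diff: "star D (x - y) = star D x - star D y"
  using star_add[of "x - y" y] by simp

lemma star_sum: "star D (sum g I) = (\<Sum>i\<in>I. star D (g i))"
  by (induction I rule: infinite_finite_induct) (simp_all add: star_0 star_add)

lemma star_scal: "star D (scal D z) = scal D (cnj z)"
  using star_scal_mult[of z 1] by (simp add: star_1)

lemma star_inc: "star D (pol D (inc D v)) = pol D (inc D v)"
  using star_cvec[of v 0] by (simp add: cvec_def inc_0)

lemma star_pol: "\<exists>b. star D (pol D a) = pol D b"
proof (induction a rule: sym_induct)
  case (const z)
  show ?case using star_scal[of z] by (auto simp: scal_def)
next
  case (inc v)
  show ?case using star_inc by blast
next
  case (add a b)
  then show ?case by (metis star_add pol_simps(2))
next
  case (mult a b)
  then show ?case by (metis star_mult pol_simps(3))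
qed

lemma star_star_pol: "star D (star D (pol D a)) = pol D a"
proof (induction a rule: sym_induct)
  case (const z)
  show ?case using star_scal[of z] star_scal[of "cnj z"] by (simp add: scal_def)
next
  case (inc v)
  show ?case by (simp add: star_inc)
next
  case (add a b)
  then show ?case by (simp add: star_add pol_simps)
next
  case (mult a b)
  then show ?case by (simp add: star_mult pol_simps)
qed

lemma star_star: "star D (star D h) = h"
proof -
  obtain f where f: "h = (\<Sum>w\<in>W. tw D w * pol D (f w))" using emb_coeffs by blast
  have "star D (star D (tw D w)) = tw D w" if "w \<in> W" for w
    using that by (simp add: star_tw weyl_inv)
  then show ?thesis by (simp add: f star_sum star_mult star_star_pol)
qed

lemma star_par_alg: "P \<subseteq> simple D \<Longrightarrow> n \<in> par_alg D P \<Longrightarrow> star D n \<in> par_alg D P"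
proof (rotate_tac 1, induction rule: par_alg_induct)
  case (tw m)
  then have "star D (tw D m) = tw D (inv m)" using par_weyl star_tw by blast
  then show ?case using par_alg_tw[OF par_inv[OF tw(2,1)]] by simp
next
  case (pol a)
  obtain b where "star D (pol D a) = pol D b" using star_pol by blast
  then show ?case using par_alg_pol by simp
next
  case (diff x y)
  then show ?case by (simp add: star_diff par_alg_diff)
next
  case (mult x y)
  then show ?case by (simp add: star_mult par_alg_mult)
qed

end


section \<open>The form\<close>

text \<open>  In this locale \<open>HM\<close> and \<open>HN\<close> are the two parabolic subalgebras, \<open>tr\<close> is the isomorphism between them,
  \<open>\<rho>\<close> the transferred module, and \<open>d0\<close> the central element of \<open>HN\<close> that clears the denominators of all
  values of the form.\<close>

locale hecke_module = hecke D
  for D :: "('v::real_vector, 'd::real_vector, 's::idom, 'h::ring_1, 'g::ring_1) hecke" +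
  fixes P :: "'v set"
    and scl :: "complex \<Rightarrow> 'u::ab_group_add \<Rightarrow> 'u"
    and \<sigma> :: "'h \<Rightarrow> 'u \<Rightarrow> 'u"
    and B :: "'u \<Rightarrow> 'u \<Rightarrow> complex"
  assumes P: "P \<subseteq> simple D"
    and fd: "fd_module D (par_alg D P) scl \<sigma>"
    and herm: "hermitian_form scl B"
    and inv_form: "star_invariant D (par_alg D P) UNIV \<sigma> B"
    and regular: "\<And>h1 h2. regular_at D (dual_par D P) (twist D P \<sigma>) (form_elt D P h1 h2)"
begin

abbreviation "\<rho> \<equiv> twist D P \<sigma>"
abbreviation "HM \<equiv> par_alg D P"
abbreviation "HN \<equiv> par_alg D (dual_par D P)"
abbreviation "tr \<equiv> transfer D P"
abbreviation "d0 \<equiv> pol D (den_prod (w_up D P))"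

lemma sigma_simps:
  "\<sigma> 1 u = u" "\<sigma> (scal D z) u = scl z u" "m \<in> HM \<Longrightarrow> \<sigma> m (u + v) = \<sigma> m u + \<sigma> m v"
  "m \<in> HM \<Longrightarrow> n \<in> HM \<Longrightarrow> \<sigma> (m + n) u = \<sigma> m u + \<sigma> n u"
  "m \<in> HM \<Longrightarrow> n \<in> HM \<Longrightarrow> \<sigma> (m * n) u = \<sigma> m (\<sigma> n u)"
  using fd by (simp_all add: fd_module_def)

lemma rho_tr: "n \<in> HM \<Longrightarrow> \<rho> (tr n) = \<sigma> n"
  unfolding twist_def using transfer_bij[OF P] by (simp add: bij_betw_inv_into_left)

lemma HN_tr: "m \<in> HN \<Longrightarrow> \<exists>n\<in>HM. m = tr n"
  using transfer_bij[OF P] unfolding bij_betw_def by blast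

lemma tr_HN: "n \<in> HM \<Longrightarrow> tr n \<in> HN"
  using transfer_bij[OF P] unfolding bij_betw_def by blast

lemma rho_simps:
  assumes "m \<in> HN" "n \<in> HN"
  shows "\<rho> m (u + v) = \<rho> m u + \<rho> m v" "\<rho> (m + n) u = \<rho> m u + \<rho> n u" "\<rho> (m * n) u = \<rho> m (\<rho> n u)"
proof -
  obtain m' n' where m: "m' \<in> HM" "m = tr m'" and n: "n' \<in> HM" "n = tr n'" using HN_tr assms by blast
  show "\<rho> m (u + v) = \<rho> m u + \<rho> m v" unfolding m(2) rho_tr[OF m(1)] by (rule sigma_simps(3)[OF m(1)])
  have "m + n = tr (m' + n')" "m * n = tr (m' * n')"
    using transfer_simps(1,2)[OF P m(1) n(1)] m n by simp_all
  then show "\<rho> (m + n) u = \<rho> m u + \<rho> n u" "\<rho> (m * n) u = \<rho> m (\<rho> n u)"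
    using m n sigma_simps(4,5)[OF m(1) n(1)] by (simp_all add: rho_tr par_alg_add par_alg_mult)
qed

lemma rho_pol_commute: "\<rho> (pol D a) (\<rho> (pol D b) u) = \<rho> (pol D b) (\<rho> (pol D a) u)"
proof -
  have "pol D a * pol D b = pol D b * pol D a" by (simp add: mult.commute flip: pol_simps(3))
  then show ?thesis
    using rho_simps(3)[OF par_alg_pol par_alg_pol, of a b u] rho_simps(3)[OF par_alg_pol par_alg_pol, of b a u]
    by simp
qed

lemma form_simps:
  "B (u + v) w = B u w + B v w" "B u (v + w) = B u v + B u w"
  "B (scl z u) v = z * B u v" "B u (scl z v) = cnj z * B u v"
proof -
  show a: "B (u + v) w = B u w + B v w" "B (scl z u) v = z * B u v" for u v w z
    using herm unfolding hermitian_form_def by blast+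
  have c: "B v u = cnj (B u v)" for u v using herm unfolding hermitian_form_def by blast
  show "B u (v + w) = B u v + B u w" 
    unfolding c[of u "v + w"] c[of u v] c[of u w] a(1) by simp
  show "B u (scl z v) = cnj z * B u v" 
    unfolding c[of u "scl z v"] c[of u v] a(2) by simp
qed

text \<open>  Let \<open>q\<close> be a denominator for the value at \<open>h\<^sub>1 = h\<^sub>2 = 1\<close> that acts bijectively. Comparing coefficients at the
  identity shows that \<open>q\<close> times the leading coefficient of \<open>R\<close> is a polynomial, so \<open>den_prod_dvd\<close> makes \<open>q\<close>
  a multiple of \<open>den_prod\<close>; a factor of a bijective product of commuting operators is bijective.\<close>

lemma d0_bij: "bij (\<rho> d0)"
proof -
  let ?u = "w_up D P"
  have u: "?u \<in> W" using w0_weyl[OF P] .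
  have top: "form_elt D P 1 1 = top_part P (R_elt D ?u)"
    by (simp add: form_elt_top[OF P] star_1 emb_simps)
  obtain m q where q: "bij (\<rho> (pol D q))" "form_elt D P 1 1 * r (Fract q 1) = emb D m"
    using regular[of 1 1] unfolding regular_at_def fraction_at_def by blast
  obtain f where f: "\<And>w. w \<in> W \<Longrightarrow> cf (emb D m) w = Fract (f w) 1" using emb_coeffs by blast
  have q_coeff: "cf (R_elt D ?u) ?u * Fract q 1 = Fract (f id) 1"
    using arg_cong[OF q(2), of "\<lambda>x. cf x id"] f[OF id_weyl]
    unfolding top cf_right cf_top[OF P id_weyl] comp_id by (simp only: refl_group.one if_True)
  have "Fract (num_prod ?u) 1 * Fract q 1 = (cf (R_elt D ?u) ?u * Fract q 1) * Fract (den_prod ?u) 1"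
    unfolding R_elt_leading(2)[OF u, symmetric] by (simp only: mult_ac)
  then have "Fract (num_prod ?u) 1 * Fract q 1 = Fract (f id) 1 * Fract (den_prod ?u) 1"
    unfolding q_coeff .
  then have "num_prod ?u * q = f id * den_prod ?u" by (simp add: eq_fract)
  then have "den_prod ?u dvd num_prod ?u * q" by simp
  then have "den_prod ?u dvd q" by (rule den_prod_dvd)
  then obtain q' where q': "q = den_prod ?u * q'" by (rule dvdE)
  have c: "\<rho> (pol D q) v = \<rho> d0 (\<rho> (pol D q') v)" for v
    unfolding q' pol_simps(3) by (rule rho_simps(3)[OF par_alg_pol par_alg_pol])
  show ?thesis
  proof (rule bijI)
    show "inj (\<rho> d0)"
    proof (rule injI)
      fix x y assume "\<rho> d0 x = \<rho> d0 y"
      then have "\<rho> (pol D q) x = \<rho> (pol D q) y" unfolding c rho_pol_commute[of "den_prod ?u"] by simp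
      then show "x = y" using q(1) by (meson bij_is_inj injD)
    qed
    show "surj (\<rho> d0)"
    proof (rule surjI)
      show "\<rho> d0 (\<rho> (pol D q') (inv (\<rho> (pol D q)) x)) = x" for x
        unfolding c[symmetric] using q(1) by (simp add: bij_is_surj surj_f_inv_f)
    qed
  qed
qed

abbreviation "I \<equiv> inv (\<rho> d0)"

lemma I_left: "I (\<rho> d0 v) = v" and I_right: "\<rho> d0 (I v) = v"
  using d0_bij by (simp_all add: bij_is_inj bij_is_surj surj_f_inv_f)

lemma I_add: "I (u + v) = I u + I v"
  using rho_simps(1)[OF par_alg_pol par_alg_pol, of "den_prod (w_up D P)" "I u" "I v"] I_left I_right by metis

text \<open>  Centrality of the denominator is what makes evaluation multiplicative.\<close>

lemma I_rho: "m \<in> HN \<Longrightarrow> I (\<rho> m v) = \<rho> m (I v)"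
proof -
  assume m: "m \<in> HN"
  have "\<rho> d0 (\<rho> m (I v)) = \<rho> m (\<rho> d0 (I v))"
    using rho_simps(3)[OF m par_alg_pol] rho_simps(3)[OF par_alg_pol m] q0_central[OF P m] by metis
  then show ?thesis using I_left I_right by metis
qed

text \<open>  Two fractions for the same element have proportional numerators, and polynomials act by
  commuting operators, so any admissible fraction gives the same operator as the one with denominator \<open>d0\<close>.\<close>

lemma eval_at_eq:
  assumes m: "m \<in> HN" and x: "x * emb D d0 = emb D m"
  shows "eval_at D (dual_par D P) \<rho> x = (\<lambda>v. \<rho> m (I v))"
proof -
  let ?q = "den_prod (w_up D P)"
  have fr: "fraction_at D (dual_par D P) \<rho> x m ?q"
    unfolding fraction_at_def using m x d0_bij den_prod_nonzero by (simp add: emb_pol)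
  have "\<rho> m' \<circ> inv (\<rho> (pol D q')) = \<rho> m \<circ> I" if f: "fraction_at D (dual_par D P) \<rho> x m' q'" for m' q'
  proof
    fix v
    have m': "m' \<in> HN" and b: "bij (\<rho> (pol D q'))" and x': "x * E q' = emb D m'"
      using f unfolding fraction_at_def by (simp_all add: emb_pol)
    have "emb D (m * pol D q') = x * (E ?q * E q')" by (simp add: emb_simps x[symmetric] mult.assoc)
    also have "\<dots> = x * (E q' * E ?q)" unfolding E_commute[of ?q] ..
    also have "\<dots> = emb D (m' * d0)" by (simp add: emb_simps x'[symmetric] mult.assoc)
    finally have e: "m * pol D q' = m' * d0" by (rule emb_inj)
    define w where "w = I (inv (\<rho> (pol D q')) v)"
    have 1: "inv (\<rho> (pol D q')) v = \<rho> d0 w" by (simp add: w_def I_right)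
    then have "v = \<rho> (pol D q') (\<rho> d0 w)" using b by (metis bij_is_surj surj_f_inv_f)
    then have 2: "I v = \<rho> (pol D q') w" unfolding rho_pol_commute[of q'] by (simp only: I_left)
    have "\<rho> m' (\<rho> d0 w) = \<rho> m (\<rho> (pol D q') w)"
      using rho_simps(3)[OF m' par_alg_pol] rho_simps(3)[OF m par_alg_pol] e by metis
    then show "(\<rho> m' \<circ> inv (\<rho> (pol D q'))) v = (\<rho> m \<circ> I) v" using 1 2 by simp
  qed
  then have "eval_at D (dual_par D P) \<rho> x = \<rho> m \<circ> I"
    unfolding eval_at_def using fr by (intro the_equality) blast+
  then show ?thesis by (simp add: comp_def)
qed

text \<open>  The numerator over \<open>d0\<close> of the top component of \<open>h R\<^sup>0\<close>; it is additive in \<open>h\<close> and turns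
  multiplication by \<open>HM\<close> on either side into multiplication by \<open>HN\<close>.\<close>

definition top_num :: "'h \<Rightarrow> 'h" where
  "top_num h = (SOME n. n \<in> HN \<and> top_part P (emb D h * R_elt D (w_up D P)) * emb D d0 = emb D n)"

lemma top_num: "top_num h \<in> HN" "top_part P (emb D h * R_elt D (w_up D P)) * emb D d0 = emb D (top_num h)"
proof -
  have "\<exists>n. n \<in> HN \<and> top_part P (emb D h * R_elt D (w_up D P)) * emb D d0 = emb D n"
    using top_den[OF P, of h] by blast
  from someI_ex[OF this]
  show "top_num h \<in> HN" "top_part P (emb D h * R_elt D (w_up D P)) * emb D d0 = emb D (top_num h)"
    unfolding top_num_def by blast+
qed

lemma top_num_add: "top_num (h + h') = top_num h + top_num h'"
  by (rule emb_inj) (simp add: emb_simps distrib_right top_add[OF P] flip: top_num(2))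

lemma top_num_right:
  assumes n: "n \<in> HM"
  shows "top_num (h * n) = top_num h * tr n"
proof (rule emb_inj)
  let ?R = "R_elt D (w_up D P)"
  have s: "emb D (tr n) \<in> supp (refl_group D (dual_par D P))"
    by (rule emb_par_alg[OF dual_par_simple[OF P] tr_HN[OF n]])
  have c: "emb D (tr n) * emb D d0 = emb D d0 * emb D (tr n)"
    using q0_central[OF P tr_HN[OF n]] by (simp flip: emb_simps(3))
  have "emb D (h * n) * ?R = (emb D h * ?R) * emb D (tr n)"
    using transfer_R0[OF P n] by (simp add: emb_simps mult.assoc)
  then have "top_part P (emb D (h * n) * ?R) = top_part P (emb D h * ?R) * emb D (tr n)"
    using top_right[OF P s] by (simp only:)
  then have "emb D (top_num (h * n)) = top_part P (emb D h * ?R) * (emb D (tr n) * emb D d0)"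
    unfolding top_num(2)[symmetric] by (simp only: mult.assoc)
  also have "\<dots> = emb D (top_num h * tr n)"
    unfolding c emb_simps(3) top_num(2)[symmetric] by (simp only: mult.assoc)
  finally show "emb D (top_num (h * n)) = emb D (top_num h * tr n)" .
qed

lemma top_num_left: "n \<in> HM \<Longrightarrow> top_num (n * h) = tr n * top_num h"
  by (rule emb_inj) (simp add: emb_simps(3) mult.assoc top_left[OF P] flip: top_num(2))

definition pre_form :: "'h \<Rightarrow> 'u \<Rightarrow> 'u \<Rightarrow> complex" where
  "pre_form h v w = B (\<rho> (top_num h) (I v)) w"

lemma pre_form_add:
  "pre_form (h + h') v w = pre_form h v w + pre_form h' v w"
  "pre_form h (v + v') w = pre_form h v w + pre_form h v' w"
  "pre_form h v (w + w') = pre_form h v w + pre_form h v w'"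
  using rho_simps[OF top_num(1) top_num(1)]
  by (simp_all add: pre_form_def top_num_add I_add form_simps)

lemma pre_form_right: "n \<in> HM \<Longrightarrow> pre_form (h * n) v w = pre_form h (\<sigma> n v) w"
  unfolding pre_form_def
  using rho_simps(3)[OF top_num(1) tr_HN] I_rho[OF tr_HN] by (simp add: top_num_right flip: rho_tr)

lemma pre_form_left: "n \<in> HM \<Longrightarrow> pre_form (star D n * h) v w = pre_form h v (\<sigma> n w)"
proof -
  assume n: "n \<in> HM"
  have s: "star D n \<in> HM" using star_par_alg[OF P n] .
  have "pre_form (star D n * h) v w = B (\<sigma> (star D n) (\<rho> (top_num h) (I v))) w"
    unfolding pre_form_def top_num_left[OF s] rho_simps(3)[OF tr_HN[OF s] top_num(1)] rho_tr[OF s] ..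
  also have "\<dots> = B (\<rho> (top_num h) (I v)) (\<sigma> (star D (star D n)) w)"
    using inv_form s unfolding star_invariant_def by blast
  finally show ?thesis unfolding star_star pre_form_def .
qed

text \<open>  The prescribed value of the form on a pair of pure tensors, see \<open>pair_form_eval\<close>.\<close>

definition pair_form :: "'h \<times> 'u \<Rightarrow> 'h \<times> 'u \<Rightarrow> complex" where
  "pair_form x y = pre_form (star D (fst y) * fst x) (snd x) (snd y)"

lemma pair_form_eval:
  "pair_form (h1, v1) (h2, v2) = B (eval_at D (dual_par D P) \<rho> (form_elt D P h1 h2) v1) v2"
  using eval_at_eq[OF top_num, of "star D h2 * h1"]
  by (simp add: pair_form_def pre_form_def form_elt_top[OF P])

lemma pair_form_balanced_left: "balanced D P \<sigma> (\<lambda>x. pair_form x y)"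
  unfolding balanced_def pair_form_def
  by (auto simp: distrib_left pre_form_add pre_form_right simp flip: mult.assoc)

lemma pair_form_balanced_right: "balanced D P \<sigma> (pair_form x)"
  unfolding balanced_def pair_form_def
  by (auto simp: star_add star_mult distrib_right pre_form_add pre_form_left mult.assoc)

lemma pair_form_star: "pair_form (h * fst x, snd x) y = pair_form x (star D h * fst y, snd y)"
  by (simp add: pair_form_def star_mult star_star mult.assoc)

lemma scal_HM: "scal D z \<in> HM"
  unfolding scal_def by (rule par_alg_pol)

text \<open>  A scalar in the second slot comes out on the left of the product and is moved back into the second slot as a
  scalar of the module by \<open>pre_form_left\<close>.\<close>

lemma pair_form_scal_right: "pair_form x (scal D z * fst y, snd y) = cnj z * pair_form x y"
proof -
  have "pair_form x (scal D z * fst y, snd y) = pre_form (star D (scal D z) * (star D (fst y) * fst x)) (snd x) (snd y)"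
    unfolding pair_form_def fst_conv snd_conv star_scal_mult star_scal mult.assoc ..
  also have "\<dots> = cnj z * pair_form x y"
    unfolding pre_form_left[OF scal_HM] sigma_simps(2) by (simp add: pre_form_def form_simps pair_form_def)
  finally show ?thesis .
qed

lemma pair_form_scal_left: "pair_form (scal D z * fst x, snd x) y = z * pair_form x y"
  using pair_form_star[of "scal D z" x y] pair_form_scal_right[of x "cnj z" y] by (simp add: star_scal)

definition free_form :: "('h \<times> 'u \<Rightarrow>\<^sub>0 int) \<Rightarrow> ('h \<times> 'u \<Rightarrow>\<^sub>0 int) \<Rightarrow> complex" where
  "free_form p q = lift (\<lambda>x. lift (pair_form x) q) p"

lemma free_form_add:
  "free_form (p + p') q = free_form p q + free_form p' q"
  "free_form p (q + q') = free_form p q + free_form p q'"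
  by (simp_all add: free_form_def lift_plus lift_add_fun)

lemma free_form_coset:
  assumes "p' \<in> coset D P \<sigma> p" "q' \<in> coset D P \<sigma> q"
  shows "free_form p' q' = free_form p q"
proof -
  have "balanced D P \<sigma> (\<lambda>x. lift (pair_form x) q)"
    unfolding balanced_def
  proof (intro conjI allI ballI)
    note b = pair_form_balanced_left[unfolded balanced_def]
    show "lift (pair_form (h + h', u)) q = lift (pair_form (h, u)) q + lift (pair_form (h', u)) q" for h h' u
      unfolding lift_add_fun[symmetric] using b by (intro arg_cong[of _ _ "\<lambda>f. lift f q"] ext) blast
    show "lift (pair_form (h, u + u')) q = lift (pair_form (h, u)) q + lift (pair_form (h, u')) q" for h u u'
      unfolding lift_add_fun[symmetric] using b by (intro arg_cong[of _ _ "\<lambda>f. lift f q"] ext) blast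
    show "lift (pair_form (h * m, u)) q = lift (pair_form (h, \<sigma> m u)) q" if "m \<in> HM" for h u m
      using b that by (intro arg_cong[of _ _ "\<lambda>f. lift f q"] ext) blast
  qed
  from lift_coset[OF this assms(1)] lift_coset[OF pair_form_balanced_right assms(2)]
  show ?thesis unfolding free_form_def by simp
qed

text \<open>  The representatives are chosen arbitrarily; by \<open>free_form_coset\<close> the value does not depend on them.\<close>

definition ind_form :: "('h, 'u) ind \<Rightarrow> ('h, 'u) ind \<Rightarrow> complex" where
  "ind_form X Y = free_form (SOME p. p \<in> X) (SOME q. q \<in> Y)"

lemma ind_form_coset: "ind_form (coset D P \<sigma> p) (coset D P \<sigma> q) = free_form p q"
  unfolding ind_form_def by (rule free_form_coset; rule someI, rule coset_self)

lemma ind_form_tensor: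
  "ind_form (tensor D P \<sigma> h1 v1) (tensor D P \<sigma> h2 v2) =
    B (eval_at D (dual_par D P) \<rho> (form_elt D P h1 h2) v1) v2"
  unfolding tensor_def ind_form_coset free_form_def lift_single_1 by (rule pair_form_eval)

lemma free_form_act: "free_form (free_act h p) q = free_form p (free_act (star D h) q)"
  unfolding free_form_def lift_free_act pair_form_star ..

lemma ind_form_star_invariant: "star_invariant D UNIV (ind_module D P \<sigma>) (ind_act D P \<sigma>) ind_form"
  unfolding star_invariant_def ind_module_def by (auto simp: ind_act_coset ind_form_coset free_form_act)

lemma free_form_scal:
  "free_form (free_act (scal D z) p) q = z * free_form p q"
  "free_form p (free_act (scal D z) q) = cnj z * free_form p q"
proof -
  have "pair_form (scal D z * fst x, snd x) = (\<lambda>y. z * pair_form x y)" for x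
    by (rule ext) (rule pair_form_scal_left)
  then show "free_form (free_act (scal D z) p) q = z * free_form p q"
    by (simp add: free_form_def lift_free_act lift_scale_fun)
  show "free_form p (free_act (scal D z) q) = cnj z * free_form p q"
    by (simp add: free_form_def lift_free_act pair_form_scal_right lift_scale_fun)
qed

lemma ind_form_sesquilinear: "ind_sesquilinear D P \<sigma> ind_form"
  unfolding ind_sesquilinear_def ind_module_def
  by (auto simp: ind_act_coset ind_add_coset ind_form_coset free_form_add free_form_scal)

end

theorem proposition3p8p1:
  fixes D :: "('v::real_vector, 'd::real_vector, 's::idom, 'h::ring_1, 'g::ring_1) hecke"
    and P :: "'v set"
    and scl :: "complex \<Rightarrow> 'u::ab_group_add \<Rightarrow> 'u"
    and \<sigma> :: "'h \<Rightarrow> 'u \<Rightarrow> 'u"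
    and B :: "'u \<Rightarrow> 'u \<Rightarrow> complex"
  assumes "graded_hecke D"
    and "P \<subseteq> simple D"
    and "fd_module D (par_alg D P) scl \<sigma>"
    and "hermitian_form scl B"
    and "star_invariant D (par_alg D P) UNIV \<sigma> B"
    and "\<And>h1 h2. regular_at D (dual_par D P) (twist D P \<sigma>) (form_elt D P h1 h2)"
  shows "\<exists>F. (\<forall>h1 h2 v1 v2.
               F (tensor D P \<sigma> h1 v1) (tensor D P \<sigma> h2 v2) =
                 B (eval_at D (dual_par D P) (twist D P \<sigma>) (form_elt D P h1 h2) v1) v2) \<and>
             star_invariant D UNIV (ind_module D P \<sigma>) (ind_act D P \<sigma>) F \<and>
             ind_sesquilinear D P \<sigma> F"
proof -
  interpret hecke_module D P scl \<sigma> B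
    by unfold_locales (fact assms)+
  show ?thesis
    using ind_form_tensor ind_form_star_invariant ind_form_sesquilinear by blast
qed

end
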